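(* Let $(\tau_1,\tau_2,\tau_3)=(0,0,1)$. Let $N,\ell$ be positive integers with $\ell\le N$, let $U_0\in H^N(\mathbb{R})\cap L^1(\mathbb{R})$, and let $U$ be the solution of the Cauchy problem (S) (described in the context) with initial datum $U_0$. Then, for any $j\in\{0,\dots,N-\ell\}$, there exist $c_0,\tilde c_0>0$ such that, for any $t\ge 0$, the following holds. Case $\epsilon_0=1$: if $k_1=k_2=k_3$, then $$\|\partial_x^jU(\cdot,t)\|_{L^2(\mathbb{R})}\le c_0(1+t)^{-1/12-j/6}\|U_0\|_{L^1(\mathbb{R})}+c_0e^{-\tilde c_0t}\|\partial_x^{j+\ell}U_0\|_{L^2(\mathbb{R})},$$ and if $k_1=k_2=k_3$ does not hold, then $$\|\partial_x^jU(\cdot,t)\|_{L^2(\mathbb{R})}\le c_0(1+t)^{-1/12-j/6}\|U_0\|_{L^1(\mathbb{R})}+c_0(1+t)^{-\ell/4}\|\partial_x^{j+\ell}U_0\|_{L^2(\mathbb{R})}.$$ Case $\epsilon_0=0$: if $k_1=k_2=k_3$, then $$\|\partial_x^jU(\cdot,t)\|_{L^2(\mathbb{R})}\le c_0(1+t)^{-1/8-j/4}\|U_0\|_{L^1(\mathbb{R})}+c_0(1+t)^{-\ell/2}\|\partial_x^{j+\ell}U_0\|_{L^2(\mathbb{R})},$$ and if $k_1=k_2=k_3$ does not hold, then $$\|\partial_x^jU(\cdot,t)\|_{L^2(\mathbb{R})}\le c_0(1+t)^{-1/8-j/4}\|U_0\|_{L^1(\mathbb{R})}+c_0(1+t)^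{-\ell/4}\|\partial_x^{j+\ell}U_0\|_{L^2(\mathbb{R})}.$$
   Context: Constants: $k_1,k_2,k_3,k_4,k_5>0$, $\gamma\in\mathbb{R}\setminus\{0\}$, $(\tau_1,\tau_2,\tau_3)\in\{(1,0,0),(0,1,0),(0,0,1)\}$, $\epsilon_0\in\{0,1\}$. Cauchy problem (S): for $x\in\mathbb{R}$, $t>0$, the unknown is $U=(v,u,z,y,\phi,\theta,\sigma,\eta)^T$, with $U(\cdot,0)=U_0$ and $$\begin{cases} v_t-u_x-y-\theta=0,\\ u_t-k_1v_x+\tau_1\gamma\eta_x=0,\\ z_t-y_x=0,\\ y_t-k_2z_x+k_1v+\tau_2\gamma\eta_x=0,\\ \phi_t-\theta_x=0,\\ \theta_t-k_3\phi_x+k_1v+\tau_3\gamma\eta_x=0,\\ \sigma_t-\eta_x=0,\\ \eta_t-k_4\sigma_x+(-1)^{\epsilon_0}k_5\partial_x^{2\epsilon_0}\eta+\gamma(\tau_1u_x+\tau_2y_x+\tau_3\theta_x)=0. \end{cases}$$ So the dissipation term is $-k_5\eta_{xx}$ if $\epsilon_0=1$ and $k_5\eta$ if $\epsilon_0=0$. (It arises from a laminated Timoshenko beam $(\varphi,\psi,w)$ coupled to a temperature variable $q$ by $u=\varphi_t$, $y=\psi_t$, $\theta=w_t$, $\eta=q_t$, $v=\varphi_x+\psi+w$, $z=\psi_x$, $\phi=w_x$, $\sigma=q_x$.) Taking the Fourier transform $\widehat{\cdot}$ in $x$ (so $\partial_x$ becomes multiplication by $i\xi$), (S) becomes for each $\xi\in\mathbb{R}$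 a linear constant-coefficient ODE system $\widehat U_t(\xi,t)=A(\xi)\widehat U(\xi,t)$ in $\mathbb{C}^8$, and the solution $U$ of (S) is the one given by $\widehat U(\xi,t)=e^{tA(\xi)}\widehat U_0(\xi)$. Norms of vector-valued functions are the usual ones (built from the Euclidean norm on $\mathbb{C}^8$). *)

theory Defs
  imports "HOL-Analysis.Analysis"
begin

section \<open>Lebesgue spaces, weak derivatives and Sobolev spaces on the real line\<close>

definition L1_norm :: "(real \<Rightarrow> 'a::euclidean_space) \<Rightarrow> real" where
  "L1_norm f = (\<integral>x. norm (f x) \<partial>lborel)"

definition square_integrable :: "(real \<Rightarrow> 'a::euclidean_space) \<Rightarrow> bool" where
  "square_integrable f \<longleftrightarrow>
     f \<in> borel_measurable lborel \<and> integrable lborel (\<lambda>x. (norm (f x))\<^sup>2)"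

text \<open>Only meaningful for square integrable functions: the Bochner integral of a
  non-integrable function is 0.\<close>

definition L2_norm :: "(real \<Rightarrow> 'a::euclidean_space) \<Rightarrow> real" where
  "L2_norm f = sqrt (\<integral>x. (norm (f x))\<^sup>2 \<partial>lborel)"

definition locally_integrable :: "(real \<Rightarrow> 'a::euclidean_space) \<Rightarrow> bool" where
  "locally_integrable f \<longleftrightarrow> (\<forall>a b. set_integrable lborel {a..b} f)"

definition test_function :: "(real \<Rightarrow> real) \<Rightarrow> bool" where
  "test_function \<phi> \<longleftrightarrow>
     (\<forall>n x. (deriv ^^ n) \<phi> field_differentiable (at x)) \<and>
     (\<exists>R. \<forall>x. \<bar>x\<bar> > R \<longrightarrow> \<phi> x = 0)"

definition has_weak_deriv ::
  "nat \<Rightarrow> (real \<Rightarrow> 'a::euclidean_space) \<Rightarrow> (real \<Rightarrow> 'a) \<Rightarrow> bool" where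
  "has_weak_deriv k f g \<longleftrightarrow> locally_integrable f \<and> locally_integrable g \<and>
     (\<forall>\<phi>. test_function \<phi> \<longrightarrow>
        (\<integral>x. (deriv ^^ k) \<phi> x *\<^sub>R f x \<partial>lborel) =
        (-1) ^ k *\<^sub>R (\<integral>x. \<phi> x *\<^sub>R g x \<partial>lborel))"

text \<open>A representative of the \<open>k\<close>-th weak derivative, which is unique up to null sets;
  unspecified if there is no weak derivative.\<close>

definition weak_deriv :: "nat \<Rightarrow> (real \<Rightarrow> 'a::euclidean_space) \<Rightarrow> real \<Rightarrow> 'a" where
  "weak_deriv k f = (SOME g. has_weak_deriv k f g)"

definition sobolev :: "nat \<Rightarrow> (real \<Rightarrow> 'a::euclidean_space) set" where
  "sobolev N = {f. square_integrable f \<and>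
     (\<forall>k\<le>N. \<exists>g. has_weak_deriv k f g \<and> square_integrable g)}"


section \<open>Fourier transform\<close>

definition fourier_L1 :: "(real \<Rightarrow> complex ^ 'n) \<Rightarrow> real \<Rightarrow> complex ^ 'n" where
  "fourier_L1 f \<xi> = (\<integral>x. cis (- (\<xi> * x)) *s f x \<partial>lborel)"

text \<open>\<open>g\<close> is (a representative of) the Fourier-Plancherel transform of \<open>f \<in> L\<^sup>2\<close>: the
  \<open>L\<^sup>2\<close>-limit, as \<open>R \<rightarrow> \<infinity>\<close>, of the transforms of the truncations of \<open>f\<close> to \<open>[-R, R]\<close>.\<close>

definition has_fourier_L2 :: "(real \<Rightarrow> complex ^ 'n) \<Rightarrow> (real \<Rightarrow> complex ^ 'n) \<Rightarrow> bool" where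
  "has_fourier_L2 f g \<longleftrightarrow> square_integrable f \<and> square_integrable g \<and>
     ((\<lambda>R. \<integral>\<^sup>+\<xi>. ennreal ((norm (g \<xi> -
          fourier_L1 (\<lambda>x. indicator {-R..R} x *\<^sub>R f x) \<xi>))\<^sup>2) \<partial>lborel) \<longlongrightarrow> 0) at_top"


section \<open>The Cauchy problem\<close>

definition matrix_exp :: "complex ^ 'n ^ 'n \<Rightarrow> complex ^ 'n ^ 'n" where
  "matrix_exp A = (\<Sum>m. (1 / fact m) *\<^sub>R (((**) A) ^^ m) (mat 1))"

text \<open>The matrix \<open>A(\<xi>)\<close>: the system is written as \<open>U\<^sub>t = A(\<partial>\<^sub>x) U\<close> for
  \<open>U = (v, u, z, y, \<phi>, \<theta>, \<sigma>, \<eta>)\<close>, one equation per row, and \<open>\<partial>\<^sub>x\<close> is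
  replaced by \<open>D = \<i>\<xi>\<close>.\<close>

definition beam_matrix ::
  "real \<Rightarrow> real \<Rightarrow> real \<Rightarrow> real \<Rightarrow> real \<Rightarrow> real \<Rightarrow> real \<times> real \<times> real \<Rightarrow> nat \<Rightarrow>
   real \<Rightarrow> complex ^ 8 ^ 8" where
  "beam_matrix k\<^sub>1 k\<^sub>2 k\<^sub>3 k\<^sub>4 k\<^sub>5 \<gamma> \<tau> \<epsilon>\<^sub>0 \<xi> =
    (let D = \<i> * complex_of_real \<xi>;
         K\<^sub>1 = complex_of_real k\<^sub>1; K\<^sub>2 = complex_of_real k\<^sub>2; K\<^sub>3 = complex_of_real k\<^sub>3;
         K\<^sub>4 = complex_of_real k\<^sub>4; K\<^sub>5 = complex_of_real k\<^sub>5;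
         (\<tau>\<^sub>1, \<tau>\<^sub>2, \<tau>\<^sub>3) = \<tau>;
         G\<^sub>1 = complex_of_real (\<tau>\<^sub>1 * \<gamma>); G\<^sub>2 = complex_of_real (\<tau>\<^sub>2 * \<gamma>);
         G\<^sub>3 = complex_of_real (\<tau>\<^sub>3 * \<gamma>)
     in vector [
       vector [0,      D,         0,      1,         0,      1,         0,      0],
       vector [K\<^sub>1 * D, 0,         0,      0,         0,      0,         0,      - (G\<^sub>1 * D)],
       vector [0,      0,         0,      D,         0,      0,         0,      0],
       vector [- K\<^sub>1,   0,         K\<^sub>2 * D, 0,         0,      0,         0,      - (G\<^sub>2 * D)],
       vector [0,      0,         0,      0,         0,      D,         0,      0],
       vector [- K\<^sub>1,   0,         0,      0,         K\<^sub>3 * D, 0,         0,      - (G\<^sub>3 * D)],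
       vector [0,      0,         0,      0,         0,      0,         0,      D],
       vector [0,      - (G\<^sub>1 * D), 0,     - (G\<^sub>2 * D), 0,      - (G\<^sub>3 * D), K\<^sub>4 * D,
               - ((-1) ^ \<epsilon>\<^sub>0 * K\<^sub>5 * D ^ (2 * \<epsilon>\<^sub>0))]])"

text \<open>\<open>U\<close>, with arguments \<open>x\<close> and \<open>t\<close>, is the solution with integrable initial datum \<open>U\<^sub>0\<close>,
  that is, the function whose transform in \<open>x\<close> is \<open>exp(t A(\<xi>))\<close> applied to the transform of
  \<open>U\<^sub>0\<close>. This determines \<open>U(\<cdot>, t)\<close> up to null sets, for every \<open>t\<close>.\<close>

definition beam_solution ::
  "real \<Rightarrow> real \<Rightarrow> real \<Rightarrow> real \<Rightarrow> real \<Rightarrow> real \<Rightarrow> real \<times> real \<times> real \<Rightarrow> nat \<Rightarrow>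
   (real \<Rightarrow> complex ^ 8) \<Rightarrow> (real \<Rightarrow> real \<Rightarrow> complex ^ 8) \<Rightarrow> bool" where
  "beam_solution k\<^sub>1 k\<^sub>2 k\<^sub>3 k\<^sub>4 k\<^sub>5 \<gamma> \<tau> \<epsilon>\<^sub>0 U\<^sub>0 U \<longleftrightarrow>
     (\<forall>t\<ge>0. has_fourier_L2 (\<lambda>x. U x t)
        (\<lambda>\<xi>. matrix_exp (t *\<^sub>R beam_matrix k\<^sub>1 k\<^sub>2 k\<^sub>3 k\<^sub>4 k\<^sub>5 \<gamma> \<tau> \<epsilon>\<^sub>0 \<xi>) *v fourier_L1 U\<^sub>0 \<xi>))"

end

theory Submission
  imports Defs "HOL-Probability.Probability" "HOL-Computational_Algebra.Fundamental_Theorem_Algebra"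
begin

text \<open>For a dissipative matrix the eigenvalues alone control the semigroup: in a Schur basis the entry
  \<open>a\<^sub>i\<^sub>k\<close> is bounded by twice the geometric mean of the absolute real parts of the \<open>i\<close>-th and
  \<open>k\<close>-th eigenvalue, so that, up to a constant depending only on the dimension, the spectral abscissa gives the
  decay rate. It therefore suffices to bound the real part of an eigenvalue of \<open>A(\<xi>)\<close> away from 0. For
  an eigenvector it equals minus the damping coefficient times \<open>\<bar>\<eta>\<bar>\<^sup>2\<close> divided by the energy, and the eight
  equations express all components through \<open>\<eta>\<close>. This gives the gap \<open>\<xi>\<^sup>6\<close> (for \<open>\<epsilon>\<^sub>0 = 1\<close>) or
  \<open>\<xi>\<^sup>4\<close> (for \<open>\<epsilon>\<^sub>0 = 0\<close>) at low frequencies, and \<open>\<xi>\<^sup>-\<^sup>4\<close>, or for equal speeds \<open>\<xi>\<^sup>-\<^sup>2\<close>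
  (\<open>\<epsilon>\<^sub>0 = 0\<close>) or 1 (\<open>\<epsilon>\<^sub>0 = 1\<close>), at high frequencies. Integrating over low frequencies with
  \<open>\<bar>\<F>U\<^sub>0\<bar> \<le> \<parallel>U\<^sub>0\<parallel>\<^sub>1\<close>, and trading \<open>l\<close> derivatives for decay at high frequencies, gives the
  theorem. On the Fourier side only the inequality half of Plancherel's theorem is needed, since
  \<open>l \<ge> 1\<close> makes the inverse transforms of the derivatives of order at most \<open>j\<close> absolutely
  convergent.\<close>

section \<open>Decay for dissipative matrices\<close>

text \<open>A bound on eigenvalues alone says little about \<open>matrix_exp\<close>, since
  eigenvectors may become nearly parallel as \<open>\<xi>\<close> varies. What makes the comparison
  uniform is dissipativity in one inner product for all \<open>\<xi>\<close>, supplied by the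
  diagonal change of variables \<open>energy_scaling\<close>. The eigenvalues are never computed. At
  each frequency the size of |a| decides what may be inverted: if |a| is small against min(1, r) r,
  every a^2 + k r^2 has size r^2 and the unknowns are slaved to \<open>\<eta>\<close>; otherwise
  division by a is affordable, and the damping is followed along the chain \<open>\<eta>\<close>,
  \<open>\<theta>\<close>, v, y. Either way energy <= const W^2 |\<open>\<eta>\<close>|^2, so that
  the gap is r^(2e) / W^2. Here W = 1/r^2 at low frequencies; at high ones W = r for equal speeds
  and r^(2+e) otherwise. The integral of |\<open>\<xi>\<close>|^(2j) exp(-c |\<open>\<xi>\<close>|^p
  t) with p = 4 + 2e is a multiple of t^(-(2j+1)/p), and its square root is the rate in front of the
  L1 norm; a gap r^(-q) trades 2l powers of r for t^(-2l/q).\<close>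

definition cip :: "complex ^ 'n \<Rightarrow> complex ^ 'n \<Rightarrow> complex" where
  "cip x y = (\<Sum>i\<in>UNIV. x $ i * cnj (y $ i))"

lemma cip_add_left: "cip (x + y) z = cip x z + cip y z"
  by (simp add: cip_def sum.distrib algebra_simps)

lemma cip_diff_left: "cip (x - y) z = cip x z - cip y z"
  by (simp add: cip_def sum_subtractf algebra_simps)

lemma cip_scale_left: "cip (c *s x) z = c * cip x z"
  by (simp add: cip_def sum_distrib_left algebra_simps)

lemma cip_scaleR_left: "cip (r *\<^sub>R x) z = of_real r * cip x z"
  unfolding cip_def by (simp add: sum_distrib_left scaleR_conv_of_real[where 'a=complex] algebra_simps)

lemma cip_zero_left [simp]: "cip 0 z = 0"
  by (simp add: cip_def)

lemma cip_sum_left: "cip (\<Sum>i\<in>I. f i) z = (\<Sum>i\<in>I. cip (f i) z)"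
  by (induction I rule: infinite_finite_induct) (simp_all add: cip_add_left)

lemma cip_commute: "cip y x = cnj (cip x y)"
  by (simp add: cip_def mult.commute)

lemma cip_add_right: "cip z (x + y) = cip z x + cip z y"
  by (simp add: cip_def sum.distrib algebra_simps)

lemma cip_scale_right: "cip z (c *s x) = cnj c * cip z x"
  by (simp add: cip_def sum_distrib_left algebra_simps)

text \<open>The inner product of the type class on \<open>complex ^ 'n\<close> is the real part of
  the Hermitian form. Real orthogonality and real dimension are therefore available for complex
  subspaces, at the price of recovering imaginary parts by hand.\<close>

lemma Re_cip: "Re (cip x y) = x \<bullet> y"
  by (simp add: cip_def inner_vec_def inner_complex_def)

lemma cip_self: "cip x x = of_real ((norm x)\<^sup>2)"
proof -
  have "cip x x = (\<Sum>i\<in>UNIV. of_real ((norm (x $ i))\<^sup>2))"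
    unfolding cip_def by (simp only: complex_norm_square)
  also have "\<dots> = of_real (\<Sum>i\<in>UNIV. (norm (x $ i))\<^sup>2)"
    by simp
  also have "(\<Sum>i\<in>UNIV. (norm (x $ i))\<^sup>2) = (norm x)\<^sup>2"
    by (simp add: norm_vec_def L2_set_def sum_nonneg)
  finally show ?thesis .
qed

lemma scaleR_vec_eq_scale: "r *\<^sub>R x = complex_of_real r *s x"
  by (simp add: vec_eq_iff scaleR_conv_of_real[where 'a=complex])

lemma matrix_vector_mult_scale:
  fixes A :: "'a::comm_semiring_1 ^ 'n ^ 'm"
  shows "A *v (c *s x) = c *s (A *v x)"
  by (simp add: matrix_vector_mult_def vec_eq_iff sum_distrib_left algebra_simps)

lemma matrix_vector_mult_sum:
  fixes A :: "'a::comm_semiring_1 ^ 'n ^ 'm"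
  shows "A *v (\<Sum>i\<in>I. f i) = (\<Sum>i\<in>I. A *v f i)"
  by (induction I rule: infinite_finite_induct) (simp_all add: matrix_vector_right_distrib)

lemma bounded_linear_cip_left: "bounded_linear (\<lambda>x. cip x z)"
  by (rule linear_conv_bounded_linear[THEN iffD1], rule linearI)
    (simp_all add: cip_add_left cip_scaleR_left scaleR_conv_of_real[where 'a=complex])

text \<open>This is the vector p(A) w.\<close>

definition krylov_eval :: "complex ^ 'n ^ 'n \<Rightarrow> complex ^ 'n \<Rightarrow> complex poly \<Rightarrow> complex ^ 'n" where
  "krylov_eval A w p = (\<Sum>i\<le>degree p. coeff p i *s (((*v) A ^^ i) w))"

lemma krylov_eval_bound:
  assumes "degree p \<le> n"
  shows "krylov_eval A w p = (\<Sum>i\<le>n. coeff p i *s (((*v) A ^^ i) w))"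
  unfolding krylov_eval_def
  by (rule sum.mono_neutral_left) (use assms in \<open>auto simp: coeff_eq_0 not_le\<close>)

text \<open>Multiplication by X - a becomes application of A - a, so a root of an annihilating
  polynomial can be split off.\<close>

lemma krylov_eval_linear_factor:
  "krylov_eval A w ([:-a, 1:] * q) = A *v krylov_eval A w q - a *s krylov_eval A w q"
proof -
  let ?P = "\<lambda>i. ((*v) A ^^ i) w"
  let ?n = "degree q"
  have "degree ([:-a, 1:] * q) \<le> Suc ?n"
    using degree_mult_le[of "[:-a, 1:]" q] by simp
  then have "krylov_eval A w ([:-a, 1:] * q) = (\<Sum>i\<le>Suc ?n. coeff ([:-a, 1:] * q) i *s ?P i)"
    by (rule krylov_eval_bound)
  also have "\<dots> = (\<Sum>i\<le>Suc ?n. coeff (pCons 0 q) i *s ?P i - a *s (coeff q i *s ?P i))"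
    by (intro sum.cong refl) (simp add: vec_eq_iff algebra_simps)
  also have "\<dots> = (\<Sum>i\<le>Suc ?n. coeff (pCons 0 q) i *s ?P i) - a *s (\<Sum>i\<le>Suc ?n. coeff q i *s ?P i)"
    by (simp add: sum_subtractf vec.scale_sum_right)
  also have "(\<Sum>i\<le>Suc ?n. coeff (pCons 0 q) i *s ?P i) = (\<Sum>i\<le>?n. coeff q i *s ?P (Suc i))"
    by (subst sum.atMost_Suc_shift) simp
  also have "\<dots> = A *v krylov_eval A w q"
    by (simp add: krylov_eval_def matrix_vector_mult_sum
       matrix_vector_mult_scale)
  also have "(\<Sum>i\<le>Suc ?n. coeff q i *s ?P i) = krylov_eval A w q"
    by (rule krylov_eval_bound[symmetric]) simp
  finally show ?thesis .
qed


lemma eigenvector_in_krylov_space: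
  fixes A :: "complex ^ 'n ^ 'n"
  assumes "subspace W" and W_scale: "\<And>c x. x \<in> W \<Longrightarrow> c *s x \<in> W"
    and W_inv: "\<And>x. x \<in> W \<Longrightarrow> A *v x \<in> W"
    and "w \<in> W" "w \<noteq> 0" "p \<noteq> 0" "krylov_eval A w p = 0"
  shows "\<exists>a x. x \<in> W \<and> x \<noteq> 0 \<and> A *v x = a *s x"
  using \<open>p \<noteq> 0\<close> \<open>krylov_eval A w p = 0\<close>
proof (induction "degree p" arbitrary: p)
  case 0
  then have "coeff p 0 *s w = 0" "coeff p 0 \<noteq> 0"
    by (auto simp: krylov_eval_def leading_coeff_0_iff simp flip: leading_coeff_0_iff)
  with \<open>w \<noteq> 0\<close> show ?case
    by (simp add: vec_eq_iff)
next
  case (Suc n)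
  obtain a where "poly p a = 0"
    using alg_closed_imp_poly_has_root[of p] Suc.hyps(2) by auto
  then obtain q where q: "p = [:-a, 1:] * q"
    using poly_eq_0_iff_dvd by (metis dvdE)
  with Suc.prems have "q \<noteq> 0"
    by auto
  have "degree p = degree [:-a, 1:] + degree q"
    unfolding q by (rule degree_mult_eq) (use \<open>q \<noteq> 0\<close> in auto)
  with Suc.hyps(2) have "degree q = n"
    by simp
  let ?x = "krylov_eval A w q"
  have W_pow: "((*v) A ^^ i) w \<in> W" for i
    by (induction i) (auto simp: \<open>w \<in> W\<close> W_inv)
  have "?x \<in> W"
    unfolding krylov_eval_def by (intro subspace_sum \<open>subspace W\<close> W_scale W_pow)
  moreover have "A *v ?x = a *s ?x"
    using Suc.prems(2) unfolding q krylov_eval_linear_factor by simp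
  \<comment> \<open>If \<open>?x\<close> = q(A) w is nonzero it is an eigenvector; if it vanishes, q
    annihilates w and has smaller degree, so the induction hypothesis applies.\<close>
  ultimately show ?case
    using Suc.hyps(1)[of q] \<open>degree q = n\<close> \<open>q \<noteq> 0\<close> by blast
qed

text \<open>The image of a basis of W spans W and has at most dim W elements, so it is again a
  basis. Used in contrapositive form: A - a has a kernel on W, hence its range is a proper
  subspace.\<close>

lemma linear_onto_imp_inj_on:
  fixes f :: "'a::euclidean_space \<Rightarrow> 'a"
  assumes lin: "linear f" and "subspace W" and onto: "f ` W = W"
  shows "inj_on f W"
proof -
  obtain B where B: "B \<subseteq> W" "independent B" "W \<subseteq> span B" "card B = dim W"
    by (rule basis_exists)
  have "finite B"
    using B(2) by (rule independent_imp_finite)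
  have span_B: "span B = W"
    using B(1,3) \<open>subspace W\<close> by (metis span_minimal subset_antisym)
  have span_fB: "span (f ` B) = W"
    using linear_span_image[OF lin, of B] span_B onto by simp
  have "dim W \<le> card (f ` B)"
    using span_fB \<open>finite B\<close> by (metis dim_le_card finite_imageI order_refl)
  moreover have "card (f ` B) \<le> card B"
    using \<open>finite B\<close> by (rule card_image_le)
  ultimately have card: "card (f ` B) = card B" "card (f ` B) = dim W"
    using B(4) by simp_all
  then have "inj_on f B"
    using \<open>finite B\<close> by (simp add: eq_card_imp_inj_on)
  moreover have "independent (f ` B)"
    by (rule card_le_dim_spanning[of _ W])
      (use span_fB card \<open>finite B\<close> span_superset[of "f ` B"] in auto)
  ultimately have "inj_on f (span B)"
    using linear_inj_on_span_iff_independent_image[OF lin] by blast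
  then show ?thesis
    by (simp add: span_B)
qed

text \<open>The Krylov vectors with exponents up to the real dimension are one too many to be
  independent over the reals; the coefficients of a real dependence form the polynomial.\<close>

lemma ex_annihilating_poly:
  fixes A :: "complex ^ 'n ^ 'n"
  shows "\<exists>p. p \<noteq> 0 \<and> krylov_eval A w p = 0"
proof -
  let ?P = "\<lambda>i. ((*v) A ^^ i) w"
  let ?N = "DIM(complex ^ 'n)"
  have "\<exists>u. (\<exists>i\<le>?N. u i \<noteq> 0) \<and> (\<Sum>i\<le>?N. u i *\<^sub>R ?P i) = 0"
  proof (cases "inj_on ?P {..?N}")
    \<comment> \<open>Dependence is a property of sets, so two equal Krylov vectors have to be
      treated apart: their difference already gives the relation X^i - X^k.\<close>
    case False
    then obtain i k where ik: "i \<le> ?N" "k \<le> ?N" "i \<noteq> k" "?P i = ?P k"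
      by (auto simp: inj_on_def)
    let ?u = "\<lambda>m. if m = i then 1 else if m = k then -1 else (0::real)"
    have "(\<Sum>m\<le>?N. ?u m *\<^sub>R ?P m) = (\<Sum>m\<in>{i, k}. ?u m *\<^sub>R ?P m)"
      by (rule sum.mono_neutral_right) (use ik in auto)
    also have "\<dots> = 0"
      using ik by simp
    finally show ?thesis
      using ik(1) by (intro exI[of _ ?u]) auto
  next
    case True
    then have "card (?P ` {..?N}) = Suc ?N"
      by (simp add: card_image)
    then have "dependent (?P ` {..?N})"
      using independent_bound[of "?P ` {..?N}"] by auto
    then obtain u v where u: "v \<in> ?P ` {..?N}" "u v \<noteq> 0" "(\<Sum>v\<in>?P ` {..?N}. u v *\<^sub>R v) = 0"
      by (auto simp: dependent_finite)
    then show ?thesis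
      using True by (intro exI[of _ "\<lambda>i. u (?P i)"]) (auto simp: sum.reindex)
  qed
  then obtain u where u: "\<exists>i\<le>?N. u i \<noteq> 0" "(\<Sum>i\<le>?N. u i *\<^sub>R ?P i) = 0"
    by blast
  let ?p = "\<Sum>i\<le>?N. monom (complex_of_real (u i)) i"
  have cf: "coeff ?p i = (if i \<le> ?N then complex_of_real (u i) else 0)" for i
    by (simp add: coeff_sum)
  from u(1) have "?p \<noteq> 0"
    using cf by (metis coeff_0 of_real_eq_0_iff)
  moreover have "degree ?p \<le> ?N"
    by (rule degree_le) (simp only: cf, simp)
  then have "krylov_eval A w ?p = (\<Sum>i\<le>?N. coeff ?p i *s ?P i)"
    by (rule krylov_eval_bound)
  then have "krylov_eval A w ?p = 0"
    using u(2) unfolding cf scaleR_vec_eq_scale by simp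
  ultimately show ?thesis by blast
qed

lemma ex_eigenvector_invariant_subspace:
  fixes A :: "complex ^ 'n ^ 'n"
  assumes "subspace W" "\<And>c x. x \<in> W \<Longrightarrow> c *s x \<in> W" "\<And>x. x \<in> W \<Longrightarrow> A *v x \<in> W"
    and "W \<noteq> {0}"
  shows "\<exists>a x. x \<in> W \<and> x \<noteq> 0 \<and> A *v x = a *s x"
proof -
  obtain w where "w \<in> W" "w \<noteq> 0"
    using \<open>W \<noteq> {0}\<close> subspace_0[OF \<open>subspace W\<close>] by blast
  obtain p where "p \<noteq> 0" "krylov_eval A w p = 0"
    using ex_annihilating_poly by blast
  then show ?thesis
    using eigenvector_in_krylov_space assms(1-3) \<open>w \<in> W\<close> \<open>w \<noteq> 0\<close> by metis
qed

text \<open>Schur triangularisation of a restriction. The last basis vector of \<open>W\<close> is orthogonal to the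
  proper subspace \<open>(A - a) W\<close>, where \<open>a\<close> is an eigenvalue, so its complement in \<open>W\<close> is invariant.\<close>

lemma schur_basis:
  fixes A :: "complex ^ 'n ^ 'n"
  assumes "subspace W" "\<And>c x. x \<in> W \<Longrightarrow> c *s x \<in> W" "\<And>x. x \<in> W \<Longrightarrow> A *v x \<in> W"
  shows "\<exists>(e :: nat \<Rightarrow> complex ^ 'n) m. m \<le> dim W \<and> (\<forall>i<m. e i \<in> W)
    \<and> (\<forall>i<m. \<forall>k<m. cip (e i) (e k) = (if i = k then 1 else 0))
    \<and> (\<forall>x\<in>W. x = (\<Sum>i<m. cip x (e i) *s e i))
    \<and> (\<forall>i<m. \<forall>k<m. i < k \<longrightarrow> cip (A *v e i) (e k) = 0)
    \<and> (\<forall>i<m. \<exists>x. x \<noteq> 0 \<and> A *v x = cip (A *v e i) (e i) *s x)"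
  using assms
proof (induction "dim W" arbitrary: W rule: less_induct)
  case less
  note sub = less.prems(1) and scale = less.prems(2) and inv = less.prems(3)
  show ?case
  proof (cases "W = {0}")
    case True
    then show ?thesis
      by (intro exI[of _ "\<lambda>_. 0"] exI[of _ 0]) auto
  next
    case False
    obtain a x where ax: "x \<in> W" "x \<noteq> 0" "A *v x = a *s x"
      using ex_eigenvector_invariant_subspace[of W A] sub scale inv False by metis
    define L where "L = (\<lambda>y. A *v y - a *s y)"
    have lin: "linear L"
      unfolding L_def by (rule linearI)
        (simp_all add: matrix_vector_right_distrib vec_eq_iff algebra_simps
          scaleR_vec_eq_scale matrix_vector_mult_scale)
    have L_W: "L ` W \<subseteq> W"
      unfolding L_def using sub inv scale by (auto intro: subspace_diff)
    have sub_L: "subspace (L ` W)"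
      using lin sub by (rule linear_subspace_image)
    have "\<not> inj_on L W"
    proof
      assume "inj_on L W"
      moreover have "L x = L 0" "0 \<in> W"
        using ax subspace_0[OF sub] by (simp_all add: L_def)
      ultimately show False
        using ax(1,2) by (auto dest: inj_onD)
    qed
    have "L ` W \<noteq> W"
    proof
      assume "L ` W = W"
      then have "inj_on L W"
        using linear_onto_imp_inj_on[OF lin sub] by blast
      with \<open>\<not> inj_on L W\<close> show False ..
    qed
    then have "span (L ` W) \<subset> span W"
      using L_W sub sub_L by (metis psubsetI span_eq_iff)
    then obtain f where f: "f \<noteq> 0" "f \<in> W" "\<And>y. y \<in> L ` W \<Longrightarrow> orthogonal f y"
      using orthogonal_to_subspace_exists_gen[of "L ` W" W] sub sub_L by (metis span_eq_iff)
    have f_perp: "cip y f = 0" if "y \<in> L ` W" for y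
    proof -
      obtain z where z: "z \<in> W" "y = L z"
        using \<open>y \<in> L ` W\<close> by blast
      \<comment> \<open>So far f is orthogonal to the range of L only for the real inner product.
        The range is closed under multiplication by the imaginary unit, and testing with that
        multiple kills the imaginary part of the Hermitian product as well.\<close>
      have "\<i> *s y = L (\<i> *s z)"
        unfolding z(2) L_def matrix_vector_mult_scale by (simp add: vec_eq_iff algebra_simps)
      then have "\<i> *s y \<in> L ` W"
        using z(1) scale by blast
      then have "Re (cip y f) = 0" "Re (cip (\<i> *s y) f) = 0"
        using f(3) that unfolding Re_cip orthogonal_def by (simp_all add: inner_commute[of _ f])
      then show ?thesis
        by (simp add: cip_scale_left complex_eq_iff)
    qed
    define g where "g = complex_of_real (1 / norm f) *s f"
    have g: "g \<in> W" "cip g g = 1" "\<And>y. y \<in> L ` W \<Longrightarrow> cip y g = 0"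
    proof -
      show "g \<in> W"
        unfolding g_def by (rule scale[OF f(2)])
      show "cip g g = 1"
        using f(1) unfolding g_def cip_scale_left cip_scale_right cip_self[of f]
        by (simp add: power2_eq_square)
      show "cip y g = 0" if "y \<in> L ` W" for y
        unfolding g_def cip_scale_right f_perp[OF that] by simp
    qed
    define V where "V = {y \<in> W. cip y g = 0}"
    have sub_V: "subspace V"
      using sub unfolding V_def
      by (auto simp: subspace_def cip_add_left cip_scaleR_left)
    have V_scale: "c *s y \<in> V" if "y \<in> V" for c y
      using that scale by (auto simp: V_def cip_scale_left)
    have A_L: "A *v y = L y + a *s y" for y
      by (simp add: L_def)
    have V_inv: "A *v y \<in> V" if "y \<in> V" for y
      using that inv g(3) unfolding V_def by (auto simp: A_L cip_add_left cip_scale_left)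
    have "g \<notin> V"
      using g(2) by (simp add: V_def)
    then have "V \<subset> W"
      using g(1) by (auto simp: V_def)
    then have dim: "dim V < dim W"
      using sub sub_V by (metis dim_psubset span_eq_iff)
    have "\<exists>(e :: nat \<Rightarrow> complex ^ 'n) m. m \<le> dim V \<and> (\<forall>i<m. e i \<in> V)
        \<and> (\<forall>i<m. \<forall>k<m. cip (e i) (e k) = (if i = k then 1 else 0))
        \<and> (\<forall>x\<in>V. x = (\<Sum>i<m. cip x (e i) *s e i))
        \<and> (\<forall>i<m. \<forall>k<m. i < k \<longrightarrow> cip (A *v e i) (e k) = 0)
        \<and> (\<forall>i<m. \<exists>x. x \<noteq> 0 \<and> A *v x = cip (A *v e i) (e i) *s x)"
      by (rule less.hyps[OF dim sub_V]) (rule V_scale V_inv, assumption)+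
    then obtain e :: "nat \<Rightarrow> complex ^ 'n" and m where IH:
      "m \<le> dim V \<and> (\<forall>i<m. e i \<in> V)
        \<and> (\<forall>i<m. \<forall>k<m. cip (e i) (e k) = (if i = k then 1 else 0))
        \<and> (\<forall>x\<in>V. x = (\<Sum>i<m. cip x (e i) *s e i))
        \<and> (\<forall>i<m. \<forall>k<m. i < k \<longrightarrow> cip (A *v e i) (e k) = 0)
        \<and> (\<forall>i<m. \<exists>x. x \<noteq> 0 \<and> A *v x = cip (A *v e i) (e i) *s x)"
      by (elim exE) (rule that)
    note m = IH[THEN conjunct1]
      and eV = IH[THEN conjunct2, THEN conjunct1, rule_format]
      and orth = IH[THEN conjunct2, THEN conjunct2, THEN conjunct1, rule_format]
      and exp = IH[THEN conjunct2, THEN conjunct2, THEN conjunct2, THEN conjunct1, rule_format]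
      and tri = IH[THEN conjunct2, THEN conjunct2, THEN conjunct2, THEN conjunct2, THEN conjunct1, rule_format]
      and eig = IH[THEN conjunct2, THEN conjunct2, THEN conjunct2, THEN conjunct2, THEN conjunct2, rule_format]
    define e' where "e' = e(m := g)"
    have e': "e' m = g" "\<And>i. i < m \<Longrightarrow> e' i = e i"
      by (auto simp: e'_def)
    have eg: "cip (e i) g = 0" "cip g (e i) = 0" if "i < m" for i
      using eV[OF that] cip_commute[of g "e i"] by (auto simp: V_def)
    \<comment> \<open>The new diagonal entry is the eigenvalue a because L g is orthogonal to g. Its
      eigenvector is x, in general not g itself.\<close>
    have "cip (A *v g) g = a"
      using g(1,3) by (simp add: A_L cip_add_left cip_scale_left g(2))
    show ?thesis
    proof (intro exI[of _ e'] exI[of _ "Suc m"] conjI allI impI ballI)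
      \<comment> \<open>\<open>dim\<close> is the real dimension, which drops by at least 1 from W
        to V. This is why the length of the basis is later bounded by twice
        \<open>CARD('n)\<close>.\<close>
      show "Suc m \<le> dim W"
        using m dim by simp
      show "e' i \<in> W" if "i < Suc m" for i
        using that eV g(1) by (cases "i = m") (auto simp: e' V_def)
      show "cip (e' i) (e' k) = (if i = k then 1 else 0)" if "i < Suc m" "k < Suc m" for i k
        using that orth eg g(2) by (cases "i = m"; cases "k = m") (auto simp: e')
      show "cip (A *v e' i) (e' k) = 0" if "i < Suc m" "k < Suc m" "i < k" for i k
      proof (cases "k = m")
        case True
        then show ?thesis
          using that V_inv[OF eV[of i]] by (auto simp: e' V_def)
      next
        case False
        then show ?thesis
          using that tri by (auto simp: e')
      qed
      show "\<exists>x. x \<noteq> 0 \<and> A *v x = cip (A *v e' i) (e' i) *s x" if "i < Suc m" for i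
        using that eig ax(2,3) \<open>cip (A *v g) g = a\<close> by (cases "i = m") (auto simp: e')
      show "y = (\<Sum>i<Suc m. cip y (e' i) *s e' i)" if "y \<in> W" for y
      proof -
        let ?z = "y - cip y g *s g"
        have "?z \<in> V"
          using that g(1,2) scale sub by (auto simp: V_def cip_diff_left cip_scale_left intro: subspace_diff)
        then have "?z = (\<Sum>i<m. cip ?z (e i) *s e i)"
          by (rule exp)
        also have "\<dots> = (\<Sum>i<m. cip y (e' i) *s e' i)"
          by (intro sum.cong refl) (simp add: cip_diff_left cip_scale_left eg e')
        finally show ?thesis
          by (simp add: e' algebra_simps)
      qed
    qed
  qed
qed

text \<open>For a dissipative matrix in triangular form the entry \<open>a\<^sub>i\<^sub>k\<close> is controlled by the real parts of
  the diagonal entries: testing with \<open>\<alpha> e\<^sub>i + \<beta> e\<^sub>k\<close> bounds it by \<open>2 (d\<^sub>i d\<^sub>k)\<^sup>1\<^sup>/\<^sup>2\<close>, whatever the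
  size of the matrix. A geometric weight \<open>q\<^sup>i\<close> therefore absorbs all off-diagonal terms.\<close>

lemma dissipative_weighted_form_le:
  fixes A :: "complex ^ 'n ^ 'n" and e :: "nat \<Rightarrow> complex ^ 'n"
  assumes dis: "\<And>x. Re (cip (A *v x) x) \<le> 0"
    and orth: "\<And>i k. i < m \<Longrightarrow> k < m \<Longrightarrow> cip (e i) (e k) = (if i = k then 1 else 0)"
    and exp: "\<And>x. x = (\<Sum>i<m. cip x (e i) *s e i)"
    and tri: "\<And>i k. i < m \<Longrightarrow> k < m \<Longrightarrow> i < k \<Longrightarrow> cip (A *v e i) (e k) = 0"
    and diag: "\<And>i. i < m \<Longrightarrow> Re (cip (A *v e i) (e i)) \<le> - \<delta>"
    and q: "q = 16 * (real m)\<^sup>2"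
  shows "(\<Sum>i<m. q ^ i * (2 * Re (cnj (cip x (e i)) * cip (A *v x) (e i))))
    \<le> - \<delta> * (\<Sum>i<m. q ^ i * (norm (cip x (e i)))\<^sup>2)"
proof (cases "m = 0")
  case False
  then have m: "m > 0" by simp
  have q1: "q \<ge> 1"
    using one_le_power[of "real m" 2] m unfolding q by linarith
  define c where "c = (\<lambda>i. cip x (e i))"
  define a where "a = (\<lambda>i k. cip (A *v e k) (e i))"
  define d where "d = (\<lambda>i. - Re (a i i))"
  \<comment> \<open>Young weight for the off-diagonal terms. Scaling the two test coefficients by
    sqrt s and 1 / sqrt s gives row i the share 2 s = 1 / (2m) and row k the share 2 / s = q / (2m),
    since q = 1 / s^2. The surplus factor q is paid by the weights, as q^(i+1) <= q^k for i <
    k.\<close>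
  define s where "s = 1 / (4 * real m)"
  have s: "s > 0" using m by (simp add: s_def)
  have d_ge: "d i \<ge> \<delta>" if "i < m" for i
    using diag[OF that] by (simp add: d_def a_def)
  have d_nonneg: "d i \<ge> 0" for i
    using dis[of "e i"] by (simp add: d_def a_def)
  have Ax: "cip (A *v x) (e i) = (\<Sum>k<m. c k * a i k)" for i
  proof -
    have "A *v x = (\<Sum>k<m. c k *s (A *v e k))"
      by (subst exp[of x]) (simp add: matrix_vector_mult_sum matrix_vector_mult_scale c_def)
    then show ?thesis
      by (simp add: cip_sum_left cip_scale_left a_def)
  qed
  have off: "Re (cnj \<alpha> * \<beta> * a i k) \<le> d i * (norm \<alpha>)\<^sup>2 + d k * (norm \<beta>)\<^sup>2"
    if "i < k" "k < m" for i k \<alpha> \<beta>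
  proof -
    have aki: "a k i = 0"
      using tri[of i k] that by (simp add: a_def)
    have *: "Re (z * (a * cnj z)) = Re a * (norm z)\<^sup>2" for z a
    proof -
      have "z * (a * cnj z) = a * of_real ((norm z)\<^sup>2)"
        unfolding complex_norm_square by (simp only: mult_ac)
      also have "Re \<dots> = Re a * (norm z)\<^sup>2"
        by (simp del: of_real_power)
      finally show ?thesis .
    qed
    have "cip (A *v (\<alpha> *s e i + \<beta> *s e k)) (\<alpha> *s e i + \<beta> *s e k)
        = \<alpha> * (a i i * cnj \<alpha>) + \<beta> * (a k k * cnj \<beta>) + cnj \<alpha> * \<beta> * a i k"
      by (simp add: matrix_vector_right_distrib matrix_vector_mult_scale cip_add_left cip_add_right
          cip_scale_left cip_scale_right aki[unfolded a_def] a_def algebra_simps)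
    then have "Re (a i i) * (norm \<alpha>)\<^sup>2 + Re (a k k) * (norm \<beta>)\<^sup>2 + Re (cnj \<alpha> * \<beta> * a i k) \<le> 0"
      using dis[of "\<alpha> *s e i + \<beta> *s e k"] by (simp add: * del: times_complex.simps)
    then show ?thesis by (simp add: d_def)
  qed
  let ?g = "\<lambda>i. q ^ i * (d i * (norm (c i))\<^sup>2)"
  have pair: "q ^ i * (2 * Re (cnj (c i) * c k * a i k)) \<le> (?g i + ?g k) / (2 * real m)"
    if ik: "i < k" "k < m" for i k
  proof -
    let ?\<tau> = "sqrt s"
    have eq: "cnj (of_real ?\<tau> * c i) * (c k / of_real ?\<tau>) * a i k = cnj (c i) * c k * a i k"
      using s by simp
    have "Re (cnj (c i) * c k * a i k) \<le> d i * (norm (of_real ?\<tau> * c i))\<^sup>2 + d k * (norm (c k / of_real ?\<tau>))\<^sup>2"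
      using off[OF ik, of "of_real ?\<tau> * c i" "c k / of_real ?\<tau>"] unfolding eq .
    also have "\<dots> = s * (d i * (norm (c i))\<^sup>2) + d k * (norm (c k))\<^sup>2 / s"
      using s by (simp add: norm_mult norm_divide power_mult_distrib power_divide)
    finally have "q ^ i * (2 * Re (cnj (c i) * c k * a i k))
        \<le> q ^ i * (2 * (s * (d i * (norm (c i))\<^sup>2) + d k * (norm (c k))\<^sup>2 / s))"
      using q1 by (intro mult_left_mono) auto
    also have "\<dots> = ?g i / (2 * real m) + q ^ i * q * (d k * (norm (c k))\<^sup>2) / (2 * real m)"
      using m by (simp add: s_def q power2_eq_square field_simps)
    also have "q ^ i * q * (d k * (norm (c k))\<^sup>2) / (2 * real m) \<le> ?g k / (2 * real m)"
    proof -
      have "q ^ Suc i \<le> q ^ k"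
        using ik q1 by (intro power_increasing) auto
      then show ?thesis
        using d_nonneg[of k] by (intro divide_right_mono mult_right_mono) (auto simp: mult.commute)
    qed
    finally show ?thesis by (simp add: add_divide_distrib)
  qed
  have gnn: "?g i \<ge> 0" for i
    using q1 d_nonneg by simp
  have row: "q ^ i * (2 * Re (cnj (c i) * cip (A *v x) (e i))) \<le> - 2 * ?g i + (\<Sum>k<m. (?g i + ?g k) / (2 * real m))"
    if i: "i < m" for i
  proof -
    have "q ^ i * (2 * Re (cnj (c i) * cip (A *v x) (e i))) = (\<Sum>k<m. q ^ i * (2 * Re (cnj (c i) * c k * a i k)))"
      by (simp add: Ax sum_distrib_left mult.assoc del: times_complex.simps)
    \<comment> \<open>Every pair, including those with k <= i, is charged the same nonnegative
      amount; this keeps the double sum symmetric.\<close>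
    also have "\<dots> \<le> (\<Sum>k<m. (if k = i then - 2 * ?g i else 0) + (?g i + ?g k) / (2 * real m))"
    proof (rule sum_mono)
      fix k assume "k \<in> {..<m}"
      then have k: "k < m" by simp
      consider "k < i" | "k = i" | "i < k" by linarith
      then show "q ^ i * (2 * Re (cnj (c i) * c k * a i k))
          \<le> (if k = i then - 2 * ?g i else 0) + (?g i + ?g k) / (2 * real m)"
      proof cases
        case 1
        then have "a i k = 0"
          using tri[of k i] i k by (simp add: a_def)
        then show ?thesis
          using gnn[of i] gnn[of k] 1 by simp
      next
        case 2
        have "cnj (c i) * c i * a i i = of_real ((norm (c i))\<^sup>2) * a i i"
          unfolding complex_norm_square by (simp only: mult_ac)
        also have "Re \<dots> = - (d i * (norm (c i))\<^sup>2)"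
          by (simp add: d_def del: of_real_power)
        finally have "Re (cnj (c i) * c i * a i i) = - (d i * (norm (c i))\<^sup>2)" .
        then have "q ^ i * (2 * Re (cnj (c i) * c i * a i i)) = - 2 * ?g i"
          by (simp only:)
        moreover have "0 \<le> (?g i + ?g i) / (2 * real m)"
          by (intro divide_nonneg_nonneg add_nonneg_nonneg gnn) simp
        ultimately show ?thesis
          unfolding 2 if_P[OF refl] by linarith
      next
        case 3
        then show ?thesis
          using pair[of i k] k by simp
      qed
    qed
    also have "\<dots> = - 2 * ?g i + (\<Sum>k<m. (?g i + ?g k) / (2 * real m))"
      using i by (simp add: sum.distrib)
    finally show ?thesis .
  qed
  have "(\<Sum>i<m. q ^ i * (2 * Re (cnj (c i) * cip (A *v x) (e i))))
      \<le> (\<Sum>i<m. - 2 * ?g i + (\<Sum>k<m. (?g i + ?g k) / (2 * real m)))"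
    by (rule sum_mono) (use row in auto)
  also have "\<dots> = - 2 * (\<Sum>i<m. ?g i) + (\<Sum>i<m. \<Sum>k<m. (?g i + ?g k) / (2 * real m))"
    by (simp only: sum.distrib sum_distrib_left)
  \<comment> \<open>The symmetric double sum costs exactly half of the diagonal dissipation 2
    \<open>?g\<close>, and the other half is the decay that remains.\<close>
  also have "(\<Sum>i<m. \<Sum>k<m. (?g i + ?g k) / (2 * real m)) = (\<Sum>i<m. ?g i)"
  proof -
    have "(\<Sum>i<m. \<Sum>k<m. (G i + G k) / (2 * real m)) = (\<Sum>i<m. G i)" for G :: "nat \<Rightarrow> real"
    proof -
      have "(\<Sum>i<m. \<Sum>k<m. (G i + G k)) = 2 * real m * (\<Sum>i<m. G i)"
        by (simp add: sum.distrib sum_distrib_left mult.assoc)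
      then show ?thesis
        using m by (simp add: sum_divide_distrib[symmetric])
    qed
    then show ?thesis .
  qed
  also have "- 2 * (\<Sum>i<m. ?g i) + (\<Sum>i<m. ?g i) = - (\<Sum>i<m. ?g i)"
    by simp
  also have "- (\<Sum>i<m. ?g i) \<le> - (\<Sum>i<m. \<delta> * (q ^ i * (norm (c i))\<^sup>2))"
  proof (rule le_imp_neg_le, rule sum_mono)
    fix i assume "i \<in> {..<m}"
    then have "\<delta> * (q ^ i * (norm (c i))\<^sup>2) \<le> d i * (q ^ i * (norm (c i))\<^sup>2)"
      using d_ge q1 by (intro mult_right_mono) auto
    then show "\<delta> * (q ^ i * (norm (c i))\<^sup>2) \<le> ?g i"
      by (simp add: mult_ac)
  qed
  finally show ?thesis
    by (simp only: c_def sum_distrib_left mult_minus_left sum_negf)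
qed simp

text \<open>The weighted sum F of squared Schur coordinates is a Lyapunov function. Its weights lie
  between 1 and a power depending only on the dimension, so F is equivalent to the squared norm
  uniformly over all dissipative A. Half of the dissipation went into the off-diagonal entries,
  hence the squared norm decays at rate \<open>\<delta>\<close> and not 2
  \<open>\<delta>\<close>.\<close>

theorem dissipative_exponential_decay:
  fixes A :: "complex ^ 'n ^ 'n" and x :: "real \<Rightarrow> complex ^ 'n"
  assumes dis: "\<And>x. Re (cip (A *v x) x) \<le> 0"
    and ev: "\<And>a x. x \<noteq> 0 \<Longrightarrow> A *v x = a *s x \<Longrightarrow> Re a \<le> - \<delta>"
    and ode: "\<And>t. (x has_vector_derivative A *v x t) (at t)"
    and "t \<ge> 0"
  shows "(norm (x t))\<^sup>2 \<le> (16 * (2 * real CARD('n))\<^sup>2) ^ (2 * CARD('n)) * (exp (- \<delta> * t) * (norm (x 0))\<^sup>2)"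
proof -
  obtain e :: "nat \<Rightarrow> complex ^ 'n" and m where *:
      "m \<le> dim (UNIV :: (complex ^ 'n) set) \<and> (\<forall>i<m. e i \<in> UNIV)
       \<and> (\<forall>i<m. \<forall>k<m. cip (e i) (e k) = (if i = k then 1 else 0))
       \<and> (\<forall>x\<in>UNIV. x = (\<Sum>i<m. cip x (e i) *s e i))
       \<and> (\<forall>i<m. \<forall>k<m. i < k \<longrightarrow> cip (A *v e i) (e k) = 0)
       \<and> (\<forall>i<m. \<exists>x. x \<noteq> 0 \<and> A *v x = cip (A *v e i) (e i) *s x)"
    using schur_basis[of UNIV A, OF subspace_UNIV UNIV_I UNIV_I] by (elim exE) (rule that)
  note m = *[THEN conjunct1]
    and orth = *[THEN conjunct2, THEN conjunct2, THEN conjunct1, rule_format]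
    and exp = *[THEN conjunct2, THEN conjunct2, THEN conjunct2, THEN conjunct1, rule_format, OF UNIV_I]
    and tri = *[THEN conjunct2, THEN conjunct2, THEN conjunct2, THEN conjunct2, THEN conjunct1, rule_format]
    and eig = *[THEN conjunct2, THEN conjunct2, THEN conjunct2, THEN conjunct2, THEN conjunct2, rule_format]
  define q where "q = 16 * (real m)\<^sup>2"
  let ?N = "2 * CARD('n)"
  have mN: "m \<le> ?N"
    using m by (simp add: mult.commute)
  define Q where "Q = 16 * (2 * real CARD('n))\<^sup>2"
  have Q1: "1 \<le> Q"
    using one_le_power[of "2 * real CARD('n)" 2] zero_less_card_finite[where 'a='n]
    unfolding Q_def by linarith
  have qQ: "0 \<le> q" "q \<le> Q"
    using mN power_mono[of "real m" "2 * real CARD('n)" 2] unfolding q_def Q_def by auto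
  define F where "F = (\<lambda>t. \<Sum>i<m. q ^ i * (norm (cip (x t) (e i)))\<^sup>2)"
  have diag: "Re (cip (A *v e i) (e i)) \<le> - \<delta>" if "i < m" for i
    using eig[OF that] ev by blast
  have norm_exp: "(norm y)\<^sup>2 = (\<Sum>i<m. (norm (cip y (e i)))\<^sup>2)" for y
  proof -
    have "of_real ((norm y)\<^sup>2) = cip y y"
      by (simp add: cip_self)
    also have "\<dots> = cip (\<Sum>i<m. cip y (e i) *s e i) y"
      by (rule arg_cong[where f = "\<lambda>x. cip x y", OF exp])
    also have "\<dots> = (\<Sum>i<m. cip y (e i) * cnj (cip y (e i)))"
    proof -
      have "cip (e i) y = cnj (cip y (e i))" for i
        by (rule cip_commute)
      then show ?thesis
        by (simp only: cip_sum_left cip_scale_left)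
    qed
    also have "\<dots> = (\<Sum>i<m. of_real ((norm (cip y (e i)))\<^sup>2))"
      by (simp only: complex_norm_square)
    also have "\<dots> = of_real (\<Sum>i<m. (norm (cip y (e i)))\<^sup>2)"
      by simp
    finally show ?thesis
      using of_real_eq_iff by blast
  qed
  have lower: "(norm (x t))\<^sup>2 \<le> F t" for t
    unfolding norm_exp F_def
  proof (rule sum_mono)
    fix i assume "i \<in> {..<m}"
    then have "1 \<le> real m"
      by auto
    then have "1 \<le> q ^ i"
      using one_le_power[of "real m" 2] unfolding q_def by (intro one_le_power) linarith
    then show "(norm (cip (x t) (e i)))\<^sup>2 \<le> q ^ i * (norm (cip (x t) (e i)))\<^sup>2"
      by (metis mult_right_mono mult_1 zero_le_power2)
  qed
  have upper: "F t \<le> Q ^ ?N * (norm (x t))\<^sup>2" for t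
    unfolding norm_exp F_def sum_distrib_left
  proof (rule sum_mono)
    fix i assume "i \<in> {..<m}"
    have "q ^ i \<le> Q ^ i"
      using qQ by (intro power_mono)
    also have "\<dots> \<le> Q ^ ?N"
      using \<open>i \<in> {..<m}\<close> mN Q1 by (intro power_increasing) auto
    finally show "q ^ i * (norm (cip (x t) (e i)))\<^sup>2 \<le> Q ^ ?N * (norm (cip (x t) (e i)))\<^sup>2"
      by (intro mult_right_mono) auto
  qed
  have comp: "((\<lambda>t. cip (x t) (e i)) has_vector_derivative cip (A *v x t) (e i)) (at t)" for i t
    using bounded_linear.has_vector_derivative[OF bounded_linear_cip_left ode] .
  have DF: "(F has_real_derivative (\<Sum>i<m. q ^ i * (2 * Re (cnj (cip (x t) (e i)) * cip (A *v x t) (e i))))) (at t)" for t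
  proof -
    have Dnorm: "((\<lambda>t. (norm (z t))\<^sup>2) has_real_derivative 2 * Re (cnj (z t) * z')) (at t)"
      if "(z has_vector_derivative z') (at t)" for z :: "real \<Rightarrow> complex" and z'
    proof -
      have "((\<lambda>t. z t \<bullet> z t) has_vector_derivative (z t \<bullet> z' + z' \<bullet> z t)) (at t)"
        by (rule bounded_bilinear.has_vector_derivative[OF bounded_bilinear_inner that that])
      moreover have "z t \<bullet> z' + z' \<bullet> z t = 2 * Re (cnj (z t) * z')"
        by (simp add: inner_complex_def)
      ultimately show ?thesis
        by (simp add: has_real_derivative_iff_has_vector_derivative power2_norm_eq_inner)
    qed
    show ?thesis
      unfolding F_def by (intro DERIV_sum DERIV_cmult Dnorm comp)
  qed
  have "exp (\<delta> * t) * F t \<le> exp (\<delta> * 0) * F 0"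
  proof (rule DERIV_nonpos_imp_nonincreasing[OF \<open>t \<ge> 0\<close>])
    fix r
    let ?D = "\<Sum>i<m. q ^ i * (2 * Re (cnj (cip (x r) (e i)) * cip (A *v x r) (e i)))"
    have "((\<lambda>t. exp (\<delta> * t) * F t) has_real_derivative (exp (\<delta> * r) * \<delta> * F r + ?D * exp (\<delta> * r))) (at r)"
      by (rule DERIV_mult[OF _ DF]) (auto intro!: derivative_eq_intros)
    moreover have "?D \<le> - \<delta> * F r"
      unfolding F_def by (rule dissipative_weighted_form_le[OF dis orth exp tri diag q_def])
    then have "exp (\<delta> * r) * ?D \<le> exp (\<delta> * r) * (- \<delta> * F r)"
      by (intro mult_left_mono) auto
    then have "exp (\<delta> * r) * \<delta> * F r + ?D * exp (\<delta> * r) \<le> 0"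
      by (simp add: algebra_simps)
    ultimately show "\<exists>y. ((\<lambda>t. exp (\<delta> * t) * F t) has_real_derivative y) (at r) \<and> y \<le> 0"
      by blast
  qed
  then have "F t \<le> exp (- \<delta> * t) * F 0"
    by (simp add: exp_minus field_simps)
  also have "\<dots> \<le> exp (- \<delta> * t) * (Q ^ ?N * (norm (x 0))\<^sup>2)"
    by (intro mult_left_mono upper) auto
  finally show ?thesis
    using lower[of t] by (simp add: Q_def mult_ac)
qed

section \<open>The matrix exponential\<close>

lemma matrix_mult_scaleR_left: "(r *\<^sub>R A) ** B = r *\<^sub>R (A ** (B :: complex ^ 'n ^ 'm))"
  by (simp add: matrix_matrix_mult_def vec_eq_iff scaleR_sum_right)

lemma matrix_mult_scaleR_right: "A ** (r *\<^sub>R B) = r *\<^sub>R (A ** (B :: complex ^ 'n ^ 'm))"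
  by (simp add: matrix_matrix_mult_def vec_eq_iff scaleR_sum_right)

lemma matrix_funpow_scaleR:
  fixes A :: "complex ^ 'n ^ 'n"
  shows "((**) (r *\<^sub>R A) ^^ m) B = r ^ m *\<^sub>R ((**) A ^^ m) B"
  by (induction m) (simp_all add: matrix_mult_scaleR_left matrix_mult_scaleR_right)

text \<open>K is a bound for the operator norm of left multiplication by A, so the powers are
  estimated by iteration.\<close>

lemma norm_matrix_funpow_le:
  fixes A :: "complex ^ 'n ^ 'n" and B :: "complex ^ 'm ^ 'n"
  shows "\<exists>K\<ge>0. \<forall>m. norm (((**) A ^^ m) B) \<le> K ^ m * norm B"
proof -
  have "linear ((**) A :: complex ^ 'm ^ 'n \<Rightarrow> _)"
    by (rule linearI) (simp_all add: matrix_add_ldistrib matrix_mult_scaleR_right)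
  then have "bounded_linear ((**) A :: complex ^ 'm ^ 'n \<Rightarrow> _)"
    by (simp add: linear_conv_bounded_linear)
  then obtain K where K: "K \<ge> 0" "\<And>X :: complex ^ 'm ^ 'n. norm (A ** X) \<le> norm X * K"
    using bounded_linear.nonneg_bounded by blast
  have "norm (((**) A ^^ m) B) \<le> K ^ m * norm B" for m
  proof (induction m)
    case (Suc m)
    have "norm (((**) A ^^ Suc m) B) \<le> norm (((**) A ^^ m) B) * K"
      using K(2) by simp
    also have "\<dots> \<le> K ^ m * norm B * K"
      using Suc K(1) by (intro mult_right_mono)
    finally show ?case by (simp add: mult_ac)
  qed simp
  with K(1) show ?thesis by blast
qed

lemma summable_matrix_exp_scaled:
  fixes A :: "complex ^ 'n ^ 'n"
  shows "summable (\<lambda>m. norm ((1 / fact m) *\<^sub>R r ^ m *\<^sub>R ((**) A ^^ m) B))"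
proof -
  obtain K where K: "K \<ge> 0" "\<And>m. norm (((**) A ^^ m) B) \<le> K ^ m * norm B"
    using norm_matrix_funpow_le by blast
  have "summable (\<lambda>m. inverse (fact m) * (\<bar>r\<bar> * K) ^ m * norm B)"
    using summable_exp[of "\<bar>r\<bar> * K"] by (rule summable_mult2)
  then show ?thesis
  proof (rule summable_comparison_test')
    fix m
    have "norm (((**) A ^^ m) B) * (\<bar>r\<bar> ^ m / fact m) \<le> K ^ m * norm B * (\<bar>r\<bar> ^ m / fact m)"
      by (intro mult_right_mono K(2)) auto
    then show "norm (norm ((1 / fact m) *\<^sub>R r ^ m *\<^sub>R ((**) A ^^ m) B)) \<le> inverse (fact m) * (\<bar>r\<bar> * K) ^ m * norm B"
      by (simp add: power_abs power_mult_distrib field_simps)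
  qed
qed

text \<open>Each entry of the exponential is a scalar power series in r; convergence and
  differentiation are thereby reduced to scalar series.\<close>

lemma matrix_exp_nth:
  fixes A :: "complex ^ 'n ^ 'n"
  shows "summable (\<lambda>m. ((**) A ^^ m) (mat 1) $ i $ k / fact m * of_real r ^ m)"
    and "matrix_exp (r *\<^sub>R A) $ i $ k = (\<Sum>m. ((**) A ^^ m) (mat 1) $ i $ k / fact m * of_real r ^ m)"
proof -
  let ?T = "\<lambda>m. (1 / fact m) *\<^sub>R r ^ m *\<^sub>R ((**) A ^^ m) (mat 1)"
  have bl: "bounded_linear (\<lambda>M :: complex ^ 'n ^ 'n. M $ i $ k)"
    by (intro bounded_linear_compose[OF bounded_linear_vec_nth] bounded_linear_vec_nth)
  have T: "?T m $ i $ k = ((**) A ^^ m) (mat 1) $ i $ k / fact m * of_real r ^ m" for m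
    by (simp add: scaleR_conv_of_real[where 'a=complex])
  have sum: "summable ?T"
    using summable_matrix_exp_scaled by (rule summable_norm_cancel)
  then have "summable (\<lambda>m. ?T m $ i $ k)"
    by (rule bounded_linear.summable[OF bl])
  then show "summable (\<lambda>m. ((**) A ^^ m) (mat 1) $ i $ k / fact m * of_real r ^ m)"
    by (simp only: T)
  have "matrix_exp (r *\<^sub>R A) $ i $ k = (\<Sum>m. ?T m $ i $ k)"
    unfolding matrix_exp_def matrix_funpow_scaleR
    by (rule bounded_linear.suminf[OF bl sum])
  then show "matrix_exp (r *\<^sub>R A) $ i $ k = (\<Sum>m. ((**) A ^^ m) (mat 1) $ i $ k / fact m * of_real r ^ m)"
    by (simp only: T)
qed

lemma matrix_exp_0 [simp]: "matrix_exp 0 = (mat 1 :: complex ^ 'n ^ 'n)"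
proof -
  have "((**) 0 ^^ m) (mat 1) = (if m = 0 then mat 1 else (0 :: complex ^ 'n ^ 'n))" for m
    by (cases m) (simp_all add: matrix_matrix_mult_def vec_eq_iff)
  then have "matrix_exp (0 :: complex ^ 'n ^ 'n) = (\<Sum>m. if m = 0 then mat 1 else 0)"
    unfolding matrix_exp_def by (intro arg_cong[where f=suminf] ext) simp
  then show ?thesis
    using suminf_finite[of "{0::nat}" "\<lambda>m. if m = 0 then mat 1 else (0 :: complex ^ 'n ^ 'n)"] by simp
qed

text \<open>The series of an entry converges for every complex z, which is the form that termwise
  differentiation asks for.\<close>

lemma summable_matrix_powers:
  fixes A :: "complex ^ 'n ^ 'n"
  shows "summable (\<lambda>m. ((**) A ^^ m) (mat 1) $ i $ k / fact m * z ^ m)"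
proof -
  have "summable (\<lambda>m. norm (((**) A ^^ m) (mat 1) $ i $ k / fact m * z ^ m))"
  proof (rule summable_comparison_test'[OF summable_matrix_exp_scaled])
    fix m
    have "norm (((**) A ^^ m) (mat 1) $ i $ k) \<le> norm (((**) A ^^ m) (mat 1))"
      by (rule order_trans[OF Finite_Cartesian_Product.norm_nth_le Finite_Cartesian_Product.norm_nth_le])
    then have "norm (((**) A ^^ m) (mat 1) $ i $ k) * (norm z ^ m / fact m)
        \<le> norm (((**) A ^^ m) (mat 1)) * (norm z ^ m / fact m)"
      by (intro mult_right_mono) auto
    then show "norm (norm (((**) A ^^ m) (mat 1) $ i $ k / fact m * z ^ m))
        \<le> norm ((1 / fact m) *\<^sub>R norm z ^ m *\<^sub>R ((**) A ^^ m) (mat 1))"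
      by (simp add: norm_mult norm_divide norm_power mult_ac)
  qed
  then show ?thesis by (rule summable_norm_cancel)
qed

text \<open>The entry series is differentiated in the complex variable and restricted to real t. The
  coefficient shift \<open>diffs\<close> cancels one factor of the factorial and leaves one factor A
  on the left.\<close>

theorem matrix_exp_has_vector_derivative:
  fixes A :: "complex ^ 'n ^ 'n"
  shows "((\<lambda>t. matrix_exp (t *\<^sub>R A) *v w) has_vector_derivative A *v (matrix_exp (t *\<^sub>R A) *v w)) (at t)"
proof -
  let ?c = "\<lambda>i k m. ((**) A ^^ m) (mat 1) $ i $ k / fact m"
  have entry: "((\<lambda>t. matrix_exp (t *\<^sub>R A) $ i $ k) has_vector_derivative
      (\<Sum>l\<in>UNIV. A $ i $ l * matrix_exp (t *\<^sub>R A) $ l $ k)) (at t)" for i k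
  proof -
    have "((\<lambda>z. \<Sum>m. ?c i k m * z ^ m) has_field_derivative (\<Sum>m. diffs (?c i k) m * of_real t ^ m)) (at (of_real t))"
      by (rule termdiffs_strong_converges_everywhere) (rule summable_matrix_powers)
    then have "((\<lambda>r. \<Sum>m. ?c i k m * of_real r ^ m) has_vector_derivative (\<Sum>m. diffs (?c i k) m * of_real t ^ m)) (at t)"
      by (rule has_vector_derivative_real_field)
    moreover have "(\<Sum>m. diffs (?c i k) m * of_real t ^ m) = (\<Sum>l\<in>UNIV. A $ i $ l * matrix_exp (t *\<^sub>R A) $ l $ k)"
    proof -
      have "diffs (?c i k) m * of_real t ^ m = (\<Sum>l\<in>UNIV. A $ i $ l * (?c l k m * of_real t ^ m))" for m
      proof -
        have "diffs (?c i k) m = ((**) A ^^ Suc m) (mat 1) $ i $ k / fact m"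
          using of_nat_neq_0[of m, where 'a=complex]
          by (simp only: diffs_def fact_Suc of_nat_mult of_nat_fact times_divide_eq_right
              mult_divide_mult_cancel_left simp_thms)
        also have "\<dots> = (\<Sum>l\<in>UNIV. A $ i $ l * ?c l k m)"
          by (simp add: matrix_matrix_mult_def sum_divide_distrib)
        finally show ?thesis
          by (simp only: sum_distrib_right mult.assoc)
      qed
      then have "(\<Sum>m. diffs (?c i k) m * of_real t ^ m) = (\<Sum>m. \<Sum>l\<in>UNIV. A $ i $ l * (?c l k m * of_real t ^ m))"
        by simp
      also have "\<dots> = (\<Sum>l\<in>UNIV. \<Sum>m. A $ i $ l * (?c l k m * of_real t ^ m))"
        by (rule suminf_sum) (intro summable_mult summable_matrix_powers)
      also have "\<dots> = (\<Sum>l\<in>UNIV. A $ i $ l * matrix_exp (t *\<^sub>R A) $ l $ k)"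
        unfolding matrix_exp_nth(2) by (intro sum.cong refl suminf_mult summable_matrix_powers)
      finally show ?thesis .
    qed
    ultimately show ?thesis
      by (simp only: matrix_exp_nth(2))
  qed
  have comp: "((\<lambda>t. (matrix_exp (t *\<^sub>R A) *v w) $ i) has_vector_derivative
      (A *v (matrix_exp (t *\<^sub>R A) *v w)) $ i) (at t)" for i
  proof -
    have "((\<lambda>t. \<Sum>k\<in>UNIV. matrix_exp (t *\<^sub>R A) $ i $ k * w $ k) has_vector_derivative
        (\<Sum>k\<in>UNIV. (\<Sum>l\<in>UNIV. A $ i $ l * matrix_exp (t *\<^sub>R A) $ l $ k) * w $ k)) (at t)"
      by (intro has_vector_derivative_sum
        bounded_linear.has_vector_derivative[OF bounded_linear_mult_left] entry)
    moreover have "(\<Sum>k\<in>UNIV. (\<Sum>l\<in>UNIV. A $ i $ l * matrix_exp (t *\<^sub>R A) $ l $ k) * w $ k)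
        = (A *v (matrix_exp (t *\<^sub>R A) *v w)) $ i"
      by (subst matrix_vector_mul_assoc) (simp add: matrix_vector_mult_def matrix_matrix_mult_def)
    ultimately show ?thesis
      by (simp add: matrix_vector_mult_def)
  qed
  then show ?thesis
    unfolding has_vector_derivative_def
  proof (subst has_derivative_componentwise_within, intro ballI)
    fix b :: "complex ^ 'n" assume "b \<in> Basis"
    then obtain i e where b: "b = axis i e"
      by (auto simp: Basis_vec_def)
    show "((\<lambda>t. (matrix_exp (t *\<^sub>R A) *v w) \<bullet> b) has_derivative
        (\<lambda>x. (x *\<^sub>R (A *v (matrix_exp (t *\<^sub>R A) *v w))) \<bullet> b)) (at t)"
      using has_derivative_inner_left[OF comp[unfolded has_vector_derivative_def, of i], of e]
      by (simp add: b inner_axis)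
  qed
qed

section \<open>Eigenvectors of the beam matrix\<close>

lemma exhaust_8:
  fixes x :: 8
  shows "x = 1 \<or> x = 2 \<or> x = 3 \<or> x = 4 \<or> x = 5 \<or> x = 6 \<or> x = 7 \<or> x = 8"
proof (induct x)
  case (of_int z)
  then have "0 \<le> z" and "z < 8" by simp_all
  then have "z = 0 \<or> z = 1 \<or> z = 2 \<or> z = 3 \<or> z = 4 \<or> z = 5 \<or> z = 6 \<or> z = 7" by arith
  then show ?case by auto
qed

lemma UNIV_8: "UNIV = {1, 2, 3, 4, 5, 6, 7, 8 :: 8}"
  using exhaust_8 by auto

lemma forall_8: "(\<forall>i::8. P i) \<longleftrightarrow> P 1 \<and> P 2 \<and> P 3 \<and> P 4 \<and> P 5 \<and> P 6 \<and> P 7 \<and> P 8"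
  by (metis exhaust_8)

lemma sum_8: "sum f (UNIV :: 8 set) = f 1 + f 2 + f 3 + f 4 + f 5 + f 6 + f 7 + f 8"
  unfolding UNIV_8 by (simp add: ac_simps)

lemma vector_8 [simp]:
  "(vector [a, b, c, d, e, f, g, h] :: 'a::zero ^ 8) $ 1 = a"
  "(vector [a, b, c, d, e, f, g, h] :: 'a::zero ^ 8) $ 2 = b"
  "(vector [a, b, c, d, e, f, g, h] :: 'a::zero ^ 8) $ 3 = c"
  "(vector [a, b, c, d, e, f, g, h] :: 'a::zero ^ 8) $ 4 = d"
  "(vector [a, b, c, d, e, f, g, h] :: 'a::zero ^ 8) $ 5 = e"
  "(vector [a, b, c, d, e, f, g, h] :: 'a::zero ^ 8) $ 6 = f"
  "(vector [a, b, c, d, e, f, g, h] :: 'a::zero ^ 8) $ 7 = g"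
  "(vector [a, b, c, d, e, f, g, h] :: 'a::zero ^ 8) $ 8 = h"
  unfolding vector_def by simp_all

lemma le_of_scaled_le:
  fixes c x :: real
  assumes "c * x \<le> b" "b \<le> c * y" "c > 0"
  shows "x \<le> y"
  using assms by (meson mult_le_cancel_left_pos order_trans)

text \<open>A single Fourier mode: \<open>a\<close> is an eigenvalue of \<open>A(\<xi>)\<close>, \<open>D = \<i> \<xi>\<close>, \<open>r = \<bar>\<xi>\<bar>\<close>, and
  \<open>d = k\<^sub>5 \<xi>\<^sup>2\<^sup>\<epsilon>\<close> is the damping coefficient. All data are bounded by \<open>K\<close> and, where relevant,
  bounded away from 0 by \<open>1 / K\<close>.\<close>

locale beam_mode =
  fixes k1 k2 k3 k4 \<gamma> d K r :: real and a D v u z y \<phi> \<theta> \<sigma> \<eta> :: complex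
  assumes K: "1 \<le> K" and r: "r > 0" and d: "d \<ge> 0"
    and k_le: "k1 \<le> K" "k2 \<le> K" "k3 \<le> K" "k4 \<le> K" "\<bar>\<gamma>\<bar> \<le> K"
    and k_ge: "1 \<le> K * k1" "1 \<le> K * k2" "1 \<le> K * k3" "1 \<le> K * k4" "1 \<le> K * \<bar>\<gamma>\<bar>"
    and D: "D * D = - of_real (r * r)" "norm D = r"
    and e1: "a * v = D * u + y + \<theta>"
    and e2: "a * u = of_real k1 * (D * v)"
    and e3: "a * z = D * y"
    and e4: "a * y = - (of_real k1 * v) + of_real k2 * (D * z)"
    and e5: "a * \<phi> = D * \<theta>"
    and e6: "a * \<theta> = - (of_real k1 * v) + of_real k3 * (D * \<phi>) - of_real \<gamma> * (D * \<eta>)"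
    and e7: "a * \<sigma> = D * \<eta>"
    and e8: "a * \<eta> = - (of_real \<gamma> * (D * \<theta>)) + of_real k4 * (D * \<sigma>) - of_real d * \<eta>"
begin

text \<open>The symbol of the wave operator with squared speed k on a mode with time factor exp(a t)
  and frequency r.\<close>

definition P :: "real \<Rightarrow> complex" where "P k = a * a + of_real (k * (r * r))"

text \<open>The weights are those for which the system without damping is skew-adjoint.\<close>

definition energy :: real where
  "energy = k1 * (norm v)\<^sup>2 + (norm u)\<^sup>2 + k2 * (norm z)\<^sup>2 + (norm y)\<^sup>2 + k3 * (norm \<phi>)\<^sup>2
     + (norm \<theta>)\<^sup>2 + k4 * (norm \<sigma>)\<^sup>2 + (norm \<eta>)\<^sup>2"

definition bounded_by :: "real \<Rightarrow> bool" where
  "bounded_by b \<longleftrightarrow> norm v \<le> b \<and> norm u \<le> b \<and> norm z \<le> b \<and> norm y \<le> b \<and> norm \<phi> \<le> b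
     \<and> norm \<theta> \<le> b \<and> norm \<sigma> \<le> b \<and> norm \<eta> \<le> b"

lemma k_pos: "k1 > 0" "k2 > 0" "k3 > 0" "k4 > 0" "\<bar>\<gamma>\<bar> > 0"
  using K k_ge by (smt (verit) mult_nonneg_nonpos)+

lemma k_inverse: "1 / K \<le> k1" "1 / K \<le> k2" "1 / K \<le> k3" "1 / K \<le> k4" "1 / K \<le> \<bar>\<gamma>\<bar>"
  using K k_ge by (simp_all add: field_simps)

text \<open>One more multiplication by a eliminates u, and likewise z, \<open>\<phi>\<close>,
  \<open>\<sigma>\<close> in the next three lemmas. The result is four wave equations for v, y,
  \<open>\<theta>\<close>, \<open>\<eta>\<close>, coupled by lower-order terms.\<close>

lemma P1_v: "P k1 * v = a * (y + \<theta>)"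
proof -
  have "a * (a * v) = D * (a * u) + a * y + a * \<theta>"
    by (subst e1) (simp add: algebra_simps)
  also have "D * (a * u) = of_real k1 * (D * D) * v"
    by (subst e2) (simp add: algebra_simps)
  finally show ?thesis by (simp add: P_def D algebra_simps)
qed

lemma P2_y: "P k2 * y = - (of_real k1 * (a * v))"
proof -
  have "a * (a * y) = - (of_real k1 * (a * v)) + of_real k2 * (D * (a * z))"
    by (subst e4) (simp add: algebra_simps)
  also have "D * (a * z) = D * D * y"
    by (subst e3) (simp add: algebra_simps)
  finally show ?thesis by (simp add: P_def D algebra_simps)
qed

lemma P3_\<theta>: "P k3 * \<theta> = - (of_real k1 * (a * v)) - of_real \<gamma> * (D * (a * \<eta>))"
proof -
  have "a * (a * \<theta>) = - (of_real k1 * (a * v)) + of_real k3 * (D * (a * \<phi>)) - of_real \<gamma> * (D * (a * \<eta>))"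
    by (subst e6) (simp add: algebra_simps)
  also have "D * (a * \<phi>) = D * D * \<theta>"
    by (subst e5) (simp add: algebra_simps)
  finally show ?thesis by (simp add: P_def D algebra_simps)
qed

lemma P4_\<eta>: "(P k4 + of_real d * a) * \<eta> = - (of_real \<gamma> * (D * (a * \<theta>)))"
proof -
  have "a * (a * \<eta>) = - (of_real \<gamma> * (D * (a * \<theta>))) + of_real k4 * (D * (a * \<sigma>)) - of_real d * (a * \<eta>)"
    by (subst e8) (simp add: algebra_simps)
  also have "D * (a * \<sigma>) = D * D * \<eta>"
    by (subst e7) (simp add: algebra_simps)
  finally show ?thesis by (simp add: P_def D algebra_simps)
qed

lemma norm_P_le: "0 \<le> k \<Longrightarrow> k \<le> K \<Longrightarrow> norm (P k) \<le> norm a * norm a + K * (r * r)"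
  unfolding P_def
  by (rule order_trans[OF norm_triangle_ineq]) (use r in \<open>auto simp: norm_mult intro!: mult_right_mono\<close>)

text \<open>While |a|^2 is at most half of the lower bound r^2 / K for k r^2, no cancellation can
  occur: the mode is far from resonance.\<close>

lemma norm_P_ge:
  assumes "1 / K \<le> k" "norm a * norm a \<le> r * r / (2 * K)"
  shows "r * r / (2 * K) \<le> norm (P k)"
proof -
  have k: "k \<ge> 0"
    using assms(1) K by (smt (verit) divide_nonneg_nonneg)
  have "1 / K * (r * r) \<le> k * (r * r)"
    using assms(1) r by (intro mult_right_mono) auto
  then have "r * r / K \<le> norm (of_real (k * (r * r)) :: complex)"
    unfolding norm_of_real using k by simp
  also have "\<dots> \<le> norm (P k) + norm (a * a)"
    using norm_triangle_ineq4[of "P k" "a * a"] by (simp add: P_def)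
  finally show ?thesis
    using assms(2) K by (simp add: norm_mult field_simps)
qed

text \<open>Far from resonance all \<open>P k\<close> have size r^2, and the coupled wave equations
  for v, y, \<open>\<theta>\<close> form a contraction driven by \<open>\<eta>\<close>. Since a may
  vanish here, the other four unknowns are recovered from the equations in which they occur under D.
  The factor min(1, r) in the hypothesis makes v, y, \<open>\<theta>\<close> also bounded by r
  |\<open>\<eta>\<close>|, which compensates the division by |D| = r.\<close>

lemma small_eigenvalue:
  assumes m: "norm a \<le> min 1 r * r / (8 * K\<^sup>2)"
  shows "bounded_by (3 * K\<^sup>2 * (1 + d / r) * norm \<eta>)"
proof -
  define \<mu> where "\<mu> = min 1 r"
  let ?m = "norm a" and ?H = "norm \<eta>" and ?c = "r * r / (2 * K)"
  have \<mu>: "0 < \<mu>" "\<mu> \<le> 1" "\<mu> \<le> r"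
    using r by (auto simp: \<mu>_def)
  have K2: "K \<le> K\<^sup>2" "1 \<le> K\<^sup>2"
    using K by (auto intro: self_le_power one_le_power)
  have c: "?c > 0" using r K by simp
  have m1: "?m \<le> \<mu> * r / (8 * K\<^sup>2)"
    using m by (simp add: \<mu>_def)
  have mr: "?m \<le> r / (8 * K\<^sup>2)"
    using \<mu> r K by (intro order_trans[OF m1] divide_right_mono) (auto simp: mult_le_cancel_right1)
  have mrr: "?m \<le> r * r / (8 * K\<^sup>2)"
    using \<mu> r K by (intro order_trans[OF m1] divide_right_mono) auto
  have m_le: "?m \<le> r"
    using mr r K2(2) by (smt (verit) divide_le_eq_1 divide_right_mono mult_le_cancel_left1 le_divide_eq_1 mult_imp_div_pos_le)
  have mm: "?m * ?m \<le> ?c"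
  proof -
    have "?m * ?m \<le> r * (r / (8 * K\<^sup>2))"
      using m_le mr r by (intro mult_mono) auto
    also have "\<dots> \<le> ?c"
      using r K K2 by (auto simp: field_simps)
    finally show ?thesis .
  qed
  \<comment> \<open>Each of the three equations gains a factor 1/4: the 8 in the threshold for |a|
    against the 2 in the lower bound for \<open>P\<close>.\<close>
  have y: "norm y \<le> norm v / 4"
  proof (rule le_of_scaled_le[OF _ _ c])
    have "?c * norm y \<le> norm (P k2) * norm y"
      using norm_P_ge[OF k_inverse(2) mm] by (intro mult_right_mono) auto
    also have "\<dots> = k1 * (?m * norm v)"
      using arg_cong[OF P2_y, of norm] k_pos by (simp add: norm_mult)
    finally show "?c * norm y \<le> k1 * (?m * norm v)" .
    have "k1 * (?m * norm v) \<le> K * (r * r / (8 * K\<^sup>2) * norm v)"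
      using k_le k_pos mrr by (intro mult_mono mult_right_mono) auto
    also have "\<dots> = ?c * (norm v / 4)"
      using K by (simp add: field_simps power2_eq_square)
    finally show "k1 * (?m * norm v) \<le> ?c * (norm v / 4)" .
  qed
  have v: "norm v \<le> (norm y + norm \<theta>) / 4"
  proof (rule le_of_scaled_le[OF _ _ c])
    have "?c * norm v \<le> norm (P k1) * norm v"
      using norm_P_ge[OF k_inverse(1) mm] by (intro mult_right_mono) auto
    also have "\<dots> = ?m * norm (y + \<theta>)"
      using arg_cong[OF P1_v, of norm] by (simp add: norm_mult)
    also have "\<dots> \<le> ?m * (norm y + norm \<theta>)"
      by (intro mult_left_mono norm_triangle_ineq) auto
    finally show "?c * norm v \<le> ?m * (norm y + norm \<theta>)" .
    have "?m * (norm y + norm \<theta>) \<le> r * r / (8 * K\<^sup>2) * (norm y + norm \<theta>)"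
      using mrr by (intro mult_right_mono) auto
    also have "\<dots> \<le> r * r / (8 * K) * (norm y + norm \<theta>)"
      using K K2 r by (intro mult_right_mono divide_left_mono) auto
    also have "\<dots> = ?c * ((norm y + norm \<theta>) / 4)"
      using K by (simp add: field_simps)
    finally show "?m * (norm y + norm \<theta>) \<le> ?c * ((norm y + norm \<theta>) / 4)" .
  qed
  have \<theta>: "norm \<theta> \<le> (norm v + \<mu> * ?H) / 4"
  proof (rule le_of_scaled_le[OF _ _ c])
    have "?c * norm \<theta> \<le> norm (P k3) * norm \<theta>"
      using norm_P_ge[OF k_inverse(3) mm] by (intro mult_right_mono) auto
    also have "\<dots> \<le> k1 * (?m * norm v) + \<bar>\<gamma>\<bar> * (r * (?m * ?H))"
      using arg_cong[OF P3_\<theta>, of norm] norm_triangle_ineq4[of "- (of_real k1 * (a * v))" "of_real \<gamma> * (D * (a * \<eta>))"]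
        k_pos D by (simp add: norm_mult)
    finally show "?c * norm \<theta> \<le> k1 * (?m * norm v) + \<bar>\<gamma>\<bar> * (r * (?m * ?H))" .
    have "k1 * (?m * norm v) + \<bar>\<gamma>\<bar> * (r * (?m * ?H))
       \<le> K * (r * r / (8 * K\<^sup>2) * norm v) + K * (r * (\<mu> * r / (8 * K\<^sup>2) * ?H))"
      using k_le k_pos mrr m1 r \<mu> by (intro add_mono mult_mono) auto
    also have "\<dots> = ?c * ((norm v + \<mu> * ?H) / 4)"
      using K by (simp add: field_simps power2_eq_square)
    finally show "k1 * (?m * norm v) + \<bar>\<gamma>\<bar> * (r * (?m * ?H)) \<le> ?c * ((norm v + \<mu> * ?H) / 4)" .
  qed
  have \<mu>H: "0 \<le> \<mu> * ?H" "\<mu> * ?H \<le> ?H" "\<mu> * ?H \<le> r * ?H"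
    using \<mu> by (auto intro!: mult_right_mono mult_left_le_one_le)
  \<comment> \<open>The coefficients 1/4 are small enough to absorb all cross terms on the
    left.\<close>
  have vy\<theta>: "norm v \<le> \<mu> * ?H" "norm y \<le> \<mu> * ?H" "norm \<theta> \<le> \<mu> * ?H"
  proof -
    have "4 * norm y \<le> norm v" "4 * norm v \<le> norm y + norm \<theta>" "4 * norm \<theta> \<le> norm v + \<mu> * ?H"
      using y v \<theta> by simp_all
    then show "norm v \<le> \<mu> * ?H" "norm y \<le> \<mu> * ?H" "norm \<theta> \<le> \<mu> * ?H"
      using \<mu>H(1) norm_ge_zero[of v] norm_ge_zero[of y] norm_ge_zero[of \<theta>] by linarith+
  qed
  have bH: "norm v \<le> ?H" "norm y \<le> ?H" "norm \<theta> \<le> ?H"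
    and brH: "norm v \<le> r * ?H" "norm y \<le> r * ?H" "norm \<theta> \<le> r * ?H"
    using vy\<theta> \<mu>H by linarith+
  have H: "?H \<le> K\<^sup>2 * ?H" "K * ?H \<le> K\<^sup>2 * ?H" "0 \<le> ?H"
    using K2 by (auto simp: mult_le_cancel_right1 intro: mult_right_mono)
  have u: "norm u \<le> 3 * ?H"
  proof (rule le_of_scaled_le[OF _ _ r])
    have "D * u = a * v - (y + \<theta>)"
      using e1 by (simp add: algebra_simps)
    then have "r * norm u = norm (a * v - (y + \<theta>))"
      using D(2) by (metis norm_mult)
    then show "r * norm u \<le> ?m * norm v + (norm y + norm \<theta>)"
      using norm_triangle_ineq4[of "a * v" "y + \<theta>"] norm_triangle_ineq[of y \<theta>] by (simp add: norm_mult)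
    have "?m * norm v \<le> r * ?H"
      using m_le bH r by (intro mult_mono) auto
    then show "?m * norm v + (norm y + norm \<theta>) \<le> r * (3 * ?H)"
      using brH by simp
  qed
  \<comment> \<open>Inverts k D, whose modulus is at least r / K.\<close>
  have elastic: "norm x \<le> K * b / r"
    if "norm (of_real k * (D * x)) \<le> b" "1 / K \<le> k" for x k b
  proof -
    have "1 / K * (r * norm x) \<le> k * (r * norm x)"
      using that(2) r by (intro mult_right_mono) auto
    also have "\<dots> \<le> b"
      using that D(2) K by (simp add: norm_mult) (smt (verit) divide_nonneg_nonneg)
    finally show ?thesis
      using K r by (simp add: field_simps)
  qed
  have z: "norm z \<le> 2 * K\<^sup>2 * ?H"
  proof -
    have "of_real k2 * (D * z) = a * y + of_real k1 * v"
      using e4 by (simp add: algebra_simps)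
    then have "norm (of_real k2 * (D * z)) \<le> ?m * norm y + k1 * norm v"
      using norm_triangle_ineq[of "a * y" "of_real k1 * v"] k_pos by (simp add: norm_mult)
    also have "\<dots> \<le> r * ?H + K * (r * ?H)"
      using m_le k_le k_pos bH brH r by (intro add_mono mult_mono) auto
    finally have "norm z \<le> K * (r * ?H + K * (r * ?H)) / r"
      using k_inverse(2) by (rule elastic)
    also have "\<dots> = K * ?H + K\<^sup>2 * ?H"
      using r by (simp add: field_simps power2_eq_square)
    finally show ?thesis using H by linarith
  qed
  have \<phi>: "norm \<phi> \<le> 3 * K\<^sup>2 * ?H"
  proof -
    have "of_real k3 * (D * \<phi>) = a * \<theta> + of_real k1 * v + of_real \<gamma> * (D * \<eta>)"
      using e6 by (simp add: algebra_simps)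
    then have "norm (of_real k3 * (D * \<phi>)) \<le> ?m * norm \<theta> + k1 * norm v + \<bar>\<gamma>\<bar> * (r * ?H)"
      using norm_triangle_ineq[of "a * \<theta> + of_real k1 * v" "of_real \<gamma> * (D * \<eta>)"]
        norm_triangle_ineq[of "a * \<theta>" "of_real k1 * v"] k_pos D by (simp add: norm_mult)
    also have "\<dots> \<le> r * ?H + K * (r * ?H) + K * (r * ?H)"
      using m_le k_le k_pos bH brH r by (intro add_mono mult_mono) auto
    finally have "norm \<phi> \<le> K * (r * ?H + K * (r * ?H) + K * (r * ?H)) / r"
      using k_inverse(3) by (rule elastic)
    also have "\<dots> = K * ?H + 2 * (K\<^sup>2 * ?H)"
      using r by (simp add: field_simps power2_eq_square)
    finally show ?thesis using H by linarith
  qed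
  \<comment> \<open>Among the components, only \<open>\<sigma>\<close> is recovered from an equation
    containing the damping; this is the source of the term d / r.\<close>
  have \<sigma>: "norm \<sigma> \<le> 2 * K\<^sup>2 * ?H + K\<^sup>2 * (d / r * ?H)"
  proof -
    have "of_real k4 * (D * \<sigma>) = a * \<eta> + of_real \<gamma> * (D * \<theta>) + of_real d * \<eta>"
      using e8 by (simp add: algebra_simps)
    then have "norm (of_real k4 * (D * \<sigma>)) \<le> ?m * ?H + \<bar>\<gamma>\<bar> * (r * norm \<theta>) + d * ?H"
      using norm_triangle_ineq[of "a * \<eta> + of_real \<gamma> * (D * \<theta>)" "of_real d * \<eta>"]
        norm_triangle_ineq[of "a * \<eta>" "of_real \<gamma> * (D * \<theta>)"] d D by (simp add: norm_mult)
    also have "\<dots> \<le> r * ?H + K * (r * ?H) + d * ?H"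
      using m_le k_le k_pos bH brH r d by (intro add_mono mult_mono) auto
    finally have "norm \<sigma> \<le> K * (r * ?H + K * (r * ?H) + d * ?H) / r"
      using k_inverse(4) by (rule elastic)
    also have "\<dots> = K * ?H + K\<^sup>2 * ?H + K * (d / r * ?H)"
      using r by (simp add: field_simps power2_eq_square)
    also have "K * (d / r * ?H) \<le> K\<^sup>2 * (d / r * ?H)"
      using K2 d r by (intro mult_right_mono) auto
    finally show ?thesis using H by linarith
  qed
  define X where "X = K\<^sup>2 * ?H"
  define Y where "Y = K\<^sup>2 * (d / r * ?H)"
  have B: "3 * K\<^sup>2 * (1 + d / r) * ?H = 3 * X + 3 * Y"
    by (simp add: X_def Y_def algebra_simps)
  have "0 \<le> Y"
    using K d r by (simp add: Y_def)
  moreover have "?H \<le> X" "norm \<sigma> \<le> 2 * X + Y" "norm z \<le> 2 * X" "norm \<phi> \<le> 3 * X"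
    using H \<sigma> z \<phi> by (simp_all add: X_def Y_def mult.assoc)
  ultimately show ?thesis
    unfolding bounded_by_def B using bH u H(3) by (intro conjI) linarith+
qed

text \<open>The damping acts on \<open>\<eta>\<close> only. Control of the other unknowns is
  obtained by reading the wave equations backwards through their coupling terms:
  \<open>\<theta>\<close> from the equation of \<open>\<eta>\<close>, v from that of
  \<open>\<theta>\<close>, y from that of v. Each step divides by a coupling coefficient, and this
  is where powers of r are lost.\<close>

lemma \<theta>_le:
  assumes "norm a > 0"
  shows "norm \<theta> \<le> K * (norm a / r + d / r + K * (r / norm a)) * norm \<eta>"
proof -
  let ?m = "norm a"
  have "1 / K * (r * (?m * norm \<theta>)) \<le> \<bar>\<gamma>\<bar> * (r * (?m * norm \<theta>))"
    using k_inverse(5) r by (intro mult_right_mono) auto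
  also have "\<dots> = norm (P k4 + of_real d * a) * norm \<eta>"
    using arg_cong[OF P4_\<eta>, of norm] D by (simp add: norm_mult)
  also have "\<dots> \<le> (?m * ?m + K * (r * r) + d * ?m) * norm \<eta>"
  proof (intro mult_right_mono)
    show "norm (P k4 + of_real d * a) \<le> ?m * ?m + K * (r * r) + d * ?m"
      using norm_triangle_ineq[of "P k4" "of_real d * a"] norm_P_le[of k4] k_pos k_le d
      by (simp add: norm_mult)
  qed simp
  finally show ?thesis
    using assms K r by (simp add: field_simps)
qed

lemma v_le:
  assumes "norm a > 0"
  shows "norm v \<le> K * (norm (P k3) / norm a * norm \<theta> + K * (r * norm \<eta>))"
proof -
  let ?m = "norm a"
  have "of_real k1 * (a * v) = - (P k3 * \<theta> + of_real \<gamma> * (D * (a * \<eta>)))"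
    by (simp add: P3_\<theta>)
  then have "norm (of_real k1 * (a * v)) = norm (P k3 * \<theta> + of_real \<gamma> * (D * (a * \<eta>)))"
    by (metis norm_minus_cancel)
  then have *: "k1 * (?m * norm v) \<le> norm (P k3) * norm \<theta> + \<bar>\<gamma>\<bar> * (r * (?m * norm \<eta>))"
    using norm_triangle_ineq[of "P k3 * \<theta>" "of_real \<gamma> * (D * (a * \<eta>))"] D k_pos by (simp add: norm_mult)
  have "1 / K * (?m * norm v) \<le> k1 * (?m * norm v)"
    using k_inverse(1) by (intro mult_right_mono) auto
  also note *
  also have "\<bar>\<gamma>\<bar> * (r * (?m * norm \<eta>)) \<le> K * (r * (?m * norm \<eta>))"
    using k_le r by (intro mult_right_mono) auto
  finally show ?thesis
    using assms K by (simp add: field_simps)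
qed

lemma y_le:
  assumes "norm a > 0"
  shows "norm y \<le> norm (P k1) / norm a * norm v + norm \<theta>"
proof -
  have "norm a * norm (y + \<theta>) = norm (P k1) * norm v"
    using arg_cong[OF P1_v, of norm] by (simp add: norm_mult)
  then have "norm (y + \<theta>) = norm (P k1) / norm a * norm v"
    using assms by (simp add: field_simps)
  then show ?thesis
    using norm_triangle_ineq4[of "y + \<theta>" \<theta>] by simp
qed

lemma slaved_components:
  assumes "norm a > 0"
  shows "norm u \<le> K * (r / norm a * norm v)" "norm z = r / norm a * norm y"
    "norm \<phi> = r / norm a * norm \<theta>" "norm \<sigma> = r / norm a * norm \<eta>"
proof -
  have "norm a * norm u = k1 * (r * norm v)"
    using arg_cong[OF e2, of norm] D k_pos by (simp add: norm_mult)
  also have "\<dots> \<le> K * (r * norm v)"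
    using k_le r by (intro mult_right_mono) auto
  finally show "norm u \<le> K * (r / norm a * norm v)"
    using assms by (simp add: field_simps)
  show "norm z = r / norm a * norm y" "norm \<phi> = r / norm a * norm \<theta>" "norm \<sigma> = r / norm a * norm \<eta>"
    using arg_cong[OF e3, of norm] arg_cong[OF e5, of norm] arg_cong[OF e7, of norm] D assms
    by (simp_all add: norm_mult field_simps)
qed

text \<open>u, z, \<open>\<phi>\<close>, \<open>\<sigma>\<close> differ from v, y,
  \<open>\<theta>\<close>, \<open>\<eta>\<close> by factors of modulus r / |a|, up to K, so only
  that ratio enters.\<close>

lemma bounded_by_slaved:
  assumes "norm a > 0" "r / norm a \<le> \<beta>" "1 \<le> \<beta>"
    and "norm v \<le> b" "norm y \<le> b" "norm \<theta> \<le> b" "norm \<eta> \<le> b"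
  shows "bounded_by (K * \<beta> * b)"
proof -
  have b: "0 \<le> b" "0 \<le> r / norm a"
    using assms(4) norm_ge_zero[of v] r by (linarith, simp)
  have *: "x \<le> K * \<beta> * b" if "x \<le> b" for x
  proof -
    have "1 * 1 * b \<le> K * \<beta> * b"
      using K assms(3) b by (intro mult_mono) auto
    with that show ?thesis by linarith
  qed
  have **: "r / norm a * x \<le> \<beta> * b" if "x \<le> b" "0 \<le> x" for x
    using that assms(2) b by (intro mult_mono) auto
  have ***: "x \<le> K * \<beta> * b" if "x \<le> \<beta> * b" for x
  proof -
    have "1 * (\<beta> * b) \<le> K * (\<beta> * b)"
      using K assms(3) b by (intro mult_right_mono) auto
    with that show ?thesis by simp
  qed
  have "norm u \<le> K * (\<beta> * b)"
    using slaved_components(1)[OF assms(1)] **[OF assms(4)] K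
    by (smt (verit) mult_left_mono norm_ge_zero)
  then show ?thesis
    unfolding bounded_by_def slaved_components(2-4)[OF assms(1)]
    using *[OF assms(4)] *[OF assms(5)] *[OF assms(6)] *[OF assms(7)]
      **[OF assms(5)] **[OF assms(6)] **[OF assms(7)] *** by (simp add: mult.assoc)
qed

text \<open>Bookkeeping for the chain from \<open>\<eta>\<close> to y, used in both frequency
  ranges: \<open>\<tau>\<close> is the loss from \<open>\<eta>\<close> to \<open>\<theta>\<close>, s
  the loss in each of the two passages through a \<open>P k\<close> / a, and \<open>\<beta>\<close>
  the loss r / |a| for the slaved unknowns. Together they give s^2 \<open>\<tau>\<close>
  \<open>\<beta>\<close>.\<close>

lemma large_eigenvalue:
  assumes m: "norm a > 0" and M: "M \<ge> 0" and c: "c > 0"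
    and 1: "norm a / r \<le> M * \<tau>" "r / norm a \<le> \<tau> / c" "d / r \<le> K * \<tau>" "r / norm a \<le> \<beta> / c"
      "norm a + K * (r * r) / norm a \<le> (M + K / c) * s" "r \<le> s * \<tau>" "1 \<le> s" "1 \<le> \<beta>" "0 \<le> \<tau>"
      "1 \<le> s * \<tau>"
  defines "C1 \<equiv> K * (M + K + K / c)" and "C2 \<equiv> M + K / c"
  defines "C3 \<equiv> K * (C2 * C1 + K)"
  shows "norm \<theta> \<le> C1 * \<tau> * norm \<eta>"
    and "bounded_by (K * ((1 + 1 / c) * \<beta>) * ((C2 * C3 + C3 + C1 + 1) * (s * s * \<tau>) * norm \<eta>))"
proof -
  let ?H = "norm \<eta>"
  have C: "0 \<le> C1" "0 \<le> C2" "0 \<le> C3"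
    using K M c by (auto simp: C1_def C2_def C3_def)
  have "norm a / r + d / r + K * (r / norm a) \<le> M * \<tau> + K * \<tau> + K * (\<tau> / c)"
    using 1 K by (intro add_mono mult_left_mono) auto
  also have "\<dots> = (M + K + K / c) * \<tau>"
    by (simp add: algebra_simps)
  finally have "K * (norm a / r + d / r + K * (r / norm a)) * ?H \<le> K * ((M + K + K / c) * \<tau>) * ?H"
    using K by (intro mult_right_mono mult_left_mono) auto
  then show \<theta>: "norm \<theta> \<le> C1 * \<tau> * ?H"
    using \<theta>_le[OF m] by (simp add: C1_def mult.assoc)
  have Pm: "norm (P k) / norm a \<le> C2 * s" if "0 \<le> k" "k \<le> K" for k
  proof -
    have "norm (P k) / norm a \<le> (norm a * norm a + K * (r * r)) / norm a"
      using norm_P_le[OF that] by (intro divide_right_mono) auto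
    then show ?thesis
      using 1(5) m by (simp add: add_divide_distrib C2_def)
  qed
  have "norm v \<le> K * (norm (P k3) / norm a * norm \<theta> + K * (r * ?H))"
    by (rule v_le[OF m])
  also have "\<dots> \<le> K * (C2 * s * (C1 * \<tau> * ?H) + K * (s * \<tau> * ?H))"
    using Pm[of k3] k_pos k_le \<theta> C 1 K by (intro mult_left_mono add_mono mult_mono mult_right_mono) auto
  also have "\<dots> = C3 * (s * \<tau>) * ?H"
    by (simp add: C3_def algebra_simps)
  finally have v: "norm v \<le> C3 * (s * \<tau>) * ?H" .
  have "norm y \<le> norm (P k1) / norm a * norm v + norm \<theta>"
    by (rule y_le[OF m])
  also have "\<dots> \<le> C2 * s * (C3 * (s * \<tau>) * ?H) + C1 * \<tau> * ?H"
    using Pm[of k1] k_pos k_le v \<theta> C 1 by (intro add_mono mult_mono) auto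
  finally have y: "norm y \<le> C2 * C3 * (s * s * \<tau> * ?H) + C1 * (\<tau> * ?H)"
    by (simp add: algebra_simps)
  have t: "\<tau> * ?H \<le> s * s * \<tau> * ?H" "s * \<tau> * ?H \<le> s * s * \<tau> * ?H" "?H \<le> s * s * \<tau> * ?H" "0 \<le> \<tau> * ?H"
  proof -
    have "1 * 1 * \<tau> \<le> s * s * \<tau>"
      using 1 by (intro mult_right_mono mult_mono) auto
    then show "\<tau> * ?H \<le> s * s * \<tau> * ?H"
      by (intro mult_right_mono) auto
    have "1 * (s * \<tau>) \<le> s * (s * \<tau>)"
      using 1 by (intro mult_right_mono) auto
    then have *: "s * \<tau> \<le> s * s * \<tau>" by (simp add: mult.assoc)
    then show "s * \<tau> * ?H \<le> s * s * \<tau> * ?H"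
      by (rule mult_right_mono) auto
    have "1 * ?H \<le> s * s * \<tau> * ?H"
      using * 1(10) by (intro mult_right_mono) auto
    then show "?H \<le> s * s * \<tau> * ?H" by simp
    show "0 \<le> \<tau> * ?H" using 1 by simp
  qed
  let ?b = "(C2 * C3 + C3 + C1 + 1) * (s * s * \<tau>) * ?H"
  have b_eq: "?b = C2 * C3 * (s * s * \<tau> * ?H) + C3 * (s * s * \<tau> * ?H) + C1 * (s * s * \<tau> * ?H) + s * s * \<tau> * ?H"
    by (simp add: algebra_simps)
  have nn: "0 \<le> s * s * \<tau> * ?H" using t by linarith
  have p: "0 \<le> C2 * C3 * (s * s * \<tau> * ?H)" "0 \<le> C3 * (s * s * \<tau> * ?H)" "0 \<le> C1 * (s * s * \<tau> * ?H)"
    using C nn by auto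
  have q: "C3 * (s * \<tau>) * ?H \<le> C3 * (s * s * \<tau> * ?H)" "C1 * (\<tau> * ?H) \<le> C1 * (s * s * \<tau> * ?H)"
    using mult_left_mono[OF t(2) C(3)] mult_left_mono[OF t(1) C(1)] by (auto simp: mult.assoc)
  have "\<beta> / c \<le> (1 + 1 / c) * \<beta>" "1 * 1 \<le> (1 + 1 / c) * \<beta>"
    using 1(8) c by (simp add: algebra_simps, intro mult_mono) auto
  then show "bounded_by (K * ((1 + 1 / c) * \<beta>) * ?b)"
    using 1(4) v y \<theta> p q t(3) nn unfolding b_eq
    by (intro bounded_by_slaved m) (auto simp: mult.assoc)
qed

text \<open>Equal wave speeds: \<open>P\<close> is the same factor in the equations for \<open>v\<close> and \<open>y\<close>. Either it is
  large and forces \<open>v\<close> and \<open>y\<close> to be controlled by \<open>\<theta>\<close>, or it is small and improves the bound of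
  \<open>v\<close>. The relation \<open>P (y (y + \<theta>) + k\<^sub>1 v\<^sup>2) = 0\<close> then bounds \<open>y\<close>.\<close>

lemma large_eigenvalue_equal_speeds:
  assumes eq: "k1 = k2" "k2 = k3"
    and m: "norm a > 0" and M: "M \<ge> 1" and c: "c > 0"
    and mr: "norm a \<le> M * r" "c * r \<le> norm a" and T: "norm \<theta> \<le> C1 * r * norm \<eta>" "C1 \<ge> 0" and r1: "1 \<le> r"
  shows "bounded_by (K * (1 + 1 / c) * (((2 * K) * (K * (2 * K * M) / c + 1) * (C1 + 1) + (K * K) * (2 * K) + 1) * (r * norm \<eta>)))"
proof -
  let ?H = "norm \<eta>"
  \<comment> \<open>The threshold \<open>?L\<close> is twice the bound K M r for the coupling
    coefficient k1 |a|, so above it the equations of v and y form a contraction with factor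
    1/2.\<close>
  let ?P = "norm (P k1)" and ?L = "2 * K * M * r"
  let ?A = "K * (2 * K * M) / c + 1"
  have A: "?A \<ge> 1" using K M c by simp
  have rH: "0 \<le> r * ?H" "0 \<le> C1 * (r * ?H)"
    using r T(2) by auto
  have AT: "norm \<theta> \<le> ?A * norm \<theta>"
    using A by (simp add: mult_le_cancel_right1)
  have v: "norm v \<le> ?A * norm \<theta> + K * K * (r * ?H)"
  proof (cases "?L \<le> ?P")
    case True
    have L: "0 < ?L" using K M r by simp
    have y: "norm y \<le> norm v / 2"
    proof (rule le_of_scaled_le[OF _ _ L])
      have "?L * norm y \<le> ?P * norm y"
        using True by (intro mult_right_mono) auto
      also have "\<dots> = k1 * (norm a * norm v)"
        using arg_cong[OF P2_y, of norm] k_pos eq by (simp add: norm_mult)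
      finally show "?L * norm y \<le> k1 * (norm a * norm v)" .
      have "k1 * (norm a * norm v) \<le> K * (M * r * norm v)"
        using k_le k_pos mr M r K by (intro mult_mono) auto
      then show "k1 * (norm a * norm v) \<le> ?L * (norm v / 2)"
        by simp
    qed
    have "norm v \<le> (norm y + norm \<theta>) / 2"
    proof (rule le_of_scaled_le[OF _ _ L])
      have "?L * norm v \<le> ?P * norm v"
        using True by (intro mult_right_mono) auto
      also have "\<dots> = norm a * norm (y + \<theta>)"
        using arg_cong[OF P1_v, of norm] by (simp add: norm_mult)
      also have "\<dots> \<le> M * r * (norm y + norm \<theta>)"
        using mr M r by (intro mult_mono norm_triangle_ineq) auto
      finally show "?L * norm v \<le> M * r * (norm y + norm \<theta>)" .
      have "1 * (M * r * (norm y + norm \<theta>)) \<le> K * (M * r * (norm y + norm \<theta>))"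
        using K M r by (intro mult_right_mono) auto
      then show "M * r * (norm y + norm \<theta>) \<le> ?L * ((norm y + norm \<theta>) / 2)"
        by simp
    qed
    with y have "2 * norm v \<le> norm y + norm \<theta>" "2 * norm y \<le> norm v"
      by simp_all
    then have "norm v \<le> norm \<theta>"
      using norm_ge_zero[of v] norm_ge_zero[of \<theta>] by linarith
    moreover have "0 \<le> K * K * (r * ?H)"
      using K rH by simp
    ultimately show ?thesis
      using AT by linarith
  next
    case False
    have "norm v \<le> K * (norm (P k3) / norm a * norm \<theta> + K * (r * ?H))"
      by (rule v_le[OF m])
    also have "\<dots> \<le> K * ((2 * K * M) / c * norm \<theta> + K * (r * ?H))"
    proof -
      have "norm (P k3) / norm a \<le> ?L / (c * r)"
        using False eq mr m c r M K by (intro frac_le) auto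
      then have "norm (P k3) / norm a \<le> (2 * K * M) / c"
        using r by simp
      then show ?thesis
        using K by (intro mult_left_mono add_mono mult_right_mono) auto
    qed
    also have "\<dots> = K * (2 * K * M) / c * norm \<theta> + K * K * (r * ?H)"
      by (simp add: algebra_simps)
    also have "\<dots> \<le> ?A * norm \<theta> + K * K * (r * ?H)"
      by (intro add_right_mono mult_right_mono) auto
    finally show ?thesis .
  qed
  have y: "norm y \<le> norm \<theta> + K * norm v"
  proof (cases "P k1 = 0")
    case True
    with P1_v m have "y = - \<theta>"
      by (auto simp: eq_neg_iff_add_eq_0)
    then show ?thesis using K by simp
  next
    case False
    have "P k1 * (y * (y + \<theta>)) = (P k2 * y) * (y + \<theta>)"
      by (simp add: eq)
    also have "\<dots> = - (of_real k1 * v * (a * (y + \<theta>)))"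
      by (simp only: P2_y) (simp add: algebra_simps)
    also have "\<dots> = P k1 * (- (of_real k1 * v * v))"
      by (simp only: P1_v[symmetric]) (simp add: algebra_simps)
    finally have "y * (y + \<theta>) = - (of_real k1 * v * v)"
      using False by (simp only: mult_cancel_left simp_thms)
    then have "y * y = - (of_real k1 * v * v) - y * \<theta>"
      by (simp add: algebra_simps)
    then have "norm y * norm y \<le> k1 * norm v * norm v + norm y * norm \<theta>"
      using norm_triangle_ineq4[of "- (of_real k1 * v * v)" "y * \<theta>"] k_pos
      by (metis (no_types, opaque_lifting) norm_minus_cancel norm_mult norm_of_real abs_of_pos)
    also have "k1 * norm v * norm v \<le> K * norm v * norm v"
      using k_le by (intro mult_right_mono) auto
    finally have *: "norm y * norm y \<le> K * norm v * norm v + norm y * norm \<theta>" by simp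
    show ?thesis
    \<comment> \<open>The quadratic inequality for |y| forces |y| <= |\<open>\<theta>\<close>| + K
      |v|: a larger |y| exceeds |v| too, and then |y|^2 would dominate the right-hand side.\<close>
    proof (rule ccontr)
      assume "\<not> ?thesis"
      then have less: "norm \<theta> + K * norm v < norm y" by simp
      have Kv: "norm v \<le> K * norm v"
        using K by (simp add: mult_le_cancel_right1)
      have "norm y * (norm \<theta> + K * norm v) < norm y * norm y"
        using less K by (intro mult_strict_left_mono) (smt (verit) mult_nonneg_nonneg norm_ge_zero)+
      moreover have "norm v * (K * norm v) \<le> norm y * (K * norm v)"
        using less Kv K by (intro mult_right_mono) (smt (verit) norm_ge_zero mult_nonneg_nonneg)+
      ultimately show False
        using * by (simp add: algebra_simps)
    qed
  qed
  have At: "?A * norm \<theta> \<le> ?A * (C1 * (r * ?H))"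
    using T(1) A by (intro mult_left_mono) (auto simp: mult.assoc)
  have v': "norm v \<le> ?A * (C1 * (r * ?H)) + K * K * (r * ?H)"
    using v At by linarith
  have Kv': "K * norm v \<le> K * (?A * (C1 * (r * ?H))) + K * (K * K * (r * ?H))"
    using mult_left_mono[OF v', of K] K by (simp add: distrib_left)
  let ?b = "((2 * K) * ?A * (C1 + 1) + (K * K) * (2 * K) + 1) * (r * ?H)"
  have b_eq: "?b = 2 * (K * (?A * (C1 * (r * ?H)))) + 2 * (K * (?A * (r * ?H))) + 2 * (K * (K * K * (r * ?H))) + r * ?H"
    by (simp add: algebra_simps add_divide_distrib)
  define X where "X = ?A * (C1 * (r * ?H))"
  define Y where "Y = K * K * (r * ?H)"
  have X: "0 \<le> X" "X \<le> K * X" "C1 * (r * ?H) \<le> X"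
  proof -
    show X0: "0 \<le> X"
      unfolding X_def by (rule mult_nonneg_nonneg) (use A rH in linarith)+
    show "X \<le> K * X"
      using mult_right_mono[OF K X0] by simp
    show "C1 * (r * ?H) \<le> X"
      using mult_right_mono[OF A rH(2)] by (simp add: X_def)
  qed
  have Y: "0 \<le> Y" "Y \<le> K * Y"
  proof -
    show Y0: "0 \<le> Y"
      unfolding Y_def by (rule mult_nonneg_nonneg) (use K rH in simp_all)
    show "Y \<le> K * Y"
      using mult_right_mono[OF K Y0] by simp
  qed
  have p: "0 \<le> K * (?A * (r * ?H))"
    using K A r by (intro mult_nonneg_nonneg) auto
  have H: "?H \<le> r * ?H"
    using r1 by (simp add: mult_le_cancel_right1)
  have t: "norm \<theta> \<le> X"
    using T(1) X(3) by (simp add: mult.assoc)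
  show ?thesis
  proof (rule bounded_by_slaved[OF m])
    have "r / norm a \<le> r / (c * r)"
      using mr r c m by (intro divide_left_mono) auto
    then show "r / norm a \<le> 1 + 1 / c"
      using r by simp
    show "norm v \<le> ?b" "norm y \<le> ?b" "norm \<theta> \<le> ?b" "norm \<eta> \<le> ?b"
      unfolding b_eq X_def[symmetric] Y_def[symmetric]
      using v'[folded X_def Y_def] Kv'[folded X_def Y_def] y t X Y p H rH by linarith+
  qed (use c in auto)
qed

section \<open>Energy identity and spectral gap of a single mode\<close>

lemma norm_power2_le_energy:
  "(norm v)\<^sup>2 \<le> K * energy" "(norm u)\<^sup>2 \<le> K * energy" "(norm z)\<^sup>2 \<le> K * energy" "(norm y)\<^sup>2 \<le> K * energy"
  "(norm \<phi>)\<^sup>2 \<le> K * energy" "(norm \<theta>)\<^sup>2 \<le> K * energy" "(norm \<sigma>)\<^sup>2 \<le> K * energy" "(norm \<eta>)\<^sup>2 \<le> K * energy"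
proof -
  have nn: "0 \<le> k1 * (norm v)\<^sup>2" "0 \<le> k2 * (norm z)\<^sup>2" "0 \<le> k3 * (norm \<phi>)\<^sup>2" "0 \<le> k4 * (norm \<sigma>)\<^sup>2"
    using k_pos by auto
  have E: "0 \<le> energy"
    using nn by (simp add: energy_def)
  have *: "x \<le> K * energy" if "x \<le> energy" for x
  proof -
    have "1 * energy \<le> K * energy"
      using K E by (intro mult_right_mono)
    with that show ?thesis by simp
  qed
  have **: "(norm x)\<^sup>2 \<le> K * energy" if "1 \<le> K * k" "k * (norm x)\<^sup>2 \<le> energy" for k x
  proof -
    have "1 * (norm x)\<^sup>2 \<le> K * k * (norm x)\<^sup>2"
      using that(1) by (intro mult_right_mono) auto
    also have "\<dots> \<le> K * energy"
      using that(2) K by (simp add: mult.assoc mult_left_mono)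
    finally show ?thesis by simp
  qed
  show "(norm u)\<^sup>2 \<le> K * energy" "(norm y)\<^sup>2 \<le> K * energy" "(norm \<theta>)\<^sup>2 \<le> K * energy" "(norm \<eta>)\<^sup>2 \<le> K * energy"
    by (rule *, use nn in \<open>simp add: energy_def\<close>)+
  show "(norm v)\<^sup>2 \<le> K * energy"
    by (rule **[OF k_ge(1)]) (use nn in \<open>simp add: energy_def\<close>)
  show "(norm z)\<^sup>2 \<le> K * energy"
    by (rule **[OF k_ge(2)]) (use nn in \<open>simp add: energy_def\<close>)
  show "(norm \<phi>)\<^sup>2 \<le> K * energy"
    by (rule **[OF k_ge(3)]) (use nn in \<open>simp add: energy_def\<close>)
  show "(norm \<sigma>)\<^sup>2 \<le> K * energy"
    by (rule **[OF k_ge(4)]) (use nn in \<open>simp add: energy_def\<close>)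
qed

lemma energy_le:
  assumes "bounded_by b"
  shows "energy \<le> 8 * K * b\<^sup>2"
proof -
  have sq: "(norm x)\<^sup>2 \<le> b\<^sup>2" if "norm x \<le> b" for x :: complex
    using that by (intro power_mono) auto
  have *: "k * (norm x)\<^sup>2 \<le> K * b\<^sup>2" if "norm x \<le> b" "k \<le> K" "0 < k" for x :: complex and k
    using that sq by (intro mult_mono) auto
  have **: "(norm x)\<^sup>2 \<le> K * b\<^sup>2" if "norm x \<le> b" for x :: complex
    using *[OF that, of 1] K by simp
  have "energy \<le> K * b\<^sup>2 + K * b\<^sup>2 + K * b\<^sup>2 + K * b\<^sup>2 + K * b\<^sup>2 + K * b\<^sup>2 + K * b\<^sup>2 + K * b\<^sup>2"
    unfolding energy_def using assms k_le k_pos unfolding bounded_by_def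
    by (intro add_mono * **) auto
  then show ?thesis by simp
qed

text \<open>Pairing the system with the conjugate unknowns in the energy weights leaves a purely
  imaginary quantity N apart from the damping term. Its real part gives the exact dissipation, and
  estimating its fourteen products crudely bounds the imaginary part of a, which keeps |a| of order
  1 + r.\<close>

lemma energy_identity:
  "Re a * energy = - d * (norm \<eta>)\<^sup>2"
  "\<bar>Im a\<bar> * energy \<le> 16 * K\<^sup>2 * (1 + r) * energy"
proof -
  let ?k1 = "of_real k1 :: complex" and ?k2 = "of_real k2 :: complex" and ?k3 = "of_real k3 :: complex"
    and ?k4 = "of_real k4 :: complex" and ?g = "of_real \<gamma> :: complex"
  \<comment> \<open>The locale knows D only through D^2 = -r^2 and its modulus; as r > 0, D has to
    be purely imaginary.\<close>
  obtain x where Dx: "D = \<i> * of_real x"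
  proof -
    have "(Re D)\<^sup>2 - (Im D)\<^sup>2 = - (r * r)" "2 * Re D * Im D = 0"
      using D(1) by (auto simp: complex_eq_iff power2_eq_square)
    moreover have "0 < r * r"
      using r by simp
    ultimately have "Im D = 0 \<Longrightarrow> (Re D)\<^sup>2 < 0"
      by simp
    then have "Im D \<noteq> 0"
      by auto
    with \<open>2 * Re D * Im D = 0\<close> have "Re D = 0"
      by simp
    then show thesis
      by (intro that[of "Im D"]) (simp add: complex_eq_iff)
  qed
  define N where "N = ?k1 * cnj v * (D * u + y + \<theta>) + cnj u * (?k1 * (D * v)) + ?k2 * cnj z * (D * y)
    + cnj y * (- (?k1 * v) + ?k2 * (D * z)) + ?k3 * cnj \<phi> * (D * \<theta>)
    + cnj \<theta> * (- (?k1 * v) + ?k3 * (D * \<phi>) - ?g * (D * \<eta>)) + ?k4 * cnj \<sigma> * (D * \<eta>)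
    + cnj \<eta> * (- (?g * (D * \<theta>)) + ?k4 * (D * \<sigma>))"
  have "a * of_real energy = ?k1 * cnj v * (a * v) + cnj u * (a * u) + ?k2 * cnj z * (a * z) + cnj y * (a * y)
     + ?k3 * cnj \<phi> * (a * \<phi>) + cnj \<theta> * (a * \<theta>) + ?k4 * cnj \<sigma> * (a * \<sigma>) + cnj \<eta> * (a * \<eta>)"
    unfolding energy_def of_real_add of_real_mult[of _ "(norm _)\<^sup>2"] complex_norm_square by (simp only: algebra_simps)
  also have "\<dots> = N - of_real d * (cnj \<eta> * \<eta>)"
    unfolding e1 e2 e3 e4 e5 e6 e7 e8 N_def by (simp only: algebra_simps)
  also have "cnj \<eta> * \<eta> = of_real ((norm \<eta>)\<^sup>2)"
    by (simp add: complex_norm_square mult.commute del: of_real_power)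
  finally have aE: "a * of_real energy = N - of_real (d * (norm \<eta>)\<^sup>2)"
    by simp
  have "Re N = 0"
    unfolding N_def Dx by (simp add: algebra_simps)
  with arg_cong[OF aE, of Re] show "Re a * energy = - d * (norm \<eta>)\<^sup>2"
    by simp
  have "Im a * energy = Im N"
    using arg_cong[OF aE, of Im] by simp
  then have "\<bar>Im a\<bar> * energy \<le> norm N"
    using abs_Im_le_cmod[of N] norm_power2_le_energy(8) K
    by (smt (verit) abs_mult mult_minus_left mult_nonneg_nonneg zero_le_power2 zero_less_mult_iff mult_le_0_iff)
  also have "norm N \<le> 16 * K\<^sup>2 * (1 + r) * energy"
  proof -
    have E: "0 \<le> K * energy"
      using norm_power2_le_energy(8) zero_le_power2[of "norm \<eta>"] by linarith
    have prod: "norm p * norm q \<le> K * energy" if "(norm p)\<^sup>2 \<le> K * energy" "(norm q)\<^sup>2 \<le> K * energy" for p q :: complex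
      using that sum_squares_bound[of "norm p" "norm q"] by simp
    have *: "norm (of_real k * (cnj p * (D * q))) \<le> K * (r * (K * energy))"
      if "\<bar>k\<bar> \<le> K" "(norm p)\<^sup>2 \<le> K * energy" "(norm q)\<^sup>2 \<le> K * energy" for k p q
    proof -
      have "\<bar>k\<bar> * (r * (norm p * norm q)) \<le> K * (r * (K * energy))"
        by (rule mult_mono[OF that(1) mult_left_mono[OF prod[OF that(2,3)]]]) (use r K in auto)
      then show ?thesis using D by (simp add: norm_mult mult_ac)
    qed
    have **: "norm (of_real k * (cnj p * q)) \<le> K * (K * energy)"
      if "\<bar>k\<bar> \<le> K" "(norm p)\<^sup>2 \<le> K * energy" "(norm q)\<^sup>2 \<le> K * energy" for k p q
    proof -
      have "\<bar>k\<bar> * (norm p * norm q) \<le> K * (K * energy)"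
        by (rule mult_mono[OF that(1) prod[OF that(2,3)]]) (use K in auto)
      then show ?thesis by (simp add: norm_mult mult_ac)
    qed
    note nle = norm_power2_le_energy
    have N: "N = ?k1 * (cnj v * (D * u)) + ?k1 * (cnj v * y) + ?k1 * (cnj v * \<theta>) + ?k1 * (cnj u * (D * v))
      + ?k2 * (cnj z * (D * y)) + of_real (- k1) * (cnj y * v) + ?k2 * (cnj y * (D * z)) + ?k3 * (cnj \<phi> * (D * \<theta>))
      + of_real (- k1) * (cnj \<theta> * v) + ?k3 * (cnj \<theta> * (D * \<phi>)) + of_real (- \<gamma>) * (cnj \<theta> * (D * \<eta>))
      + ?k4 * (cnj \<sigma> * (D * \<eta>)) + of_real (- \<gamma>) * (cnj \<eta> * (D * \<theta>)) + ?k4 * (cnj \<eta> * (D * \<sigma>))"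
      by (simp add: N_def algebra_simps)
    let ?A = "K * (r * (K * energy))" and ?B = "K * (K * energy)"
    have "norm N \<le> ?A + ?B + ?B + ?A + ?A + ?B + ?A + ?A + ?B + ?A + ?A + ?A + ?A + ?A"
      unfolding N
      by (intro norm_triangle_le add_mono * ** nle) (use k_le k_pos in auto)
    \<comment> \<open>Ten products carry D and four do not; 16 is a common round bound.\<close>
    also have "\<dots> = 10 * (r * (K\<^sup>2 * energy)) + 4 * (K\<^sup>2 * energy)"
      by (simp add: power2_eq_square algebra_simps)
    also have "\<dots> \<le> 16 * (r * (K\<^sup>2 * energy)) + 16 * (K\<^sup>2 * energy)"
    proof -
      have "0 \<le> K\<^sup>2 * energy"
        using E K by (simp add: power2_eq_square mult.assoc)
      moreover from this have "0 \<le> r * (K\<^sup>2 * energy)"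
        using r by simp
      ultimately show ?thesis by linarith
    qed
    finally show ?thesis by (simp add: algebra_simps)
  qed
  finally show "\<bar>Im a\<bar> * energy \<le> 16 * K\<^sup>2 * (1 + r) * energy" .
qed

text \<open>17 is 16 for the imaginary part plus 1 for the real part, which the energy identity and
  the hypothesis confine to [-1, 0].\<close>

lemma norm_eigenvalue_le:
  assumes "0 < energy" "-1 \<le> Re a"
  shows "norm a \<le> 17 * K\<^sup>2 * (1 + r)"
proof -
  have "Re a * energy \<le> 0"
    using energy_identity(1) d by simp
  then have "\<bar>Re a\<bar> \<le> 1"
    using assms by (simp add: mult_le_0_iff)
  moreover have "\<bar>Im a\<bar> \<le> 16 * K\<^sup>2 * (1 + r)"
    using energy_identity(2) assms(1) by simp
  moreover have "1 \<le> K\<^sup>2 * (1 + r)"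
  proof -
    have "1 * 1 \<le> K\<^sup>2 * (1 + r)"
      using K r by (intro mult_mono) auto
    then show ?thesis by simp
  qed
  moreover have "norm a \<le> \<bar>Re a\<bar> + \<bar>Im a\<bar>"
    by (rule cmod_le)
  ultimately show ?thesis by linarith
qed

text \<open>A Rayleigh quotient: the decay rate is d |\<open>\<eta>\<close>|^2 / energy, and a bound
  of all components by B |\<open>\<eta>\<close>| controls the denominator.\<close>

lemma decay_rate_ge:
  assumes "0 < energy" "bounded_by (B * norm \<eta>)" "0 < B"
  shows "Re a \<le> - (d / (8 * K * B\<^sup>2))"
proof -
  have "energy \<le> 8 * K * B\<^sup>2 * (norm \<eta>)\<^sup>2"
    using energy_le[OF assms(2)] by (simp add: power_mult_distrib)
  then have "d * energy \<le> d * (8 * K * B\<^sup>2 * (norm \<eta>)\<^sup>2)"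
    using d by (rule mult_left_mono)
  also have "\<dots> = - (Re a * energy) * (8 * K * B\<^sup>2)"
    by (simp add: energy_identity(1) algebra_simps)
  also have "\<dots> = - Re a * (8 * K * B\<^sup>2) * energy"
    by simp
  finally have "d \<le> - Re a * (8 * K * B\<^sup>2)"
    using assms(1) by (simp only: mult_le_cancel_right_pos)
  then show ?thesis
    using K assms(3) by (simp add: field_simps)
qed


end

text \<open>Sum of the constants of the three regimes: small eigenvalue, large eigenvalue, large
  eigenvalue with equal speeds. The value c is the threshold between small and large |a|, and M = 2
  * 17 K^2 comes from the bound 17 K^2 (1 + r), where 1 + r is at most 2 or at most 2 r.\<close>

definition mode_const :: "real \<Rightarrow> real" where
  "mode_const K = (let c = 1 / (8 * K\<^sup>2); M = 34 * K\<^sup>2; C1 = K * (M + K + K / c); C2 = M + K / c;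
      C3 = K * (C2 * C1 + K)
    in 3 * K\<^sup>2 * (1 + K) + K * (1 + 1 / c) * (C2 * C3 + C3 + C1 + 1)
      + K * (1 + 1 / c) * ((2 * K) * (K * (2 * K * M) / c + 1) * (C1 + 1) + (K * K) * (2 * K) + 1))"

lemma mode_const_ge:
  assumes "1 \<le> K"
  defines "c \<equiv> 1 / (8 * K\<^sup>2)" and "M \<equiv> 34 * K\<^sup>2"
  defines "C1 \<equiv> K * (M + K + K / c)" and "C2 \<equiv> M + K / c"
  defines "C3 \<equiv> K * (C2 * C1 + K)"
  shows "3 * K\<^sup>2 * (1 + K) \<le> mode_const K"
    "K * (1 + 1 / c) * (C2 * C3 + C3 + C1 + 1) \<le> mode_const K"
    "K * (1 + 1 / c) * ((2 * K) * (K * (2 * K * M) / c + 1) * (C1 + 1) + (K * K) * (2 * K) + 1) \<le> mode_const K"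
    "1 \<le> mode_const K"
proof -
  have nn: "0 \<le> c" "0 \<le> M" "0 \<le> K" "0 \<le> C1" "0 \<le> C2" "0 \<le> C3"
    using assms(1) by (auto simp: c_def M_def C1_def C2_def C3_def)
  have eq: "mode_const K = 3 * K\<^sup>2 * (1 + K) + K * (1 + 1 / c) * (C2 * C3 + C3 + C1 + 1)
      + K * (1 + 1 / c) * ((2 * K) * (K * (2 * K * M) / c + 1) * (C1 + 1) + (K * K) * (2 * K) + 1)"
    unfolding mode_const_def Let_def c_def M_def C1_def C2_def C3_def ..
  have "0 \<le> 3 * K\<^sup>2 * (1 + K)" "0 \<le> K * (1 + 1 / c) * (C2 * C3 + C3 + C1 + 1)"
    "0 \<le> K * (1 + 1 / c) * ((2 * K) * (K * (2 * K * M) / c + 1) * (C1 + 1) + (K * K) * (2 * K) + 1)"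
    using nn by auto
  then show 1: "3 * K\<^sup>2 * (1 + K) \<le> mode_const K"
    "K * (1 + 1 / c) * (C2 * C3 + C3 + C1 + 1) \<le> mode_const K"
    "K * (1 + 1 / c) * ((2 * K) * (K * (2 * K * M) / c + 1) * (C1 + 1) + (K * K) * (2 * K) + 1) \<le> mode_const K"
    unfolding eq by linarith+
  have "1 * 1 * 1 \<le> 3 * K\<^sup>2 * (1 + K)"
    using assms(1) by (intro mult_mono) (auto intro!: order_trans[OF one_le_power[of K 2]])
  with 1(1) show "1 \<le> mode_const K" by simp
qed

text \<open>The spectral gap at frequency \<open>\<xi>\<close> is bounded below by a multiple of this rate, where \<open>r = \<bar>\<xi>\<bar>\<close>
  and \<open>eq\<close> says that the three wave speeds agree.\<close>

definition gap_rate :: "nat \<Rightarrow> bool \<Rightarrow> real \<Rightarrow> real" where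
  "gap_rate e eq r = (if r \<le> 1 then r ^ (4 + 2 * e) else if eq then 1 / r ^ (2 - 2 * e) else 1 / r ^ 4)"

lemma gap_rate_nonneg: "0 \<le> r \<Longrightarrow> 0 \<le> gap_rate e eq r"
  by (simp add: gap_rate_def)

lemma gap_rate_le_1: "0 \<le> r \<Longrightarrow> gap_rate e eq r \<le> 1"
  by (simp add: gap_rate_def power_le_one one_le_power)

context beam_mode
begin

lemma bounded_by_mono: "bounded_by b \<Longrightarrow> b \<le> b' \<Longrightarrow> bounded_by b'"
  by (auto simp: bounded_by_def)

text \<open>The factor \<open>?W\<close> is how much larger than \<open>\<eta>\<close> the other
  components may be. It is the loss s^2 \<open>\<tau>\<close> \<open>\<beta>\<close> of
  \<open>large_eigenvalue\<close>, except for equal speeds at high frequency, where a single factor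
  r survives.\<close>

lemma mode_bound:
  assumes E: "0 < energy" and Re: "-1 \<le> Re a" and e: "e \<in> {0, 1}" and d_le: "d \<le> K * r ^ (2 * e)"
  shows "bounded_by (mode_const K *
    (if r \<le> 1 then 1 / (r * r) else if k1 = k2 \<and> k2 = k3 then r else r * r * r ^ e) * norm \<eta>)"
    (is "bounded_by (_ * ?W * ?H)")
proof -
  define c where "c = 1 / (8 * K\<^sup>2)"
  define M where "M = 34 * K\<^sup>2"
  note const = mode_const_ge[OF K, folded c_def M_def]
  have c: "0 < c" and M: "0 \<le> M" "1 \<le> M"
    using K one_le_power[OF K, of 2] unfolding c_def M_def by (auto simp del: one_le_power)
  have rr: "1 \<le> r * r" "r \<le> r * r" "r \<le> r * r * r" if "1 \<le> r"
    using that mult_mono[of 1 r 1 r] mult_mono[of 1 r r r] mult_mono[of 1 "r * r" r r] by auto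
  have rr': "r * r \<le> 1" "r * r \<le> r" if "r \<le> 1"
    using that r mult_mono[of r 1 r 1] mult_right_mono[of r 1 r] by auto
  have d_low: "d \<le> K" if "r \<le> 1"
  proof -
    have "K * r ^ (2 * e) \<le> K * 1"
      using that r K by (intro mult_left_mono power_le_one) auto
    with d_le show ?thesis by simp
  qed
  have d_high: "d \<le> K * (r * r ^ e)" "d \<le> K * (r * r)" if "1 \<le> r"
    using d_le e that rr[OF that] K order_trans[OF _ mult_left_mono[of 1 r K]] order_trans[OF _ mult_left_mono[of 1 "r * r" K]]
    by (auto simp: power2_eq_square)
  \<comment> \<open>These two facts absorb the factor 1 + d / r of the small-eigenvalue case into (1
    + K) \<open>?W\<close>.\<close>
  have W: "1 \<le> ?W \<and> d / r \<le> K * ?W"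
  proof (cases "r \<le> 1")
    case True
    have "d / r \<le> K / (r * r)"
      using d_low[OF True] rr'[OF True] r K by (intro frac_le) auto
    moreover have "1 \<le> 1 / (r * r)"
      using rr'[OF True] r by simp
    ultimately show ?thesis using True by simp
  next
    case False
    then have r1: "1 \<le> r" by simp
    have "r \<le> r * r * r ^ e"
      using e rr[OF r1] by auto
    then have rW: "r \<le> ?W" using False by auto
    have "d / r \<le> K * r"
      using d_high(2)[OF r1] r by (simp add: field_simps)
    also have "\<dots> \<le> K * ?W"
      using rW K by (intro mult_left_mono) auto
    finally show ?thesis
      using rW r1 by linarith
  qed
  have m_le: "norm a \<le> 17 * K\<^sup>2 * (1 + r)"
    by (rule norm_eigenvalue_le[OF E Re])
  have fin: "bounded_by (mode_const K * ?W * ?H)" if "bounded_by (C * ?W * ?H)" "C \<le> mode_const K" for C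
    using that W by (intro bounded_by_mono[OF that(1)] mult_right_mono) auto
  show ?thesis
  proof (cases "norm a \<le> min 1 r * r / (8 * K\<^sup>2)")
    case True
    have "3 * K\<^sup>2 * (1 + d / r) * ?H \<le> 3 * K\<^sup>2 * ((1 + K) * ?W) * ?H"
      using W K by (intro mult_right_mono mult_left_mono) (auto simp: distrib_right)
    then have "bounded_by (3 * K\<^sup>2 * (1 + K) * ?W * ?H)"
      using small_eigenvalue[OF True] bounded_by_mono by (simp only: mult.assoc)
    then show ?thesis using const(1) by (rule fin)
  next
    case False
    then have big: "c * (min 1 r * r) < norm a"
      by (simp add: c_def)
    have a0: "0 < norm a"
      using big c r by (smt (verit) mult_pos_pos min_less_iff_conj)
    show ?thesis
    proof (cases "r \<le> 1")
      case low: True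
      then have big': "c * (r * r) < norm a" using big by simp
      have m: "norm a \<le> M"
      proof -
        note m_le
        also have "17 * K\<^sup>2 * (1 + r) \<le> 17 * K\<^sup>2 * 2"
          using low by (intro mult_left_mono) auto
        finally show ?thesis by (simp add: M_def)
      qed
      have rma: "r / norm a \<le> (1 / r) / c" "(r * r) / norm a \<le> 1 / c"
        using big' r c a0 by (auto simp: field_simps)
      have "norm a + K * (r * r) / norm a \<le> (M + K / c) * 1"
        using m mult_left_mono[OF rma(2), of K] K by simp
      moreover have "norm a / r \<le> M * (1 / r)" "d / r \<le> K * (1 / r)"
        using m d_low[OF low] r by (auto simp: divide_right_mono)
      moreover have "1 \<le> 1 / r" "r \<le> 1 * (1 / r)"
        using low r rr' by (auto simp: field_simps)
      \<comment> \<open>Low frequencies: s = 1 and \<open>\<tau>\<close> = \<open>\<beta>\<close> =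
        1 / r, a total loss of 1 / r^2.\<close>
      ultimately have "bounded_by (K * ((1 + 1 / c) * (1 / r)) * (((M + K / c) * (K * ((M + K / c) * (K * (M + K + K / c)) + K))
          + K * ((M + K / c) * (K * (M + K + K / c)) + K) + K * (M + K + K / c) + 1) * (1 * 1 * (1 / r)) * ?H))"
        using rma(1) r by (intro large_eigenvalue(2)[OF a0 M(1) c]) auto
      then have "bounded_by (K * (1 + 1 / c) * ((M + K / c) * (K * ((M + K / c) * (K * (M + K + K / c)) + K))
          + K * ((M + K / c) * (K * (M + K + K / c)) + K) + K * (M + K + K / c) + 1) * ?W * ?H)"
        using low by (simp add: mult_ac)
      then show ?thesis using const(2) by (rule fin)
    next
      case high: False
      then have r1: "1 \<le> r" by simp
      have big': "c * r < norm a" using big high by simp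
      have m: "norm a \<le> M * r"
      proof -
        note m_le
        also have "17 * K\<^sup>2 * (1 + r) \<le> 17 * K\<^sup>2 * (2 * r)"
          using r1 by (intro mult_left_mono) auto
        finally show ?thesis by (simp add: M_def)
      qed
      have rma: "r / norm a \<le> 1 / c"
        using big' r c a0 by (auto simp: field_simps)
      have s: "norm a + K * (r * r) / norm a \<le> (M + K / c) * r"
      proof -
        have "K * r * (r / norm a) \<le> K * r * (1 / c)"
          using rma K r by (intro mult_left_mono) auto
        then show ?thesis using m by (simp add: algebra_simps)
      qed
      have cond: "norm a / r \<le> M * \<tau>" "r / norm a \<le> \<tau> / c" "r \<le> r * \<tau>" "1 \<le> r * \<tau>" "0 \<le> \<tau>" if "1 \<le> \<tau>" for \<tau>
      proof -
        have "norm a / r \<le> M"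
          using m r by (simp add: field_simps)
        also have "M * 1 \<le> M * \<tau>"
          using that M by (intro mult_left_mono) auto
        finally show "norm a / r \<le> M * \<tau>" by simp
        have "1 / c \<le> \<tau> / c"
          using that c by (intro divide_right_mono) auto
        with rma show "r / norm a \<le> \<tau> / c" by linarith
        have "r * 1 \<le> r * \<tau>" using that r by (intro mult_left_mono) auto
        then show "r \<le> r * \<tau>" "1 \<le> r * \<tau>" using r1 by linarith+
      qed (use that in simp)
      show ?thesis
      proof (cases "k1 = k2 \<and> k2 = k3")
        case True
        have "d / r \<le> K * r"
          using d_high(2)[OF r1] r by (simp add: field_simps)
        \<comment> \<open>Here \<open>\<tau>\<close> = s = r, and only the bound of
          \<open>\<theta>\<close> is taken; v and y are treated by the equal-speed argument, which
          adds no further power of r.\<close>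
        then have "norm \<theta> \<le> K * (M + K + K / c) * r * ?H"
          using cond[OF r1] s rma r1 by (intro large_eigenvalue(1)[OF a0 M(1) c, where s=r and \<beta>=1]) auto
        then have "bounded_by (K * (1 + 1 / c) * (((2 * K) * (K * (2 * K * M) / c + 1) * (K * (M + K + K / c) + 1) + (K * K) * (2 * K) + 1) * (r * norm \<eta>)))"
          using True m big' K M c r1 by (intro large_eigenvalue_equal_speeds[OF _ _ a0 M(2) c]) auto
        then have "bounded_by (K * (1 + 1 / c) * ((2 * K) * (K * (2 * K * M) / c + 1) * (K * (M + K + K / c) + 1) + (K * K) * (2 * K) + 1) * ?W * ?H)"
          using True high by (simp add: mult_ac)
        then show ?thesis using const(3) by (rule fin)
      next
        case False
        have "1 \<le> r ^ e" using r1 by simp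
        moreover have "d / r \<le> K * r ^ e"
          using d_high(1)[OF r1] r by (simp add: field_simps)
        \<comment> \<open>High frequencies, different speeds: s = r, \<open>\<tau>\<close> = r^e
          from the damping term d / r, and \<open>\<beta>\<close> = 1.\<close>
        ultimately have "bounded_by (K * ((1 + 1 / c) * 1) * (((M + K / c) * (K * ((M + K / c) * (K * (M + K + K / c)) + K))
          + K * ((M + K / c) * (K * (M + K + K / c)) + K) + K * (M + K + K / c) + 1) * (r * r * r ^ e) * ?H))"
          using s rma r1 cond[of "r ^ e"] by (intro large_eigenvalue(2)[OF a0 M(1) c]) auto
        then have "bounded_by (K * (1 + 1 / c) * ((M + K / c) * (K * ((M + K / c) * (K * (M + K + K / c)) + K))
          + K * ((M + K / c) * (K * (M + K + K / c)) + K) + K * (M + K + K / c) + 1) * ?W * ?H)"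
          unfolding if_not_P[OF high] if_not_P[OF False] by (simp add: mult_ac)
        then show ?thesis using const(2) by (rule fin)
      qed
    qed
  qed
qed

text \<open>Eigenvalues with real part below -1 are harmless because the claimed rate never exceeds
  1; the remaining ones satisfy the a priori bound on |a|. In the constant, 8 K comes from the
  energy and the other K from k5 >= 1 / K.\<close>

lemma mode_spectral_gap:
  assumes E: "0 < energy" and e: "e \<in> {0, 1}" and d_eq: "d = k5 * r ^ (2 * e)" and k5: "k5 \<le> K" "1 \<le> K * k5"
  shows "Re a \<le> - (1 / (8 * K\<^sup>2 * (mode_const K)\<^sup>2) * gap_rate e (k1 = k2 \<and> k2 = k3) r)"
proof -
  let ?g = "gap_rate e (k1 = k2 \<and> k2 = k3) r" and ?C = "1 / (8 * K\<^sup>2 * (mode_const K)\<^sup>2)"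
  have mc: "1 \<le> mode_const K" by (rule mode_const_ge[OF K])
  have g: "0 \<le> ?g" "?g \<le> 1"
    using r by (auto intro: gap_rate_nonneg gap_rate_le_1)
  have C: "?C \<le> 1" "0 \<le> ?C"
  proof -
    have "1 * 1 \<le> K\<^sup>2 * (mode_const K)\<^sup>2"
      using mc K by (intro mult_mono one_le_power) auto
    then show "?C \<le> 1" "0 \<le> ?C" by simp_all
  qed
  show ?thesis
  proof (cases "-1 \<le> Re a")
    case False
    have "?C * ?g \<le> 1 * 1"
      using g C by (intro mult_mono) auto
    with False show ?thesis by linarith
  next
    case True
    let ?W = "if r \<le> 1 then 1 / (r * r) else if k1 = k2 \<and> k2 = k3 then r else r * r * r ^ e"
    have W: "0 < ?W" using r by auto
    have "d \<le> K * r ^ (2 * e)"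
      unfolding d_eq using k5 r by (intro mult_right_mono) auto
    from mode_bound[OF E True e this]
    have "Re a \<le> - (d / (8 * K * (mode_const K * ?W)\<^sup>2))"
      using E W mc by (intro decay_rate_ge) auto
    also have "\<dots> \<le> - (?C * ?g)"
    proof -
      have "r ^ (2 * e) / K \<le> d"
        using mult_right_mono[OF k5(2), of "r ^ (2 * e)"] K r by (simp add: d_eq field_simps)
      then have "r ^ (2 * e) / K / (8 * K * (mode_const K * ?W)\<^sup>2) \<le> d / (8 * K * (mode_const K * ?W)\<^sup>2)"
        using K by (intro divide_right_mono) auto
      moreover have "r ^ (2 * e) / K / (8 * K * (mode_const K * ?W)\<^sup>2) = ?C * (r ^ (2 * e) / ?W\<^sup>2)"
        by (simp add: power_mult_distrib power2_eq_square mult_ac)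
      \<comment> \<open>With W = 1/r^2, r, r^(2+e) the quotient is r^(4+2e), r^(2e-2), r^(-4). For
        different speeds the extra loss r^e is exactly offset by the stronger damping, so the last
        power is independent of e.\<close>
      moreover have "r ^ (2 * e) / ?W\<^sup>2 = ?g"
        using e r by (auto simp: gap_rate_def power2_eq_square power_mult_distrib power_divide
            field_simps numeral_eq_Suc)
      ultimately show ?thesis by simp
    qed
    finally show ?thesis .
  qed
qed

end

section \<open>From single modes to a semigroup bound for the beam matrix\<close>

lemma cip_8: "cip x y = x $ 1 * cnj (y $ 1) + x $ 2 * cnj (y $ 2) + x $ 3 * cnj (y $ 3) + x $ 4 * cnj (y $ 4)
    + x $ 5 * cnj (y $ 5) + x $ 6 * cnj (y $ 6) + x $ 7 * cnj (y $ 7) + x $ (8 :: 8) * cnj (y $ 8)"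
  by (simp add: cip_def sum_8)

definition damping :: "real \<Rightarrow> nat \<Rightarrow> real \<Rightarrow> real" where
  "damping k5 e \<xi> = k5 * \<bar>\<xi>\<bar> ^ (2 * e)"

lemma damping_simps: "damping k5 0 \<xi> = k5" "damping k5 (Suc 0) \<xi> = k5 * (\<xi> * \<xi>)"
  by (simp_all add: damping_def power2_eq_square)

lemma beam_matrix_vector_mult:
  assumes "e \<in> {0, 1}"
  defines "D \<equiv> \<lambda>\<xi>. \<i> * complex_of_real \<xi>"
  shows
    "(beam_matrix k1 k2 k3 k4 k5 \<gamma> (0, 0, 1) e \<xi> *v w) $ 1 = D \<xi> * w $ 2 + w $ 4 + w $ 6"
    "(beam_matrix k1 k2 k3 k4 k5 \<gamma> (0, 0, 1) e \<xi> *v w) $ 2 = of_real k1 * (D \<xi> * w $ 1)"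
    "(beam_matrix k1 k2 k3 k4 k5 \<gamma> (0, 0, 1) e \<xi> *v w) $ 3 = D \<xi> * w $ 4"
    "(beam_matrix k1 k2 k3 k4 k5 \<gamma> (0, 0, 1) e \<xi> *v w) $ 4 = - (of_real k1 * w $ 1) + of_real k2 * (D \<xi> * w $ 3)"
    "(beam_matrix k1 k2 k3 k4 k5 \<gamma> (0, 0, 1) e \<xi> *v w) $ 5 = D \<xi> * w $ 6"
    "(beam_matrix k1 k2 k3 k4 k5 \<gamma> (0, 0, 1) e \<xi> *v w) $ 6
      = - (of_real k1 * w $ 1) + of_real k3 * (D \<xi> * w $ 5) - of_real \<gamma> * (D \<xi> * w $ 8)"
    "(beam_matrix k1 k2 k3 k4 k5 \<gamma> (0, 0, 1) e \<xi> *v w) $ 7 = D \<xi> * w $ 8"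
    "(beam_matrix k1 k2 k3 k4 k5 \<gamma> (0, 0, 1) e \<xi> *v w) $ 8
      = - (of_real \<gamma> * (D \<xi> * w $ 6)) + of_real k4 * (D \<xi> * w $ 7) - of_real (damping k5 e \<xi>) * w $ 8"
  unfolding matrix_vector_mult_def using assms(1)
  by (auto simp: beam_matrix_def Let_def sum_8 D_def damping_simps power2_eq_square algebra_simps)

lemma beam_eigenvalue_bound:
  assumes k: "k1 > 0" "k2 > 0" "k3 > 0" "k4 > 0" "k5 > 0" "\<gamma> \<noteq> 0" and e: "e \<in> {0, 1}"
  shows "\<exists>c>0. \<forall>\<xi> a w. \<xi> \<noteq> 0 \<longrightarrow> w \<noteq> 0 \<longrightarrow> beam_matrix k1 k2 k3 k4 k5 \<gamma> (0, 0, 1) e \<xi> *v w = a *s w \<longrightarrow>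
    Re a \<le> - (c * gap_rate e (k1 = k2 \<and> k2 = k3) \<bar>\<xi>\<bar>)"
proof -
  \<comment> \<open>A sum of positive terms dominates each of them, so one K bounds all data and all
    their inverses.\<close>
  define K where "K = 1 + k1 + k2 + k3 + k4 + k5 + \<bar>\<gamma>\<bar> + 1/k1 + 1/k2 + 1/k3 + 1/k4 + 1/k5 + 1/\<bar>\<gamma>\<bar>"
  have inv: "0 \<le> 1/k1" "0 \<le> 1/k2" "0 \<le> 1/k3" "0 \<le> 1/k4" "0 \<le> 1/k5" "0 \<le> 1/\<bar>\<gamma>\<bar>"
    using k by auto
  have K: "1 \<le> K" and k_le: "k1 \<le> K" "k2 \<le> K" "k3 \<le> K" "k4 \<le> K" "k5 \<le> K" "\<bar>\<gamma>\<bar> \<le> K"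
    and inv_le: "1/k1 \<le> K" "1/k2 \<le> K" "1/k3 \<le> K" "1/k4 \<le> K" "1/k5 \<le> K" "1/\<bar>\<gamma>\<bar> \<le> K"
    unfolding K_def using inv k abs_ge_zero[of \<gamma>] by linarith+
  have k_ge: "1 \<le> K * k1" "1 \<le> K * k2" "1 \<le> K * k3" "1 \<le> K * k4" "1 \<le> K * k5" "1 \<le> K * \<bar>\<gamma>\<bar>"
    using inv_le k by (simp_all add: field_simps)
  let ?c = "1 / (8 * K\<^sup>2 * (mode_const K)\<^sup>2)"
  have "0 < mode_const K"
    using mode_const_ge(4)[OF K] by linarith
  then have c: "0 < ?c"
    using K by (auto simp: zero_less_mult_iff)
  have "Re a \<le> - (?c * gap_rate e (k1 = k2 \<and> k2 = k3) \<bar>\<xi>\<bar>)"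
    if \<xi>: "\<xi> \<noteq> 0" and w: "w \<noteq> 0" and eig: "beam_matrix k1 k2 k3 k4 k5 \<gamma> (0, 0, 1) e \<xi> *v w = a *s w"
    for \<xi> a and w :: "complex ^ 8"
  proof -
    have comp: "a * w $ i = (beam_matrix k1 k2 k3 k4 k5 \<gamma> (0, 0, 1) e \<xi> *v w) $ i" for i
      by (simp add: eig)
    note k5 = k_le(5) k_ge(5)
    note eqs = trans[OF comp[of 1] beam_matrix_vector_mult(1)[OF e]]
      trans[OF comp[of 2] beam_matrix_vector_mult(2)[OF e]]
      trans[OF comp[of 3] beam_matrix_vector_mult(3)[OF e]]
      trans[OF comp[of 4] beam_matrix_vector_mult(4)[OF e]]
      trans[OF comp[of 5] beam_matrix_vector_mult(5)[OF e]]
      trans[OF comp[of 6] beam_matrix_vector_mult(6)[OF e]]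
      trans[OF comp[of 7] beam_matrix_vector_mult(7)[OF e]]
      trans[OF comp[of 8] beam_matrix_vector_mult(8)[OF e]]
    have DD: "\<i> * of_real \<xi> * (\<i> * of_real \<xi>) = - complex_of_real (\<bar>\<xi>\<bar> * \<bar>\<xi>\<bar>)"
      by (simp add: complex_eq_iff)
    interpret beam_mode k1 k2 k3 k4 \<gamma> "damping k5 e \<xi>" K "\<bar>\<xi>\<bar>" a "\<i> * of_real \<xi>"
      "w $ 1" "w $ 2" "w $ 3" "w $ 4" "w $ 5" "w $ 6" "w $ 7" "w $ 8"
      by unfold_locales (rule K k_le k_ge eqs DD | use \<xi> k in \<open>simp add: damping_def norm_mult\<close>)+
    have "0 < energy"
    proof (rule ccontr)
      assume "\<not> 0 < energy"
      then have "K * energy \<le> 0"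
        using K by (simp add: mult_le_0_iff)
      then have "(norm (w $ 1))\<^sup>2 \<le> 0" "(norm (w $ 2))\<^sup>2 \<le> 0" "(norm (w $ 3))\<^sup>2 \<le> 0" "(norm (w $ 4))\<^sup>2 \<le> 0"
        "(norm (w $ 5))\<^sup>2 \<le> 0" "(norm (w $ 6))\<^sup>2 \<le> 0" "(norm (w $ 7))\<^sup>2 \<le> 0" "(norm (w $ 8))\<^sup>2 \<le> 0"
        using norm_power2_le_energy by (meson order_trans)+
      then have "w = 0"
        by (simp add: vec_eq_iff forall_8)
      with w show False ..
    qed
    then show ?thesis
      using mode_spectral_gap[OF _ e _ k5] by (simp add: damping_def)
  qed
  with c show ?thesis by blast
qed

text \<open>Coordinates in which the energy is the Euclidean norm, so that the matrix becomes dissipative.\<close>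

definition energy_scaling :: "real \<Rightarrow> real \<Rightarrow> real \<Rightarrow> real \<Rightarrow> real ^ 8" where
  "energy_scaling k1 k2 k3 k4 = vector [sqrt k1, 1, sqrt k2, 1, sqrt k3, 1, sqrt k4, 1]"

definition scale_vec :: "real ^ 'n \<Rightarrow> complex ^ 'n \<Rightarrow> complex ^ 'n" where
  "scale_vec s x = (\<chi> i. of_real (s $ i) * x $ i)"

definition conj_matrix :: "real ^ 'n \<Rightarrow> complex ^ 'n ^ 'n \<Rightarrow> complex ^ 'n ^ 'n" where
  "conj_matrix s A = (\<chi> i k. of_real (s $ i) * A $ i $ k / of_real (s $ k))"

lemma conj_matrix_scale_vec:
  assumes "\<And>i. s $ i \<noteq> 0"
  shows "conj_matrix s A *v scale_vec s x = scale_vec s (A *v x)"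
  using assms by (simp add: conj_matrix_def scale_vec_def matrix_vector_mult_def vec_eq_iff sum_distrib_left mult_ac)

lemma scale_vec_surj:
  assumes "\<And>i. s $ i \<noteq> 0"
  shows "\<exists>y. x = scale_vec s y"
  using assms by (intro exI[of _ "\<chi> i. x $ i / of_real (s $ i)"]) (simp add: scale_vec_def vec_eq_iff)

lemma bounded_linear_scale_vec: "bounded_linear (scale_vec s)"
  by (simp add: linear_conv_bounded_linear[symmetric])
    (rule linearI; simp add: scale_vec_def vec_eq_iff algebra_simps)

lemma norm_scale_vec_bounds:
  fixes s :: "real ^ 'n"
  assumes "\<And>i. 1 / K \<le> s $ i" "\<And>i. s $ i \<le> K" "0 < K"
  shows "norm (scale_vec s x) \<le> K * norm x" "norm x \<le> K * norm (scale_vec s x)"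
proof -
  have s: "0 \<le> s $ i" for i
    using assms(1)[of i] assms(3) by (smt (verit) divide_nonneg_nonneg)
  have "norm (scale_vec s x) \<le> L2_set (\<lambda>i. K * norm (x $ i)) UNIV"
    unfolding norm_vec_def
    by (rule L2_set_mono) (use s assms in \<open>auto simp: scale_vec_def norm_mult intro!: mult_right_mono\<close>)
  then show "norm (scale_vec s x) \<le> K * norm x"
    using assms(3) by (simp add: norm_vec_def L2_set_right_distrib)
  have "norm x \<le> L2_set (\<lambda>i. K * norm (scale_vec s x $ i)) UNIV"
    unfolding norm_vec_def
  proof (rule L2_set_mono)
    fix i
    have "1 * norm (x $ i) \<le> K * s $ i * norm (x $ i)"
      using assms(1)[of i] assms(3) by (intro mult_right_mono) (auto simp: field_simps)
    then show "norm (x $ i) \<le> K * norm (scale_vec s x $ i)"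
      using s[of i] by (simp add: scale_vec_def norm_mult)
  qed auto
  then show "norm x \<le> K * norm (scale_vec s x)"
    using assms(3) by (simp add: norm_vec_def L2_set_right_distrib)
qed

text \<open>In the scaled coordinates the off-diagonal entries become skew-Hermitian and cancel in
  the real part; only the damping in the last diagonal place survives.\<close>

lemma beam_dissipative:
  assumes k: "k1 > 0" "k2 > 0" "k3 > 0" "k4 > 0" "k5 > 0" and e: "e \<in> {0, 1}"
  shows "Re (cip (conj_matrix (energy_scaling k1 k2 k3 k4) (beam_matrix k1 k2 k3 k4 k5 \<gamma> (0, 0, 1) e \<xi>) *v x) x) \<le> 0"
proof -
  let ?s = "energy_scaling k1 k2 k3 k4"
  have s: "?s $ i \<noteq> 0" for i
    using exhaust_8[of i] k by (auto simp: energy_scaling_def)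
  obtain y where y: "x = scale_vec ?s y"
    using scale_vec_surj[of ?s] s by blast
  have sq: "sqrt k * (sqrt k * z) = k * z" if "k > 0" for k z :: real
    using that by (simp flip: mult.assoc)
  have "Re (cip (conj_matrix ?s (beam_matrix k1 k2 k3 k4 k5 \<gamma> (0, 0, 1) e \<xi>) *v x) x)
      = - damping k5 e \<xi> * ((Re (y $ 8))\<^sup>2 + (Im (y $ 8))\<^sup>2)"
    unfolding y conj_matrix_scale_vec[OF s] cip_8
    by (simp add: scale_vec_def energy_scaling_def beam_matrix_vector_mult[OF e] k sq algebra_simps power2_eq_square)
  also have "\<dots> \<le> 0"
    using k by (simp add: damping_def)
  finally show ?thesis .
qed


theorem beam_semigroup_bound:
  assumes k: "k1 > 0" "k2 > 0" "k3 > 0" "k4 > 0" "k5 > 0" "\<gamma> \<noteq> 0" and e: "e \<in> {0, 1}"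
  shows "\<exists>C>0. \<exists>c>0. \<forall>\<xi> t w. t \<ge> 0 \<longrightarrow>
    (norm (matrix_exp (t *\<^sub>R beam_matrix k1 k2 k3 k4 k5 \<gamma> (0, 0, 1) e \<xi>) *v w))\<^sup>2
      \<le> C * exp (- c * gap_rate e (k1 = k2 \<and> k2 = k3) \<bar>\<xi>\<bar> * t) * (norm w)\<^sup>2"
proof -
  let ?A = "beam_matrix k1 k2 k3 k4 k5 \<gamma> (0, 0, 1) e"
  let ?s = "energy_scaling k1 k2 k3 k4" and ?g = "\<lambda>\<xi>. gap_rate e (k1 = k2 \<and> k2 = k3) \<bar>\<xi>\<bar>"
  obtain c where c: "c > 0" and eig: "\<And>\<xi> a w. \<xi> \<noteq> 0 \<Longrightarrow> w \<noteq> 0 \<Longrightarrow> ?A \<xi> *v w = a *s w \<Longrightarrow> Re a \<le> - (c * ?g \<xi>)"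
    using beam_eigenvalue_bound[OF k e] by blast
  have s0: "?s $ i \<noteq> 0" for i
    using exhaust_8[of i] k by (auto simp: energy_scaling_def)
  define K where "K = 1 + sqrt k1 + sqrt k2 + sqrt k3 + sqrt k4 + 1 / sqrt k1 + 1 / sqrt k2 + 1 / sqrt k3 + 1 / sqrt k4"
  have q: "0 < sqrt k1" "0 < sqrt k2" "0 < sqrt k3" "0 < sqrt k4"
    "0 < 1 / sqrt k1" "0 < 1 / sqrt k2" "0 < 1 / sqrt k3" "0 < 1 / sqrt k4"
    using k by auto
  have K: "1 \<le> K" and K_le: "sqrt k1 \<le> K" "sqrt k2 \<le> K" "sqrt k3 \<le> K" "sqrt k4 \<le> K"
    and K_inv: "1 / sqrt k1 \<le> K" "1 / sqrt k2 \<le> K" "1 / sqrt k3 \<le> K" "1 / sqrt k4 \<le> K"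
    unfolding K_def using q by linarith+
  have s_le: "?s $ i \<le> K" for i
    using exhaust_8[of i] K K_le by (auto simp: energy_scaling_def)
  have s_ge: "1 / K \<le> ?s $ i" for i
  proof -
    have "1 / K \<le> x" if "1 / x \<le> K" "0 < x" for x
      using that K by (simp add: field_simps)
    then show ?thesis
      using exhaust_8[of i] K K_inv q by (auto simp: energy_scaling_def)
  qed
  note nb = norm_scale_vec_bounds[of K ?s, OF s_ge s_le]
  define Q where "Q = (16 * (2 * real CARD(8))\<^sup>2) ^ (2 * CARD(8))"
  have Q: "0 < Q" by (simp add: Q_def)
  have bound: "(norm (matrix_exp (t *\<^sub>R ?A \<xi>) *v w))\<^sup>2 \<le> K\<^sup>2 * Q * K\<^sup>2 * exp (- c * ?g \<xi> * t) * (norm w)\<^sup>2"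
    if t: "t \<ge> 0" for \<xi> t w
  proof -
    let ?B = "conj_matrix ?s (?A \<xi>)"
    define x where "x = (\<lambda>t. scale_vec ?s (matrix_exp (t *\<^sub>R ?A \<xi>) *v w))"
    have ode: "(x has_vector_derivative ?B *v x t) (at t)" for t
      unfolding x_def conj_matrix_scale_vec[OF s0]
      by (intro bounded_linear.has_vector_derivative[OF bounded_linear_scale_vec] matrix_exp_has_vector_derivative)
    have dis: "Re (cip (?B *v y) y) \<le> 0" for y
      by (rule beam_dissipative[OF k(1-5) e])
    have ev: "Re a \<le> - (c * ?g \<xi>)" if y: "y \<noteq> 0" "?B *v y = a *s y" for a y
    proof (cases "\<xi> = 0")
      \<comment> \<open>At frequency 0 the mode analysis, which divides by r, does not apply. The
        claimed rate vanishes there, and dissipativity alone suffices.\<close>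
      case True
      have "Re a * (norm y)\<^sup>2 = Re (cip (?B *v y) y)"
        unfolding y(2) cip_scale_left cip_self by (simp del: of_real_power)
      with dis[of y] have "Re a * (norm y)\<^sup>2 \<le> 0"
        by simp
      moreover have "0 < (norm y)\<^sup>2"
        using y(1) by simp
      ultimately have "Re a \<le> 0"
        by (meson mult_pos_pos not_le)
      then show ?thesis
        using True by (simp add: gap_rate_def power_0_left)
    next
      case False
      obtain z where z: "y = scale_vec ?s z"
        using scale_vec_surj[of ?s] s0 by blast
      have "scale_vec ?s (?A \<xi> *v z) = a *s scale_vec ?s z"
        using y(2) unfolding z conj_matrix_scale_vec[OF s0] .
      then have "?A \<xi> *v z = a *s z"
        using s0 by (simp add: scale_vec_def vec_eq_iff mult.left_commute)
      moreover have "z \<noteq> 0"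
        using y(1) by (auto simp: z scale_vec_def vec_eq_iff)
      ultimately show ?thesis
        using eig[OF False] by blast
    qed
    have "(norm (x t))\<^sup>2 \<le> Q * (exp (- (c * ?g \<xi>) * t) * (norm (x 0))\<^sup>2)"
      unfolding Q_def by (rule dissipative_exponential_decay[OF dis ev ode t])
    also have "(norm (x 0))\<^sup>2 \<le> K\<^sup>2 * (norm w)\<^sup>2"
      using power_mono[OF nb(1)[of w], of 2] K by (simp add: x_def power_mult_distrib)
    finally have "(norm (x t))\<^sup>2 \<le> Q * (exp (- (c * ?g \<xi>) * t) * (K\<^sup>2 * (norm w)\<^sup>2))"
      using Q by simp
    then have "K\<^sup>2 * (norm (x t))\<^sup>2 \<le> K\<^sup>2 * (Q * (exp (- (c * ?g \<xi>) * t) * (K\<^sup>2 * (norm w)\<^sup>2)))"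
      by (intro mult_left_mono) auto
    moreover have "(norm (matrix_exp (t *\<^sub>R ?A \<xi>) *v w))\<^sup>2 \<le> K\<^sup>2 * (norm (x t))\<^sup>2"
      using power_mono[OF nb(2)[of "matrix_exp (t *\<^sub>R ?A \<xi>) *v w"], of 2] K
      by (simp add: x_def power_mult_distrib)
    ultimately show ?thesis
      by (simp add: mult_ac)
  qed
  show ?thesis
    by (rule exI[of _ "K\<^sup>2 * Q * K\<^sup>2"], intro conjI exI[of _ c] allI impI bound c)
      (use K Q in \<open>auto intro!: mult_pos_pos\<close>)
qed

section \<open>The Fourier transform of integrable functions\<close>

lemma borel_measurable_cis [measurable (raw)]:
  "f \<in> borel_measurable M \<Longrightarrow> (\<lambda>x. cis (f x)) \<in> borel_measurable M"
  by (rule measurable_compose[OF _ borel_measurable_continuous_onI[OF continuous_on_cis[OF continuous_on_id]]])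

lemma integrable_cis_mult:
  assumes "integrable M f" "g \<in> borel_measurable M"
  shows "integrable M (\<lambda>x. cis (g x) * f x)"
proof (rule Bochner_Integration.integrable_bound[OF assms(1)])
  show "(\<lambda>x. cis (g x) * f x) \<in> borel_measurable M"
    using assms by measurable
qed (simp add: norm_mult)

text \<open>The scalar counterpart of \<open>fourier_L1\<close>. It is unnormalised, hence the
  factors 2 pi in the Plancherel and inversion statements.\<close>

definition ft :: "(real \<Rightarrow> complex) \<Rightarrow> real \<Rightarrow> complex" where
  "ft f \<xi> = (\<integral>x. cis (- (\<xi> * x)) * f x \<partial>lborel)"

lemma borel_measurable_ft [measurable]:
  assumes [measurable]: "f \<in> borel_measurable borel"
  shows "ft f \<in> borel_measurable borel"
  unfolding ft_def by measurable

lemma norm_ft_le: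
  assumes "integrable lborel f"
  shows "norm (ft f \<xi>) \<le> (\<integral>x. norm (f x) \<partial>lborel)"
proof -
  have "norm (ft f \<xi>) \<le> (\<integral>x. norm (cis (- (\<xi> * x)) * f x) \<partial>lborel)"
    unfolding ft_def by (rule integral_norm_bound)
  then show ?thesis by (simp add: norm_mult)
qed

lemma integrable_bounded_mult:
  fixes g h :: "real \<Rightarrow> complex"
  assumes "integrable lborel g" "h \<in> borel_measurable borel" "\<And>x. norm (h x) \<le> B"
  shows "integrable lborel (\<lambda>x. h x * g x)"
proof (rule Bochner_Integration.integrable_bound)
  show "integrable lborel (\<lambda>x. complex_of_real B * g x)"
    using assms(1) by simp
  show "(\<lambda>x. h x * g x) \<in> borel_measurable lborel"
    using assms by auto
  have "norm (h x * g x) \<le> norm (complex_of_real B * g x)" for x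
    using assms(3)[of x] order_trans[OF norm_ge_zero assms(3)] 
    by (simp add: norm_mult mult_right_mono)
  then show "AE x in lborel. norm (h x * g x) \<le> norm (complex_of_real B * g x)" by simp
qed

text \<open>Fubini applies because the modulus of the kernel is |f(x)| |g(\<open>\<xi>\<close>)|.
  This symmetric identity is the engine of the Plancherel, inversion and duality arguments that
  follow.\<close>

lemma ft_multiplication_formula:
  assumes f: "integrable lborel f" and g: "integrable lborel g"
  shows "(\<integral>\<xi>. ft f \<xi> * g \<xi> \<partial>lborel) = (\<integral>x. f x * ft g x \<partial>lborel)"
proof -
  have [measurable]: "f \<in> borel_measurable borel" "g \<in> borel_measurable borel"
    using f g by auto
  let ?F = "\<lambda>\<xi> x. cis (- (\<xi> * x)) * f x * g \<xi>"
  have int: "integrable (lborel \<Otimes>\<^sub>M lborel) (\<lambda>(\<xi>, x). ?F \<xi> x)"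
  proof (rule lborel_pair.Fubini_integrable)
    show "(\<lambda>(\<xi>, x). ?F \<xi> x) \<in> borel_measurable (lborel \<Otimes>\<^sub>M lborel)"
      by measurable
    show "integrable lborel (\<lambda>\<xi>. \<integral>x. norm (case (\<xi>, x) of (\<xi>, x) \<Rightarrow> ?F \<xi> x) \<partial>lborel)"
      using integrable_norm[OF g] by (simp add: norm_mult)
    show "AE \<xi> in lborel. integrable lborel (\<lambda>x. case (\<xi>, x) of (\<xi>, x) \<Rightarrow> ?F \<xi> x)"
      using integrable_cis_mult[OF f] by simp
  qed
  have "(\<integral>\<xi>. ft f \<xi> * g \<xi> \<partial>lborel) = (\<integral>\<xi>. (\<integral>x. ?F \<xi> x \<partial>lborel) \<partial>lborel)"
    by (simp add: ft_def)
  also have "\<dots> = (\<integral>x. (\<integral>\<xi>. ?F \<xi> x \<partial>lborel) \<partial>lborel)"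
    using lborel_pair.Fubini_integral[OF int] by simp
  also have "(\<lambda>x. \<integral>\<xi>. ?F \<xi> x \<partial>lborel) = (\<lambda>x. f x * ft g x)"
  proof
    fix x
    have "(\<integral>\<xi>. ?F \<xi> x \<partial>lborel) = (\<integral>\<xi>. f x * (cis (- (x * \<xi>)) * g \<xi>) \<partial>lborel)"
      by (simp add: mult_ac)
    then show "(\<integral>\<xi>. ?F \<xi> x \<partial>lborel) = f x * ft g x"
      by (simp add: ft_def)
  qed
  finally show ?thesis .
qed

section \<open>Gaussian regularisation and Plancherel's inequality\<close>

definition gauss :: "real \<Rightarrow> real \<Rightarrow> real" where
  "gauss \<epsilon> x = exp (- (\<epsilon> * x\<^sup>2))"

lemma gauss_pos [simp]: "0 < gauss \<epsilon> x" and gauss_nonneg [simp]: "0 \<le> gauss \<epsilon> x"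
  by (simp_all add: gauss_def)

lemma borel_measurable_gauss [measurable]: "gauss \<epsilon> \<in> borel_measurable borel"
  unfolding gauss_def by measurable

lemma gauss_le_1: "0 \<le> \<epsilon> \<Longrightarrow> gauss \<epsilon> x \<le> 1"
  by (simp add: gauss_def)

lemma gauss_normal_density:
  assumes "\<epsilon> > 0"
  shows "gauss \<epsilon> = (\<lambda>x. sqrt (pi / \<epsilon>) * normal_density 0 (1 / sqrt (2 * \<epsilon>)) x)"
  using assms by (intro ext) (simp add: gauss_def normal_density_def power_divide real_sqrt_divide field_simps)

lemma integrable_gauss: "\<epsilon> > 0 \<Longrightarrow> integrable lborel (gauss \<epsilon>)"
  by (simp add: gauss_normal_density integrable_normal_density)

lemma integral_gauss: "\<epsilon> > 0 \<Longrightarrow> (\<integral>x. gauss \<epsilon> x \<partial>lborel) = sqrt (pi / \<epsilon>)"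
  by (simp add: gauss_normal_density)

text \<open>Substituting x -> sqrt(2 \<open>\<epsilon>\<close>) x turns the characteristic function
  of the standard normal law into this transform.\<close>

lemma ft_gauss:
  assumes \<epsilon>: "\<epsilon> > 0"
  shows "ft (\<lambda>x. of_real (gauss \<epsilon> x)) \<xi> = of_real (sqrt (pi / \<epsilon>) * gauss (1 / (4 * \<epsilon>)) \<xi>)"
proof -
  let ?c = "sqrt (2 * \<epsilon>)"
  have c: "?c > 0" "?c * ?c = 2 * \<epsilon>" using \<epsilon> by auto
  have "complex_of_real (exp (- (\<xi> / ?c)\<^sup>2 / 2)) = char std_normal_distribution (- \<xi> / ?c)"
    by (simp add: char_std_normal_distribution)
  also have "\<dots> = (\<integral>x. std_normal_density x *\<^sub>R iexp (- \<xi> / ?c * x) \<partial>lborel)"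
    unfolding char_def by (subst integral_density) (auto simp: normal_density_nonneg)
  also have "\<dots> = \<bar>?c\<bar> *\<^sub>R (\<integral>x. std_normal_density (0 + ?c * x) *\<^sub>R iexp (- \<xi> / ?c * (0 + ?c * x)) \<partial>lborel)"
    by (rule lborel_integral_real_affine) (use c in simp)
  also have "(\<lambda>x. std_normal_density (0 + ?c * x) *\<^sub>R iexp (- \<xi> / ?c * (0 + ?c * x)))
      = (\<lambda>x. of_real (1 / sqrt (2 * pi)) * (cis (- (\<xi> * x)) * of_real (gauss \<epsilon> x)))"
  proof
    fix x
    have 1: "std_normal_density (0 + ?c * x) = 1 / sqrt (2 * pi) * gauss \<epsilon> x"
      using \<epsilon> by (simp add: normal_density_def gauss_def power_mult_distrib)
    have 2: "iexp (- \<xi> / ?c * (0 + ?c * x)) = cis (- (\<xi> * x))"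
      using c by (simp add: cis_conv_exp)
    show "std_normal_density (0 + ?c * x) *\<^sub>R iexp (- \<xi> / ?c * (0 + ?c * x))
        = of_real (1 / sqrt (2 * pi)) * (cis (- (\<xi> * x)) * of_real (gauss \<epsilon> x))"
      unfolding 1 2 by (simp add: scaleR_conv_of_real mult_ac)
  qed
  also have "\<bar>?c\<bar> *\<^sub>R (\<integral>x. of_real (1 / sqrt (2 * pi)) * (cis (- (\<xi> * x)) * of_real (gauss \<epsilon> x)) \<partial>lborel)
      = of_real (?c / sqrt (2 * pi)) * ft (\<lambda>x. of_real (gauss \<epsilon> x)) \<xi>"
    using c by (simp add: ft_def scaleR_conv_of_real)
  finally have *: "of_real (?c / sqrt (2 * pi)) * ft (\<lambda>x. of_real (gauss \<epsilon> x)) \<xi> = complex_of_real (exp (- (\<xi> / ?c)\<^sup>2 / 2))"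
    by simp
  have "exp (- (\<xi> / ?c)\<^sup>2 / 2) = gauss (1 / (4 * \<epsilon>)) \<xi>"
    using \<epsilon> by (simp add: gauss_def power_divide field_simps)
  moreover have "?c / sqrt (2 * pi) * sqrt (pi / \<epsilon>) = 1"
    using \<epsilon> by (simp add: real_sqrt_mult real_sqrt_divide)
  ultimately have "of_real (?c / sqrt (2 * pi)) * ft (\<lambda>x. of_real (gauss \<epsilon> x)) \<xi>
      = of_real (?c / sqrt (2 * pi)) * of_real (sqrt (pi / \<epsilon>) * gauss (1 / (4 * \<epsilon>)) \<xi>)"
    unfolding * of_real_mult[symmetric] by (metis mult.assoc mult_1)
  then show ?thesis
    using c by simp
qed

text \<open>The Fourier transform of \<open>gauss \<epsilon>\<close>. It has mass 2 pi for every
  \<open>\<epsilon>\<close> and concentrates at 0 as \<open>\<epsilon>\<close> tends to 0.\<close>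

definition heat_kernel :: "real \<Rightarrow> real \<Rightarrow> real" where
  "heat_kernel \<epsilon> x = sqrt (pi / \<epsilon>) * gauss (1 / (4 * \<epsilon>)) x"

lemma heat_kernel_nonneg [simp]: "0 < \<epsilon> \<Longrightarrow> 0 \<le> heat_kernel \<epsilon> x"
  by (simp add: heat_kernel_def)

lemma heat_kernel_minus: "heat_kernel \<epsilon> (x - y) = heat_kernel \<epsilon> (y - x)"
  by (simp add: heat_kernel_def gauss_def power2_commute)

lemma borel_measurable_heat_kernel [measurable]: "heat_kernel \<epsilon> \<in> borel_measurable borel"
  unfolding heat_kernel_def by measurable

lemma integrable_heat_kernel: "\<epsilon> > 0 \<Longrightarrow> integrable lborel (heat_kernel \<epsilon>)"
  unfolding heat_kernel_def by (simp add: integrable_gauss)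

lemma integral_heat_kernel: "\<epsilon> > 0 \<Longrightarrow> (\<integral>x. heat_kernel \<epsilon> x \<partial>lborel) = 2 * pi"
  unfolding heat_kernel_def
  by (simp add: integral_gauss real_sqrt_mult[symmetric] flip: real_sqrt_mult) 
    (simp add: real_sqrt_mult real_sqrt_divide)

lemma nn_integral_heat_kernel:
  assumes "\<epsilon> > 0"
  shows "(\<integral>\<^sup>+y. ennreal (heat_kernel \<epsilon> (y - x)) \<partial>lborel) = ennreal (2 * pi)"
proof -
  have "(\<integral>\<^sup>+y. ennreal (heat_kernel \<epsilon> y) \<partial>lborel) = ennreal (2 * pi)"
    by (subst nn_integral_eq_integral)
      (use assms in \<open>simp_all add: integrable_heat_kernel integral_heat_kernel\<close>)
  then show ?thesis
    by (subst (asm) nn_integral_real_affine[of _ 1 "- x"]) simp_all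
qed

lemma ft_modulated_gauss:
  assumes "\<epsilon> > 0"
  shows "ft (\<lambda>\<xi>. cis (\<xi> * x) * of_real (gauss \<epsilon> \<xi>)) y = of_real (heat_kernel \<epsilon> (y - x))"
proof -
  have "ft (\<lambda>\<xi>. cis (\<xi> * x) * of_real (gauss \<epsilon> \<xi>)) y = ft (\<lambda>\<xi>. of_real (gauss \<epsilon> \<xi>)) (y - x)"
    unfolding ft_def by (simp add: cis_mult mult.assoc[symmetric] algebra_simps)
  then show ?thesis
    by (simp add: ft_gauss[OF assms] heat_kernel_def)
qed

lemma borel_measurable_cnj [measurable (raw)]:
  "f \<in> borel_measurable M \<Longrightarrow> (\<lambda>x. cnj (f x)) \<in> borel_measurable M"
  by (rule measurable_compose[OF _ borel_measurable_continuous_onI[OF continuous_on_cnj[OF continuous_on_id]]])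

lemma norm_integral_le_nn_integral:
  fixes f :: "'a \<Rightarrow> 'b::{banach, second_countable_topology}"
  shows "ennreal (norm (integral\<^sup>L M f)) \<le> (\<integral>\<^sup>+x. ennreal (norm (f x)) \<partial>M)"
  by (cases "integrable M f") (simp_all add: integral_norm_bound_ennreal not_integrable_integral_eq)

text \<open>Schur's test: the product |f(x)| |f(y)| is at most half the sum of the squares, and the
  symmetric kernel has mass 2 pi in either variable. Nonnegative integrals make the exchange of the
  integrations free of side conditions.\<close>

lemma nn_integral_heat_kernel_schur:
  fixes f :: "real \<Rightarrow> complex"
  assumes [measurable]: "f \<in> borel_measurable borel" and \<epsilon>: "\<epsilon> > 0"
  shows "(\<integral>\<^sup>+x. (\<integral>\<^sup>+y. ennreal (norm (f x) * (norm (f y) * heat_kernel \<epsilon> (y - x))) \<partial>lborel) \<partial>lborel)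
    \<le> ennreal (2 * pi) * (\<integral>\<^sup>+x. ennreal ((norm (f x))\<^sup>2) \<partial>lborel)"
proof -
  let ?K = "\<lambda>x y. heat_kernel \<epsilon> (y - x)" and ?h = "\<lambda>x. ennreal ((norm (f x))\<^sup>2 / 2)"
  have K: "0 \<le> ?K x y" for x y using \<epsilon> by simp
  have "(\<integral>\<^sup>+x. (\<integral>\<^sup>+y. ennreal (norm (f x) * (norm (f y) * ?K x y)) \<partial>lborel) \<partial>lborel)
      \<le> (\<integral>\<^sup>+x. (\<integral>\<^sup>+y. ?h x * ennreal (?K x y) + ?h y * ennreal (?K x y) \<partial>lborel) \<partial>lborel)"
  proof (intro nn_integral_mono)
    fix x y
    have "norm (f x) * norm (f y) \<le> (norm (f x))\<^sup>2 / 2 + (norm (f y))\<^sup>2 / 2"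
      using sum_squares_bound[of "norm (f x)" "norm (f y)"] by simp
    then have "norm (f x) * norm (f y) * ?K x y \<le> ((norm (f x))\<^sup>2 / 2 + (norm (f y))\<^sup>2 / 2) * ?K x y"
      by (rule mult_right_mono[OF _ K])
    then have "ennreal (norm (f x) * (norm (f y) * ?K x y))
        \<le> ennreal ((norm (f x))\<^sup>2 / 2 * ?K x y + (norm (f y))\<^sup>2 / 2 * ?K x y)"
      by (intro ennreal_leI) (simp add: algebra_simps)
    then show "ennreal (norm (f x) * (norm (f y) * ?K x y)) \<le> ?h x * ennreal (?K x y) + ?h y * ennreal (?K x y)"
      using K by (simp add: ennreal_mult'[symmetric] ennreal_plus[symmetric] del: ennreal_plus)
  qed
  also have "\<dots> = (\<integral>\<^sup>+x. (\<integral>\<^sup>+y. ?h x * ennreal (?K x y) \<partial>lborel) \<partial>lborel)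
      + (\<integral>\<^sup>+x. (\<integral>\<^sup>+y. ?h y * ennreal (?K x y) \<partial>lborel) \<partial>lborel)"
    by (simp add: nn_integral_add)
  also have "(\<integral>\<^sup>+x. (\<integral>\<^sup>+y. ?h y * ennreal (?K x y) \<partial>lborel) \<partial>lborel)
      = (\<integral>\<^sup>+y. (\<integral>\<^sup>+x. ?h y * ennreal (?K x y) \<partial>lborel) \<partial>lborel)"
    by (rule lborel_pair.Fubini') measurable
  also have "\<dots> = (\<integral>\<^sup>+y. ?h y * ennreal (2 * pi) \<partial>lborel)"
    using nn_integral_heat_kernel[OF \<epsilon>] by (simp add: nn_integral_cmult heat_kernel_minus)
  also have "(\<integral>\<^sup>+x. (\<integral>\<^sup>+y. ?h x * ennreal (?K x y) \<partial>lborel) \<partial>lborel) = (\<integral>\<^sup>+y. ?h y * ennreal (2 * pi) \<partial>lborel)"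
    using nn_integral_heat_kernel[OF \<epsilon>] by (simp add: nn_integral_cmult)
  also have "(\<integral>\<^sup>+y. ?h y * ennreal (2 * pi) \<partial>lborel) + (\<integral>\<^sup>+y. ?h y * ennreal (2 * pi) \<partial>lborel)
      = (\<integral>\<^sup>+y. ennreal (2 * pi) * ennreal ((norm (f y))\<^sup>2) \<partial>lborel)"
  proof (subst nn_integral_add[symmetric])
    have "?h y * ennreal (2 * pi) + ?h y * ennreal (2 * pi) = ennreal (2 * pi) * ennreal ((norm (f y))\<^sup>2)" for y
      by (simp add: ennreal_mult'[symmetric] ennreal_plus[symmetric] del: ennreal_plus)
    then show "(\<integral>\<^sup>+y. ?h y * ennreal (2 * pi) + ?h y * ennreal (2 * pi) \<partial>lborel)
        = (\<integral>\<^sup>+y. ennreal (2 * pi) * ennreal ((norm (f y))\<^sup>2) \<partial>lborel)"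
      by simp
  qed measurable
  also have "\<dots> = ennreal (2 * pi) * (\<integral>\<^sup>+x. ennreal ((norm (f x))\<^sup>2) \<partial>lborel)"
    by (rule nn_integral_cmult) measurable
  finally show ?thesis .
qed

text \<open>The weighted integral is the pairing of \<open>ft f\<close> with \<open>?\<psi>\<close>,
  the conjugate of \<open>ft f\<close> times the Gaussian. The multiplication formula moves the
  transform onto \<open>?\<psi>\<close>, whose transform is the conjugate of the heat-kernel average
  of f; Schur's test finishes.\<close>

lemma gauss_weighted_plancherel:
  assumes f: "integrable lborel f" and \<epsilon>: "\<epsilon> > 0"
  shows "(\<integral>\<^sup>+\<xi>. ennreal (gauss \<epsilon> \<xi> * (norm (ft f \<xi>))\<^sup>2) \<partial>lborel)
    \<le> ennreal (2 * pi) * (\<integral>\<^sup>+x. ennreal ((norm (f x))\<^sup>2) \<partial>lborel)"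
proof -
  have [measurable]: "f \<in> borel_measurable borel" using f by auto
  let ?N = "\<integral>x. norm (f x) \<partial>lborel"
  let ?g = "\<lambda>\<xi>. of_real (gauss \<epsilon> \<xi>) :: complex"
  have ig: "integrable lborel ?g"
    using integrable_gauss[OF \<epsilon>] by (simp add: complex_of_real_integrable_eq)
  let ?\<psi> = "\<lambda>\<xi>. cnj (ft f \<xi>) * ?g \<xi>"
  have i\<psi>: "integrable lborel ?\<psi>"
    by (rule integrable_bounded_mult[OF ig]) (use norm_ft_le[OF f] in auto)
  have ft\<psi>: "ft ?\<psi> x = cnj (\<integral>y. f y * of_real (heat_kernel \<epsilon> (y - x)) \<partial>lborel)" for x
  proof -
    have "ft ?\<psi> x = (\<integral>\<xi>. cnj (ft f \<xi> * (cis (\<xi> * x) * ?g \<xi>)) \<partial>lborel)"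
      by (simp add: ft_def cis_cnj mult_ac)
    also have "\<dots> = cnj (\<integral>\<xi>. ft f \<xi> * (cis (\<xi> * x) * ?g \<xi>) \<partial>lborel)"
      by (rule integral_bounded_linear'[OF bounded_linear_cnj bounded_linear_cnj]) simp
    also have "(\<integral>\<xi>. ft f \<xi> * (cis (\<xi> * x) * ?g \<xi>) \<partial>lborel) = (\<integral>y. f y * ft (\<lambda>\<xi>. cis (\<xi> * x) * ?g \<xi>) y \<partial>lborel)"
      by (rule ft_multiplication_formula[OF f]) (rule integrable_cis_mult[OF ig], measurable)
    finally show ?thesis
      by (simp add: ft_modulated_gauss[OF \<epsilon>])
  qed
  have norm_ft\<psi>: "ennreal (norm (ft ?\<psi> x)) \<le> (\<integral>\<^sup>+y. ennreal (norm (f y) * heat_kernel \<epsilon> (y - x)) \<partial>lborel)" for x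
  proof -
    have "ennreal (norm (ft ?\<psi> x)) \<le> (\<integral>\<^sup>+y. ennreal (norm (f y * of_real (heat_kernel \<epsilon> (y - x)))) \<partial>lborel)"
      unfolding ft\<psi> complex_mod_cnj by (rule norm_integral_le_nn_integral)
    then show ?thesis
      using \<epsilon> by (simp add: norm_mult)
  qed
  have int: "integrable lborel (\<lambda>\<xi>. gauss \<epsilon> \<xi> * (norm (ft f \<xi>))\<^sup>2)"
  proof (rule Bochner_Integration.integrable_bound)
    show "integrable lborel (\<lambda>\<xi>. gauss \<epsilon> \<xi> * ?N\<^sup>2)"
      using integrable_gauss[OF \<epsilon>] by simp
    show "AE \<xi> in lborel. norm (gauss \<epsilon> \<xi> * (norm (ft f \<xi>))\<^sup>2) \<le> norm (gauss \<epsilon> \<xi> * ?N\<^sup>2)"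
      using norm_ft_le[OF f] by (intro AE_I2) (simp add: abs_mult mult_left_mono power_mono)
  qed measurable
  have "(\<integral>\<^sup>+\<xi>. ennreal (gauss \<epsilon> \<xi> * (norm (ft f \<xi>))\<^sup>2) \<partial>lborel)
      = ennreal (\<integral>\<xi>. gauss \<epsilon> \<xi> * (norm (ft f \<xi>))\<^sup>2 \<partial>lborel)"
    by (rule nn_integral_eq_integral[OF int]) simp
  also have "(\<integral>\<xi>. gauss \<epsilon> \<xi> * (norm (ft f \<xi>))\<^sup>2 \<partial>lborel) \<le> norm (\<integral>x. f x * ft ?\<psi> x \<partial>lborel)"
  proof -
    have "complex_of_real (\<integral>\<xi>. gauss \<epsilon> \<xi> * (norm (ft f \<xi>))\<^sup>2 \<partial>lborel)
        = (\<integral>\<xi>. of_real (gauss \<epsilon> \<xi> * (norm (ft f \<xi>))\<^sup>2) \<partial>lborel)"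
      by (rule integral_complex_of_real[symmetric])
    also have "\<dots> = (\<integral>\<xi>. ft f \<xi> * ?\<psi> \<xi> \<partial>lborel)"
    proof (rule arg_cong[where f = "integral\<^sup>L lborel"], rule ext)
      show "of_real (gauss \<epsilon> \<xi> * (norm (ft f \<xi>))\<^sup>2) = ft f \<xi> * ?\<psi> \<xi>" for \<xi>
        unfolding of_real_mult complex_norm_square by (simp add: mult_ac)
    qed
    also have "\<dots> = (\<integral>x. f x * ft ?\<psi> x \<partial>lborel)"
      by (rule ft_multiplication_formula[OF f i\<psi>])
    finally have "\<bar>\<integral>\<xi>. gauss \<epsilon> \<xi> * (norm (ft f \<xi>))\<^sup>2 \<partial>lborel\<bar> = norm (\<integral>x. f x * ft ?\<psi> x \<partial>lborel)"
      by (metis norm_of_real)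
    then show ?thesis by linarith
  qed
  also have "ennreal (norm (\<integral>x. f x * ft ?\<psi> x \<partial>lborel)) \<le> (\<integral>\<^sup>+x. ennreal (norm (f x * ft ?\<psi> x)) \<partial>lborel)"
    by (rule norm_integral_le_nn_integral)
  also have "\<dots> \<le> (\<integral>\<^sup>+x. (\<integral>\<^sup>+y. ennreal (norm (f x) * (norm (f y) * heat_kernel \<epsilon> (y - x))) \<partial>lborel) \<partial>lborel)"
  proof (rule nn_integral_mono)
    fix x
    have "ennreal (norm (f x * ft ?\<psi> x)) = ennreal (norm (f x)) * ennreal (norm (ft ?\<psi> x))"
      by (simp add: norm_mult ennreal_mult')
    also have "\<dots> \<le> ennreal (norm (f x)) * (\<integral>\<^sup>+y. ennreal (norm (f y) * heat_kernel \<epsilon> (y - x)) \<partial>lborel)"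
      by (intro mult_left_mono norm_ft\<psi>) simp
    also have "\<dots> = (\<integral>\<^sup>+y. ennreal (norm (f x) * (norm (f y) * heat_kernel \<epsilon> (y - x))) \<partial>lborel)"
      by (subst nn_integral_cmult[symmetric]) (simp_all add: ennreal_mult')
    finally show "ennreal (norm (f x * ft ?\<psi> x))
        \<le> (\<integral>\<^sup>+y. ennreal (norm (f x) * (norm (f y) * heat_kernel \<epsilon> (y - x))) \<partial>lborel)" .
  qed
  also have "\<dots> \<le> ennreal (2 * pi) * (\<integral>\<^sup>+x. ennreal ((norm (f x))\<^sup>2) \<partial>lborel)"
    by (rule nn_integral_heat_kernel_schur[OF _ \<epsilon>]) measurable
  finally show ?thesis
    by (simp add: ennreal_leI)
qed

text \<open>The Gaussian weight makes Fubini applicable, and Fatou's lemma removes it.\<close>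

theorem plancherel_le:
  assumes f: "integrable lborel f"
  shows "(\<integral>\<^sup>+\<xi>. ennreal ((norm (ft f \<xi>))\<^sup>2) \<partial>lborel) \<le> ennreal (2 * pi) * (\<integral>\<^sup>+x. ennreal ((norm (f x))\<^sup>2) \<partial>lborel)"
proof -
  have [measurable]: "f \<in> borel_measurable borel" using f by auto
  let ?G = "\<lambda>n \<xi>. ennreal (gauss (inverse (real (Suc n))) \<xi> * (norm (ft f \<xi>))\<^sup>2)"
  have lim: "liminf (\<lambda>n. ?G n \<xi>) = ennreal ((norm (ft f \<xi>))\<^sup>2)" for \<xi>
  proof (rule lim_imp_Liminf)
    have "(\<lambda>n. gauss (inverse (real (Suc n))) \<xi>) \<longlonglongrightarrow> exp (- (0 * \<xi>\<^sup>2))"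
      unfolding gauss_def by (intro tendsto_intros LIMSEQ_inverse_real_of_nat)
    then have "(\<lambda>n. gauss (inverse (real (Suc n))) \<xi> * (norm (ft f \<xi>))\<^sup>2) \<longlonglongrightarrow> exp (- (0 * \<xi>\<^sup>2)) * (norm (ft f \<xi>))\<^sup>2"
      by (rule tendsto_mult_right)
    then show "(\<lambda>n. ?G n \<xi>) \<longlonglongrightarrow> ennreal ((norm (ft f \<xi>))\<^sup>2)"
      by (intro tendsto_ennrealI) simp
  qed simp
  have "(\<integral>\<^sup>+\<xi>. ennreal ((norm (ft f \<xi>))\<^sup>2) \<partial>lborel) = (\<integral>\<^sup>+\<xi>. liminf (\<lambda>n. ?G n \<xi>) \<partial>lborel)"
    by (simp only: lim)
  also have "\<dots> \<le> liminf (\<lambda>n. \<integral>\<^sup>+\<xi>. ?G n \<xi> \<partial>lborel)"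
    by (rule nn_integral_liminf) measurable
  also have "\<dots> \<le> liminf (\<lambda>n. ennreal (2 * pi) * (\<integral>\<^sup>+x. ennreal ((norm (f x))\<^sup>2) \<partial>lborel))"
    by (intro Liminf_mono always_eventually allI gauss_weighted_plancherel[OF f]) simp
  also have "\<dots> = ennreal (2 * pi) * (\<integral>\<^sup>+x. ennreal ((norm (f x))\<^sup>2) \<partial>lborel)"
    by (rule Liminf_const) simp
  finally show ?thesis .
qed

lemma square_integrable_ft:
  assumes f: "integrable lborel f" and f2: "integrable lborel (\<lambda>x. (norm (f x))\<^sup>2)"
  shows "integrable lborel (\<lambda>\<xi>. (norm (ft f \<xi>))\<^sup>2)"
    and "(\<integral>\<xi>. (norm (ft f \<xi>))\<^sup>2 \<partial>lborel) \<le> 2 * pi * (\<integral>x. (norm (f x))\<^sup>2 \<partial>lborel)"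
proof -
  have [measurable]: "f \<in> borel_measurable borel" using f by auto
  let ?I = "\<integral>x. (norm (f x))\<^sup>2 \<partial>lborel"
  have I: "0 \<le> ?I" by simp
  have "(\<integral>\<^sup>+\<xi>. ennreal ((norm (ft f \<xi>))\<^sup>2) \<partial>lborel) \<le> ennreal (2 * pi) * (\<integral>\<^sup>+x. ennreal ((norm (f x))\<^sup>2) \<partial>lborel)"
    by (rule plancherel_le[OF f])
  also have "(\<integral>\<^sup>+x. ennreal ((norm (f x))\<^sup>2) \<partial>lborel) = ennreal ?I"
    by (rule nn_integral_eq_integral[OF f2]) simp
  finally have le: "(\<integral>\<^sup>+\<xi>. ennreal ((norm (ft f \<xi>))\<^sup>2) \<partial>lborel) \<le> ennreal (2 * pi * ?I)"
    by (simp add: ennreal_mult')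
  then have "(\<integral>\<^sup>+\<xi>. ennreal (norm ((norm (ft f \<xi>))\<^sup>2)) \<partial>lborel) < \<infinity>"
    by (simp add: le_less_trans[OF _ ennreal_less_top])
  then show int: "integrable lborel (\<lambda>\<xi>. (norm (ft f \<xi>))\<^sup>2)"
    by (intro integrableI_bounded) measurable
  have "ennreal (\<integral>\<xi>. (norm (ft f \<xi>))\<^sup>2 \<partial>lborel) \<le> ennreal (2 * pi * ?I)"
    using le nn_integral_eq_integral[OF int] by simp
  then show "(\<integral>\<xi>. (norm (ft f \<xi>))\<^sup>2 \<partial>lborel) \<le> 2 * pi * ?I"
    using I by (simp add: ennreal_le_iff)
qed

section \<open>Test functions and uniqueness of weak derivatives\<close>

definition smooth :: "(real \<Rightarrow> real) \<Rightarrow> bool" where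
  "smooth f \<longleftrightarrow> (\<forall>n x. (deriv ^^ n) f field_differentiable (at x))"

lemma test_function_iff_smooth: "test_function \<phi> \<longleftrightarrow> smooth \<phi> \<and> (\<exists>R. \<forall>x. \<bar>x\<bar> > R \<longrightarrow> \<phi> x = 0)"
  by (simp add: test_function_def smooth_def)

lemma smooth_DERIV: "smooth f \<Longrightarrow> (f has_field_derivative deriv f x) (at x)"
  unfolding smooth_def by (metis DERIV_deriv_iff_field_differentiable funpow_0)

lemma smooth_deriv: "smooth f \<Longrightarrow> smooth (deriv f)"
  unfolding smooth_def by (metis funpow_Suc_right comp_apply)

lemma smooth_higher_deriv: "smooth f \<Longrightarrow> smooth ((deriv ^^ n) f)"
  by (induction n) (auto intro: smooth_deriv)

text \<open>Any class of functions in which every member has a derivative in the class consists of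
  smooth functions, so no formula for the n-th derivative is ever required.\<close>

lemma smooth_coinduct:
  assumes "f \<in> S" and S: "\<And>f. f \<in> S \<Longrightarrow> \<exists>f'\<in>S. \<forall>x. (f has_field_derivative f' x) (at x)"
  shows "smooth f"
proof -
  have "(deriv ^^ n) f \<in> S" for n
  proof (induction n)
    case (Suc n)
    then obtain f' where f': "f' \<in> S" "\<And>x. ((deriv ^^ n) f has_field_derivative f' x) (at x)"
      using S by blast
    then have "deriv ((deriv ^^ n) f) = f'"
      by (intro ext DERIV_imp_deriv)
    with f'(1) show ?case by simp
  qed (simp add: assms)
  then show ?thesis
    unfolding smooth_def field_differentiable_def using S by blast
qed

text \<open>Finite sums of products of smooth functions: by the product rule this class is closed
  under differentiation.\<close>

inductive_set smooth_products :: "(real \<Rightarrow> real) set" where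
  prod: "smooth f \<Longrightarrow> smooth g \<Longrightarrow> (\<lambda>x. f x * g x) \<in> smooth_products"
| add: "f \<in> smooth_products \<Longrightarrow> g \<in> smooth_products \<Longrightarrow> (\<lambda>x. f x + g x) \<in> smooth_products"

lemma smooth_mult:
  assumes "smooth f" "smooth g"
  shows "smooth (\<lambda>x. f x * g x)"
proof (rule smooth_coinduct)
  show "(\<lambda>x. f x * g x) \<in> smooth_products"
    using assms by (rule smooth_products.prod)
  show "\<exists>f'\<in>smooth_products. \<forall>x. (f has_field_derivative f' x) (at x)" if "f \<in> smooth_products" for f
    using that
  proof induction
    case (prod f g)
    then have "(\<lambda>x. deriv f x * g x + f x * deriv g x) \<in> smooth_products"
      by (intro smooth_products.add smooth_products.prod smooth_deriv)
    moreover have "((\<lambda>x. f x * g x) has_field_derivative deriv f x * g x + f x * deriv g x) (at x)" for x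
      using DERIV_mult[OF smooth_DERIV[OF prod(1)] smooth_DERIV[OF prod(2)]] by (simp add: mult.commute add.commute)
    ultimately show ?case by (intro bexI) auto
  next
    case (add f g)
    then obtain f' g' where "f' \<in> smooth_products" "g' \<in> smooth_products"
      "\<forall>x. (f has_field_derivative f' x) (at x)" "\<forall>x. (g has_field_derivative g' x) (at x)"
      by blast
    then show ?case
      by (intro bexI[of _ "\<lambda>x. f' x + g' x"] allI DERIV_add smooth_products.add) auto
  qed
qed

lemma smooth_affine:
  assumes "smooth f"
  shows "smooth (\<lambda>x. f (a * x + b))"
proof (rule smooth_coinduct)
  let ?S = "{\<lambda>x. c * g (a * x + b) | c g. smooth g}"
  have "(\<lambda>x. f (a * x + b)) = (\<lambda>x. 1 * f (a * x + b))" by simp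
  with assms show "(\<lambda>x. f (a * x + b)) \<in> ?S" by blast
  show "\<exists>h'\<in>?S. \<forall>x. (h has_field_derivative h' x) (at x)" if "h \<in> ?S" for h
  proof -
    obtain c g where g: "smooth g" "h = (\<lambda>x. c * g (a * x + b))"
      using \<open>h \<in> ?S\<close> by blast
    have "(h has_field_derivative (c * a) * deriv g (a * x + b)) (at x)" for x
    proof -
      have "((\<lambda>x. a * x + b) has_field_derivative a) (at x)"
        by (auto intro!: derivative_eq_intros)
      from DERIV_chain2[OF smooth_DERIV[OF g(1)] this]
      have "((\<lambda>x. g (a * x + b)) has_field_derivative deriv g (a * x + b) * a) (at x)" .
      from DERIV_cmult[OF this, of c] show ?thesis
        by (simp add: g(2) mult_ac)
    qed
    moreover have "(\<lambda>x. (c * a) * deriv g (a * x + b)) \<in> ?S"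
      using smooth_deriv[OF g(1)] by blast
    ultimately show ?thesis
      by (intro bexI[of _ "\<lambda>x. (c * a) * deriv g (a * x + b)"]) auto
  qed
qed

lemma smooth_isCont: "smooth f \<Longrightarrow> isCont f x"
  by (rule DERIV_isCont[OF smooth_DERIV])

text \<open>The classical flat functions p(1/x) exp(-1/x), with an arbitrary polynomial p so that
  the family is closed under differentiation.\<close>

definition flat_exp :: "real poly \<Rightarrow> real \<Rightarrow> real" where
  "flat_exp p x = (if x > 0 then poly p (inverse x) * exp (- inverse x) else 0)"

lemma poly_times_exp_minus_tendsto_0: "((\<lambda>s. poly p s * exp (- s)) \<longlongrightarrow> (0 :: real)) at_top"
proof -
  have "((\<lambda>s. \<Sum>i\<le>degree p. coeff p i * (s ^ i / exp s)) \<longlongrightarrow> (\<Sum>i\<le>degree p. coeff p i * 0)) at_top"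
    by (intro tendsto_sum tendsto_mult_left tendsto_power_div_exp_0)
  then show ?thesis
    by (simp add: poly_altdef exp_minus sum_distrib_left sum_distrib_right divide_inverse mult_ac)
qed

lemma flat_exp_DERIV:
  "(flat_exp p has_field_derivative flat_exp ([:0, 0, 1:] * (p - pderiv p)) x) (at x)"
proof -
  let ?q = "[:0, 0, 1:] * (p - pderiv p)"
  consider "x > 0" | "x < 0" | "x = 0" by linarith
  then show ?thesis
  proof cases
    case 1
    have "((\<lambda>x. poly p (inverse x) * exp (- inverse x)) has_field_derivative poly ?q (inverse x) * exp (- inverse x)) (at x)"
      using 1 by (auto intro!: derivative_eq_intros simp: power2_eq_square field_simps)
    then have "(flat_exp p has_field_derivative poly ?q (inverse x) * exp (- inverse x)) (at x)"
      by (rule has_field_derivative_transform_within_open[of _ _ _ "{0<..}"]) (use 1 in \<open>auto simp: flat_exp_def\<close>)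
    then show ?thesis using 1 by (simp add: flat_exp_def)
  next
    case 2
    have "((\<lambda>x. 0) has_field_derivative (0::real)) (at x)"
      by (rule DERIV_const)
    then have "(flat_exp p has_field_derivative 0) (at x)"
      by (rule has_field_derivative_transform_within_open[of _ _ _ "{..<0}"]) (use 2 in \<open>auto simp: flat_exp_def\<close>)
    then show ?thesis using 2 by (simp add: flat_exp_def)
  next
    case 3
    have "((\<lambda>y. (flat_exp p y - flat_exp p 0) / (y - 0)) \<longlongrightarrow> 0) (at_right 0)"
    proof -
      \<comment> \<open>In the variable s = 1/y the difference quotient at 0 is s p(s) exp(-s), and
        the exponential wins as s tends to infinity.\<close>
      have "((\<lambda>y. poly (pCons 0 p) (inverse y) * exp (- inverse y)) \<longlongrightarrow> (0::real)) (at_right 0)"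
        by (rule filterlim_compose[OF poly_times_exp_minus_tendsto_0 filterlim_inverse_at_top_right])
      moreover have "\<forall>\<^sub>F y in at_right 0. poly (pCons 0 p) (inverse y) * exp (- inverse y) = (flat_exp p y - flat_exp p 0) / (y - 0)"
        by (auto simp: eventually_at_filter flat_exp_def field_simps)
      ultimately show ?thesis
        using tendsto_cong by fastforce
    qed
    moreover have "((\<lambda>y. (flat_exp p y - flat_exp p 0) / (y - 0)) \<longlongrightarrow> 0) (at_left 0)"
      by (rule tendsto_eventually) (auto simp: eventually_at_filter flat_exp_def)
    ultimately show ?thesis
      unfolding has_field_derivative_iff using 3 by (simp add: filterlim_split_at flat_exp_def)
  qed
qed

lemma smooth_flat_exp: "smooth (flat_exp p)"
  by (rule smooth_coinduct[of _ "range flat_exp"]) (use flat_exp_DERIV in blast)+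

abbreviation cut :: "real \<Rightarrow> real" where "cut \<equiv> flat_exp 1"

lemma cut_bounds: "0 \<le> cut x" "cut x \<le> 1"
  by (auto simp: flat_exp_def)

lemma cut_eq: "x > 0 \<Longrightarrow> cut x = exp (- inverse x)" "x \<le> 0 \<Longrightarrow> cut x = 0"
  by (auto simp: flat_exp_def)

text \<open>The parameter n steepens the edges: exp(-1/(n s)) tends to 1 for every s > 0. The bumps
  thus approximate the indicator of the open interval while staying below it, which provides both
  the limit and the domination.\<close>

definition bump :: "real \<Rightarrow> real \<Rightarrow> real \<Rightarrow> real \<Rightarrow> real" where
  "bump n a b x = cut (n * (x - a)) * cut (n * (b - x))"

lemma bump_bounds: "0 \<le> bump n a b x" "bump n a b x \<le> 1"
  using cut_bounds by (auto simp: bump_def intro: mult_le_one)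

lemma bump_support: "0 < n \<Longrightarrow> x \<notin> {a<..<b} \<Longrightarrow> bump n a b x = 0"
  by (auto simp: bump_def cut_eq mult_nonneg_nonpos)

lemma test_function_bump:
  assumes "0 < n"
  shows "test_function (bump n a b)"
  unfolding test_function_iff_smooth
proof
  have "smooth (\<lambda>x. cut (n * x + - n * a) * cut (- n * x + n * b))"
    by (intro smooth_mult smooth_affine smooth_flat_exp)
  then show "smooth (bump n a b)"
    by (simp add: bump_def[abs_def] algebra_simps)
  show "\<exists>R. \<forall>x. \<bar>x\<bar> > R \<longrightarrow> bump n a b x = 0"
    by (intro exI[of _ "\<bar>a\<bar> + \<bar>b\<bar>"] allI impI bump_support assms) auto
qed

lemma bump_tendsto_indicator:
  "(\<lambda>n. bump (real (Suc n)) a b x) \<longlonglongrightarrow> indicator {a<..<b} x"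
proof (cases "x \<in> {a<..<b}")
  case True
  have 1: "(\<lambda>n. cut (real (Suc n) * s)) \<longlonglongrightarrow> 1" if "s > 0" for s
  proof -
    have "(\<lambda>n. exp (- (inverse (real (Suc n)) * inverse s))) \<longlonglongrightarrow> exp (- (0 * inverse s))"
      by (intro tendsto_intros LIMSEQ_inverse_real_of_nat)
    then show ?thesis
      using that by (simp add: cut_eq del: of_nat_Suc)
  qed
  have "(\<lambda>n. cut (real (Suc n) * (x - a)) * cut (real (Suc n) * (b - x))) \<longlonglongrightarrow> 1 * 1"
    by (intro tendsto_mult 1) (use True in auto)
  then show ?thesis
    using True by (simp add: bump_def)
next
  case False
  then show ?thesis
    by (simp add: bump_support)
qed

lemma test_function_deriv:
  assumes "test_function \<phi>"
  shows "test_function (deriv \<phi>)"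
proof -
  obtain R where R: "\<And>x. \<bar>x\<bar> > R \<Longrightarrow> \<phi> x = 0" and s: "smooth \<phi>"
    using assms by (auto simp: test_function_iff_smooth)
  have "deriv \<phi> x = 0" if "\<bar>x\<bar> > R" for x
  proof -
    have "((\<lambda>x. 0) has_field_derivative (0::real)) (at x)"
      by (rule DERIV_const)
    then have "(\<phi> has_field_derivative 0) (at x)"
    proof (rule has_field_derivative_transform_within_open)
      show "open {x. R < \<bar>x\<bar>}"
        by (intro open_Collect_less continuous_intros)
    qed (use that R in auto)
    then show ?thesis by (rule DERIV_imp_deriv)
  qed
  then show ?thesis
    using s by (auto simp: test_function_iff_smooth smooth_deriv)
qed

lemma test_function_higher_deriv: "test_function \<phi> \<Longrightarrow> test_function ((deriv ^^ n) \<phi>)"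
  by (induction n) (auto intro: test_function_deriv)

lemma test_function_bounded:
  assumes "test_function \<phi>"
  obtains R B where "R > 0" "\<And>x. \<bar>x\<bar> > R \<Longrightarrow> \<phi> x = 0" "\<And>x. \<bar>\<phi> x\<bar> \<le> B" "continuous_on UNIV \<phi>"
    "\<phi> \<in> borel_measurable borel" "B \<ge> 0"
proof -
  obtain R where R: "\<And>x. \<bar>x\<bar> > R \<Longrightarrow> \<phi> x = 0" and s: "smooth \<phi>"
    using assms by (auto simp: test_function_iff_smooth)
  have cont: "continuous_on UNIV \<phi>"
    using smooth_isCont[OF s] by (simp add: continuous_on_eq_continuous_at)
  have "compact (\<phi> ` {- max R 1..max R 1})"
    by (intro compact_continuous_image continuous_on_subset[OF cont]) auto
  then obtain B where B: "\<And>x. x \<in> {- max R 1..max R 1} \<Longrightarrow> \<bar>\<phi> x\<bar> \<le> B"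
    using compact_imp_bounded bounded_iff by (metis imageI real_norm_def)
  have "\<bar>\<phi> x\<bar> \<le> max B 0" for x
    using B[of x] R[of x] by (cases "x \<in> {- max R 1..max R 1}") (auto simp: abs_le_iff)
  then show thesis
    using R cont by (intro that[of "max R 1" "max B 0"]) (auto intro: borel_measurable_continuous_onI)
qed

section \<open>Locally integrable functions and the fundamental lemma\<close>

lemma locally_integrable_measurable:
  fixes f :: "real \<Rightarrow> 'a::euclidean_space"
  assumes "locally_integrable f"
  shows "f \<in> borel_measurable borel"
proof (rule borel_measurable_LIMSEQ_metric)
  show "(\<lambda>x. indicator {- real n..real n} x *\<^sub>R f x) \<in> borel_measurable borel" for n
    using assms borel_measurable_integrable[of lborel "\<lambda>x. indicator {- real n..real n} x *\<^sub>R f x"]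
    by (simp add: locally_integrable_def set_integrable_def)
  show "(\<lambda>n. indicator {- real n..real n} x *\<^sub>R f x) \<longlonglongrightarrow> f x" for x
  proof (rule tendsto_eventually)
    obtain N where "\<bar>x\<bar> \<le> real N"
      using real_arch_simple by blast
    then show "\<forall>\<^sub>F n in sequentially. indicator {- real n..real n} x *\<^sub>R f x = f x"
      by (intro eventually_sequentiallyI[of N]) (auto simp: indicator_def)
  qed
qed

lemma integrable_test_function_scaleR:
  fixes f :: "real \<Rightarrow> 'a::euclidean_space"
  assumes "locally_integrable f" "test_function \<phi>"
  shows "integrable lborel (\<lambda>x. \<phi> x *\<^sub>R f x)"
proof -
  obtain R B where RB: "R > 0" "\<And>x. \<bar>x\<bar> > R \<Longrightarrow> \<phi> x = 0" "\<And>x. \<bar>\<phi> x\<bar> \<le> B" "continuous_on UNIV \<phi>"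
    "\<phi> \<in> borel_measurable borel" "B \<ge> 0"
    by (rule test_function_bounded[OF assms(2)]) blast
  have [measurable]: "f \<in> borel_measurable borel" "\<phi> \<in> borel_measurable borel"
    using locally_integrable_measurable[OF assms(1)] RB(5) by auto
  show ?thesis
  proof (rule Bochner_Integration.integrable_bound)
    show "integrable lborel (\<lambda>x. B *\<^sub>R (indicator {-R..R} x *\<^sub>R f x))"
      using assms(1) by (intro integrable_scaleR_right) (simp add: locally_integrable_def set_integrable_def)
    show "AE x in lborel. norm (\<phi> x *\<^sub>R f x) \<le> norm (B *\<^sub>R (indicator {-R..R} x *\<^sub>R f x))"
    proof (rule AE_I2)
      fix x show "norm (\<phi> x *\<^sub>R f x) \<le> norm (B *\<^sub>R (indicator {-R..R} x *\<^sub>R f x))"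
        using RB(2)[of x] RB(3)[of x] RB(6) by (cases "\<bar>x\<bar> > R") (auto simp: indicator_def intro!: mult_right_mono)
    qed
  qed measurable
qed

text \<open>Restricted to (-n, n), the positive and the negative part of g are densities of finite
  measures that agree on all half-lines. The measures coincide, hence so do the two densities almost
  everywhere, and a number whose positive and negative parts are equal is 0.\<close>

lemma AE_zero_if_interval_integrals_zero:
  fixes g :: "real \<Rightarrow> real"
  assumes g: "locally_integrable g" and zero: "\<And>a b. a < b \<Longrightarrow> (\<integral>x. indicator {a<..<b} x * g x \<partial>lborel) = 0"
  shows "AE x in lborel. g x = 0"
proof -
  have [measurable]: "g \<in> borel_measurable borel"
    by (rule locally_integrable_measurable[OF g])
  have "AE x in lborel. x \<in> {- real n<..<real n} \<longrightarrow> g x = 0" for n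
  proof -
    let ?I = "{- real n<..<real n}"
    let ?p = "\<lambda>x. ennreal (indicator ?I x * max 0 (g x))" and ?m = "\<lambda>x. ennreal (indicator ?I x * max 0 (- g x))"
    have gI: "integrable lborel (\<lambda>x. indicator J x * g x)" if "J \<subseteq> ?I" "J \<in> sets borel" for J
    proof (rule Bochner_Integration.integrable_bound)
      show "integrable lborel (\<lambda>x. indicator {- real n..real n} x *\<^sub>R g x)"
        using g by (simp add: locally_integrable_def set_integrable_def)
      show "(\<lambda>x. indicator J x * g x) \<in> borel_measurable lborel"
        using that(2) by measurable
      show "AE x in lborel. norm (indicator J x * g x) \<le> norm (indicator {- real n..real n} x *\<^sub>R g x)"
        using that(1) by (intro AE_I2) (auto simp: indicator_def)
    qed
    have part: "integrable lborel (\<lambda>x. indicator J x * max 0 (s * g x))" if "J \<subseteq> ?I" "J \<in> sets borel" "\<bar>s\<bar> = 1" for J and s :: real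
    proof (rule Bochner_Integration.integrable_bound[OF gI[OF that(1,2)]])
      show "(\<lambda>x. indicator J x * max 0 (s * g x)) \<in> borel_measurable lborel"
        using that(2) by measurable
      show "AE x in lborel. norm (indicator J x * max 0 (s * g x)) \<le> norm (indicator J x * g x)"
        using that(3) by (intro AE_I2) (auto simp: indicator_def max_def abs_if split: if_splits)
    qed
    have em: "emeasure (density lborel ?p) {a<..} = emeasure (density lborel ?m) {a<..}
        \<and> emeasure (density lborel ?p) {a<..} < \<infinity>" for a
    proof -
      let ?J = "{max a (- real n)<..<real n}"
      have ind: "indicator {a<..} x * (indicator ?I x * t) = indicator ?J x * t" for x and t :: real
        by (auto simp: indicator_def)
      have eJ: "emeasure (density lborel (\<lambda>x. ennreal (indicator ?I x * max 0 (s * g x)))) {a<..}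
          = ennreal (\<integral>x. indicator ?J x * max 0 (s * g x) \<partial>lborel)" if "\<bar>s\<bar> = 1" for s :: real
      proof -
        have "emeasure (density lborel (\<lambda>x. ennreal (indicator ?I x * max 0 (s * g x)))) {a<..}
            = (\<integral>\<^sup>+x. ennreal (indicator ?I x * max 0 (s * g x)) * indicator {a<..} x \<partial>lborel)"
          by (rule emeasure_density) measurable
        also have "\<dots> = (\<integral>\<^sup>+x. ennreal (indicator ?J x * max 0 (s * g x)) \<partial>lborel)"
          by (intro nn_integral_cong) (auto simp: indicator_def)
        also have "\<dots> = ennreal (\<integral>x. indicator ?J x * max 0 (s * g x) \<partial>lborel)"
          by (rule nn_integral_eq_integral[OF part]) (use that in auto)
        finally show ?thesis .
      qed
      have J0: "(\<integral>x. indicator ?J x * g x \<partial>lborel) = 0"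
      proof (cases "max a (- real n) < real n")
        case True
        then show ?thesis by (rule zero)
      next
        case False
        then have "?J = {}" by auto
        then show ?thesis by simp
      qed
      have "(\<integral>x. indicator ?J x * max 0 (1 * g x) \<partial>lborel) - (\<integral>x. indicator ?J x * max 0 (- 1 * g x) \<partial>lborel)
          = (\<integral>x. indicator ?J x * max 0 (1 * g x) - indicator ?J x * max 0 (- 1 * g x) \<partial>lborel)"
        by (rule Bochner_Integration.integral_diff[symmetric]) (rule part; auto)+
      also have "\<dots> = (\<integral>x. indicator ?J x * g x \<partial>lborel)"
        by (intro Bochner_Integration.integral_cong) (auto simp: indicator_def max_def)
      finally have "(\<integral>x. indicator ?J x * max 0 (1 * g x) \<partial>lborel) = (\<integral>x. indicator ?J x * max 0 (- 1 * g x) \<partial>lborel)"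
        using J0 by simp
      then show ?thesis
        using eJ[of 1] eJ[of "-1"] by simp
    qed
    have "density lborel ?p = density lborel ?m"
    proof (rule measure_eqI_lessThan)
      fix a
      show "emeasure (density lborel ?p) {a<..} = emeasure (density lborel ?m) {a<..}"
        and "emeasure (density lborel ?p) {a<..} < \<infinity>"
        using em[of a] by blast+
    qed simp_all
    then have "AE x in lborel. ?p x = ?m x"
      by (intro sigma_finite_measure.density_unique[OF sigma_finite_lborel]) measurable
    then show ?thesis
      by eventually_elim (auto simp: indicator_def max_def split: if_splits)
  qed
  then have "AE x in lborel. \<forall>n. x \<in> {- real n<..<real n} \<longrightarrow> g x = 0"
    unfolding AE_all_countable ..
  then show ?thesis
  proof eventually_elim
    case (elim x)
    obtain n where "\<bar>x\<bar> < real n"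
      using reals_Archimedean2 by blast
    with elim show ?case by (auto simp: abs_less_iff)
  qed
qed

lemma locally_integrable_inner:
  fixes f :: "real \<Rightarrow> 'a::euclidean_space"
  assumes "locally_integrable f"
  shows "locally_integrable (\<lambda>x. f x \<bullet> b)"
proof -
  have "integrable lborel (\<lambda>x. (indicator {u..v} x *\<^sub>R f x) \<bullet> b)" for u v :: real
    by (rule integrable_inner_left) (use assms in \<open>simp add: locally_integrable_def set_integrable_def\<close>)
  then show ?thesis
    by (simp add: locally_integrable_def set_integrable_def)
qed

lemma locally_integrable_diff:
  fixes f :: "real \<Rightarrow> 'a::euclidean_space"
  assumes "locally_integrable f" "locally_integrable g"
  shows "locally_integrable (\<lambda>x. f x - g x)"
  using assms unfolding locally_integrable_def by (auto intro: set_integral_diff)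

text \<open>Bumps are test functions and converge boundedly to interval indicators, so every
  component has vanishing interval integrals.\<close>

theorem fundamental_lemma_calculus_of_variations:
  fixes f :: "real \<Rightarrow> 'a::euclidean_space"
  assumes f: "locally_integrable f" and zero: "\<And>\<phi>. test_function \<phi> \<Longrightarrow> (\<integral>x. \<phi> x *\<^sub>R f x \<partial>lborel) = 0"
  shows "AE x in lborel. f x = 0"
proof -
  have "AE x in lborel. f x \<bullet> b = 0" if "b \<in> Basis" for b
  proof (rule AE_zero_if_interval_integrals_zero[OF locally_integrable_inner[OF f]])
    fix u v :: real
    let ?g = "\<lambda>x. f x \<bullet> b"
    have g: "locally_integrable ?g" by (rule locally_integrable_inner[OF f])
    have [measurable]: "?g \<in> borel_measurable borel" by (rule locally_integrable_measurable[OF g])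
    have [measurable]: "bump (real (Suc n)) u v \<in> borel_measurable borel" for n
      by (rule test_function_bounded[OF test_function_bump[of "real (Suc n)" u v]]) auto
    have "(\<integral>x. bump (real (Suc n)) u v x * ?g x \<partial>lborel) = 0" for n
    proof -
      have tf: "test_function (bump (real (Suc n)) u v)" by (rule test_function_bump) simp
      have "(\<integral>x. bump (real (Suc n)) u v x * ?g x \<partial>lborel) = (\<integral>x. (bump (real (Suc n)) u v x *\<^sub>R f x) \<bullet> b \<partial>lborel)"
        by simp
      also have "\<dots> = (\<integral>x. bump (real (Suc n)) u v x *\<^sub>R f x \<partial>lborel) \<bullet> b"
        by (rule integral_inner_left) (rule integrable_test_function_scaleR[OF f tf])
      finally show ?thesis
        using zero[OF tf] by simp
    qed
    moreover have "(\<lambda>n. \<integral>x. bump (real (Suc n)) u v x * ?g x \<partial>lborel) \<longlonglongrightarrow> (\<integral>x. indicator {u<..<v} x * ?g x \<partial>lborel)"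
    proof (rule integral_dominated_convergence)
      show "integrable lborel (\<lambda>x. norm (indicator {u..v} x *\<^sub>R ?g x))"
        using g by (intro integrable_norm) (simp add: locally_integrable_def set_integrable_def)
      show "AE x in lborel. (\<lambda>n. bump (real (Suc n)) u v x * ?g x) \<longlonglongrightarrow> indicator {u<..<v} x * ?g x"
        by (intro AE_I2 tendsto_mult_right bump_tendsto_indicator)
      show "AE x in lborel. norm (bump (real (Suc n)) u v x * ?g x) \<le> norm (indicator {u..v} x *\<^sub>R ?g x)" for n
      proof (rule AE_I2)
        fix x
        show "norm (bump (real (Suc n)) u v x * ?g x) \<le> norm (indicator {u..v} x *\<^sub>R ?g x)"
          using bump_bounds[of "real (Suc n)" u v x] bump_support[of "real (Suc n)" x u v]
          by (cases "x \<in> {u<..<v}") (auto simp: indicator_def abs_mult intro!: mult_left_le_one_le)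
      qed
    qed measurable
    ultimately show "(\<integral>x. indicator {u<..<v} x * ?g x \<partial>lborel) = 0"
      by (simp add: LIMSEQ_const_iff)
  qed
  then have "AE x in lborel. \<forall>b\<in>Basis. f x \<bullet> b = 0"
    by (simp add: AE_ball_countable countable_finite)
  then show ?thesis
    by eventually_elim (simp add: euclidean_all_zero_iff)
qed

lemma has_weak_deriv_unique:
  assumes "has_weak_deriv k f g" "has_weak_deriv k f h"
  shows "AE x in lborel. g x = h x"
proof -
  have g: "locally_integrable g" and h: "locally_integrable h"
    using assms by (auto simp: has_weak_deriv_def)
  have "AE x in lborel. g x - h x = 0"
  proof (rule fundamental_lemma_calculus_of_variations[OF locally_integrable_diff[OF g h]])
    fix \<phi> assume \<phi>: "test_function \<phi>"
    have "(-1) ^ k *\<^sub>R (\<integral>x. \<phi> x *\<^sub>R g x \<partial>lborel) = (-1) ^ k *\<^sub>R (\<integral>x. \<phi> x *\<^sub>R h x \<partial>lborel)"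
      using assms \<phi> unfolding has_weak_deriv_def by metis
    then have "(\<integral>x. \<phi> x *\<^sub>R g x \<partial>lborel) = (\<integral>x. \<phi> x *\<^sub>R h x \<partial>lborel)"
      by simp
    then show "(\<integral>x. \<phi> x *\<^sub>R (g x - h x) \<partial>lborel) = 0"
      by (simp add: scaleR_diff_right Bochner_Integration.integral_diff
          integrable_test_function_scaleR[OF g \<phi>] integrable_test_function_scaleR[OF h \<phi>])
  qed
  then show ?thesis by eventually_elim simp
qed

text \<open>\<open>weak_deriv\<close> is an arbitrarily chosen representative; almost everywhere
  uniqueness allows its norm to be computed from any explicit weak derivative.\<close>

lemma L2_norm_weak_deriv:
  assumes "has_weak_deriv k f g"
  shows "L2_norm (weak_deriv k f) = L2_norm g"
proof -
  have w: "has_weak_deriv k f (weak_deriv k f)"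
    unfolding weak_deriv_def by (rule someI[of "has_weak_deriv k f", OF assms])
  have [measurable]: "g \<in> borel_measurable borel" "weak_deriv k f \<in> borel_measurable borel"
    using assms w by (auto simp: has_weak_deriv_def intro: locally_integrable_measurable)
  have "(\<integral>x. (norm (weak_deriv k f x))\<^sup>2 \<partial>lborel) = (\<integral>x. (norm (g x))\<^sup>2 \<partial>lborel)"
    by (rule integral_cong_AE) (use has_weak_deriv_unique[OF w assms] in \<open>auto elim: eventually_mono\<close>)
  then show ?thesis
    by (simp add: L2_norm_def)
qed

lemma square_integrable_imp_integrable_Icc:
  fixes f :: "real \<Rightarrow> 'a::euclidean_space"
  assumes "square_integrable f"
  shows "integrable lborel (\<lambda>x. indicator {a..b} x *\<^sub>R f x)"
proof (rule Bochner_Integration.integrable_bound)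
  have [measurable]: "f \<in> borel_measurable borel" and f2: "integrable lborel (\<lambda>x. (norm (f x))\<^sup>2)"
    using assms by (auto simp: square_integrable_def)
  show "(\<lambda>x. indicator {a..b} x *\<^sub>R f x) \<in> borel_measurable lborel" by measurable
  show "integrable lborel (\<lambda>x. indicator {a..b} x + (norm (f x))\<^sup>2)"
    by (intro Bochner_Integration.integrable_add f2 integrable_real_indicator) (auto simp: emeasure_lborel_Icc_eq)
  show "AE x in lborel. norm (indicator {a..b} x *\<^sub>R f x) \<le> norm (indicator {a..b} x + (norm (f x))\<^sup>2)"
  proof (rule AE_I2)
    fix x
    have "2 * norm (f x) \<le> 1 + (norm (f x))\<^sup>2"
      using sum_squares_bound[of 1 "norm (f x)"] by simp
    then have "norm (f x) \<le> 1 + (norm (f x))\<^sup>2"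
      using norm_ge_zero[of "f x"] by linarith
    then show "norm (indicator {a..b} x *\<^sub>R f x) \<le> norm (indicator {a..b} x + (norm (f x))\<^sup>2)"
      by (auto simp: indicator_def)
  qed
qed

lemma square_integrable_imp_locally_integrable: "square_integrable f \<Longrightarrow> locally_integrable f"
  by (simp add: locally_integrable_def set_integrable_def square_integrable_imp_integrable_Icc)

section \<open>Weak derivatives and the Fourier transform\<close>

lemma norm_cis_diff_le: "norm (cis a - cis b) \<le> \<bar>a - b\<bar>"
proof -
  have "cis a - cis b = cis b * (cis (a - b) - 1)"
    by (simp add: algebra_simps cis_mult)
  then have "norm (cis a - cis b) = norm (cis (a - b) - 1)"
    by (simp add: norm_mult)
  then show ?thesis
    using iexp_approx1[of "a - b" 0] by (simp add: cis_conv_exp)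
qed

lemma cis_difference_quotient_tendsto:
  fixes Y :: "nat \<Rightarrow> real"
  assumes "Y \<longlonglongrightarrow> x" "\<And>n. Y n \<noteq> x"
  shows "(\<lambda>n. (cis (- (Y n * \<xi>)) - cis (- (x * \<xi>))) / of_real (Y n - x)) \<longlonglongrightarrow> - (\<i> * of_real \<xi>) * cis (- (x * \<xi>))"
proof -
  let ?c = "- (\<i> * complex_of_real \<xi>)"
  have "((\<lambda>z. exp (?c * z)) has_field_derivative ?c * exp (?c * of_real x)) (at (of_real x))"
    by (auto intro!: derivative_eq_intros)
  then have "((\<lambda>z. (exp (?c * z) - exp (?c * of_real x)) / (z - of_real x)) \<longlongrightarrow> ?c * exp (?c * of_real x)) (at (of_real x))"
    by (simp add: has_field_derivative_iff)
  moreover have "filterlim (\<lambda>n. complex_of_real (Y n)) (at (of_real x)) sequentially"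
    using assms by (intro filterlim_atI tendsto_of_real) auto
  ultimately have "(\<lambda>n. (exp (?c * of_real (Y n)) - exp (?c * of_real x)) / (of_real (Y n) - of_real x)) \<longlonglongrightarrow> ?c * exp (?c * of_real x)"
    by (rule filterlim_compose)
  then show ?thesis
    by (simp add: cis_conv_exp mult_ac)
qed

text \<open>Differentiation under the integral: the difference quotients of the exponential are
  dominated by |\<open>\<xi>\<close>|, so the first moment of w is the majorant.\<close>

lemma ft_difference_quotient_tendsto:
  assumes w: "integrable lborel w" and w1: "integrable lborel (\<lambda>\<xi>. of_real \<xi> * w \<xi>)"
  shows "((\<lambda>y. (ft w y - ft w x) / of_real (y - x)) \<longlongrightarrow> ft (\<lambda>\<xi>. - (\<i> * of_real \<xi>) * w \<xi>) x) (at x)"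
  unfolding tendsto_at_iff_sequentially comp_def
proof (intro allI impI)
  fix Y :: "nat \<Rightarrow> real" assume "\<forall>n. Y n \<in> UNIV - {x}" "Y \<longlonglongrightarrow> x"
  then have Y: "\<And>n. Y n \<noteq> x" "Y \<longlonglongrightarrow> x" by auto
  have [measurable]: "w \<in> borel_measurable borel" using w by auto
  let ?s = "\<lambda>n \<xi>. (cis (- (Y n * \<xi>)) - cis (- (x * \<xi>))) / of_real (Y n - x) * w \<xi>"
  have "(\<lambda>n. \<integral>\<xi>. ?s n \<xi> \<partial>lborel) \<longlonglongrightarrow> (\<integral>\<xi>. - (\<i> * of_real \<xi>) * cis (- (x * \<xi>)) * w \<xi> \<partial>lborel)"
  proof (rule integral_dominated_convergence)
    show "integrable lborel (\<lambda>\<xi>. norm (of_real \<xi> * w \<xi>))"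
      using w1 by (rule integrable_norm)
    show "AE \<xi> in lborel. (\<lambda>n. ?s n \<xi>) \<longlonglongrightarrow> - (\<i> * of_real \<xi>) * cis (- (x * \<xi>)) * w \<xi>"
      by (intro AE_I2 tendsto_mult_right cis_difference_quotient_tendsto Y)
    show "AE \<xi> in lborel. norm (?s n \<xi>) \<le> norm (of_real \<xi> * w \<xi>)" for n
    proof (rule AE_I2)
      fix \<xi>
      have "norm (cis (- (Y n * \<xi>)) - cis (- (x * \<xi>))) \<le> \<bar>\<xi>\<bar> * \<bar>Y n - x\<bar>"
        using norm_cis_diff_le[of "- (Y n * \<xi>)" "- (x * \<xi>)"]
        by (simp add: abs_mult[symmetric] algebra_simps abs_minus_commute)
      then have "norm (cis (- (Y n * \<xi>)) - cis (- (x * \<xi>))) / \<bar>Y n - x\<bar> \<le> \<bar>\<xi>\<bar>"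
        using Y(1)[of n] by (simp add: field_simps)
      then have "norm (cis (- (Y n * \<xi>)) - cis (- (x * \<xi>))) / \<bar>Y n - x\<bar> * norm (w \<xi>) \<le> \<bar>\<xi>\<bar> * norm (w \<xi>)"
        by (rule mult_right_mono) simp
      then show "norm (?s n \<xi>) \<le> norm (of_real \<xi> * w \<xi>)"
        by (simp add: norm_mult norm_divide flip: of_real_diff)
    qed
  qed measurable
  moreover have "(\<integral>\<xi>. ?s n \<xi> \<partial>lborel) = (ft w (Y n) - ft w x) / of_real (Y n - x)" for n
  proof -
    have "ft w (Y n) - ft w x = (\<integral>\<xi>. cis (- (Y n * \<xi>)) * w \<xi> - cis (- (x * \<xi>)) * w \<xi> \<partial>lborel)"
      unfolding ft_def by (rule Bochner_Integration.integral_diff[symmetric]) (rule integrable_cis_mult[OF w], measurable)+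
    moreover have "(\<integral>\<xi>. ?s n \<xi> \<partial>lborel) = (\<integral>\<xi>. (cis (- (Y n * \<xi>)) * w \<xi> - cis (- (x * \<xi>)) * w \<xi>) / of_real (Y n - x) \<partial>lborel)"
      by (rule Bochner_Integration.integral_cong) (simp_all add: field_simps diff_divide_distrib)
    ultimately show ?thesis by simp
  qed
  moreover have "(\<integral>\<xi>. - (\<i> * of_real \<xi>) * cis (- (x * \<xi>)) * w \<xi> \<partial>lborel) = ft (\<lambda>\<xi>. - (\<i> * of_real \<xi>) * w \<xi>) x"
    unfolding ft_def by (rule Bochner_Integration.integral_cong) (simp_all add: mult_ac)
  ultimately show "(\<lambda>n. (ft w (Y n) - ft w x) / of_real (Y n - x)) \<longlonglongrightarrow> ft (\<lambda>\<xi>. - (\<i> * of_real \<xi>) * w \<xi>) x"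
    by (simp only:)
qed

text \<open>Test functions are real-valued, so a complex transform can only enter through its real
  and imaginary parts; c = 1 and c = -i select them.\<close>

lemma Re_ft_DERIV:
  assumes "integrable lborel w" "integrable lborel (\<lambda>\<xi>. of_real \<xi> * w \<xi>)"
  shows "((\<lambda>x. Re (c * ft w x)) has_field_derivative Re (c * ft (\<lambda>\<xi>. - (\<i> * of_real \<xi>) * w \<xi>) x)) (at x)"
proof -
  have "((\<lambda>y. Re (c * ((ft w y - ft w x) / of_real (y - x)))) \<longlongrightarrow> Re (c * ft (\<lambda>\<xi>. - (\<i> * of_real \<xi>) * w \<xi>) x)) (at x)"
    by (intro tendsto_Re tendsto_mult_left ft_difference_quotient_tendsto assms)
  moreover have "Re (c * ((ft w y - ft w x) / of_real (y - x))) = (Re (c * ft w y) - Re (c * ft w x)) / (y - x)" for y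
  proof -
    have "c * ((ft w y - ft w x) / of_real (y - x)) = (c * ft w y - c * ft w x) / of_real (y - x)"
      by (simp add: right_diff_distrib)
    then show ?thesis
      by (simp only: Re_divide_of_real minus_complex.sel)
  qed
  ultimately show ?thesis
    unfolding has_field_derivative_iff by (simp only:)
qed

text \<open>Transforms of compactly supported functions are smooth with bounded derivatives but not
  compactly supported. This class contains their real parts and will be admissible for testing weak
  derivatives.\<close>

definition bsmooth :: "(real \<Rightarrow> real) \<Rightarrow> bool" where
  "bsmooth p \<longleftrightarrow> smooth p \<and> (\<forall>n. \<exists>B. \<forall>x. \<bar>(deriv ^^ n) p x\<bar> \<le> B)"

lemma bsmooth_deriv: "bsmooth p \<Longrightarrow> bsmooth (deriv p)"
  unfolding bsmooth_def by (metis smooth_deriv funpow_Suc_right comp_apply)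

lemma bsmooth_test_function:
  assumes "test_function \<kappa>"
  shows "bsmooth \<kappa>"
  unfolding bsmooth_def
proof (intro conjI allI)
  show "smooth \<kappa>" using assms by (simp add: test_function_iff_smooth)
  show "\<exists>B. \<forall>x. \<bar>(deriv ^^ n) \<kappa> x\<bar> \<le> B" for n
    by (rule test_function_bounded[OF test_function_higher_deriv[OF assms, of n]]) blast
qed

lemma higher_deriv_linear:
  assumes "smooth f" "smooth g"
  shows "(deriv ^^ n) (\<lambda>x. c * f x + g x) = (\<lambda>x. c * (deriv ^^ n) f x + (deriv ^^ n) g x)"
proof (induction n)
  case (Suc n)
  have "((\<lambda>x. c * (deriv ^^ n) f x + (deriv ^^ n) g x) has_field_derivative
      c * deriv ((deriv ^^ n) f) x + deriv ((deriv ^^ n) g) x) (at x)" for x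
    by (intro DERIV_add DERIV_cmult smooth_DERIV smooth_higher_deriv assms)
  then show ?case
    by (simp add: Suc) (intro ext DERIV_imp_deriv)
qed simp

lemma smooth_dilation: "smooth \<kappa> \<Longrightarrow> smooth (\<lambda>x. \<kappa> (s * x))"
  using smooth_affine[of \<kappa> s 0] by simp

lemma deriv_dilated_cutoff:
  assumes "smooth \<kappa>" "smooth p"
  shows "deriv (\<lambda>x. \<kappa> (s * x) * p x) = (\<lambda>x. s * (deriv \<kappa> (s * x) * p x) + \<kappa> (s * x) * deriv p x)"
proof (intro ext DERIV_imp_deriv)
  fix x
  have "((\<lambda>x. s * x) has_field_derivative s) (at x)"
    by (auto intro!: derivative_eq_intros)
  from DERIV_chain2[OF smooth_DERIV[OF assms(1)] this]
  have "((\<lambda>x. \<kappa> (s * x)) has_field_derivative deriv \<kappa> (s * x) * s) (at x)" .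
  from DERIV_mult[OF this smooth_DERIV[OF assms(2)]]
  show "((\<lambda>x. \<kappa> (s * x) * p x) has_field_derivative s * (deriv \<kappa> (s * x) * p x) + \<kappa> (s * x) * deriv p x) (at x)"
    by (simp add: algebra_simps)
qed

text \<open>All terms of the Leibniz rule in which the cutoff \<open>\<kappa>(s x)\<close> is differentiated carry a power
  of \<open>s\<close>, so only the undifferentiated cutoff survives as \<open>s \<rightarrow> 0\<close>.\<close>

lemma higher_deriv_dilated_cutoff:
  assumes "bsmooth \<kappa>" "bsmooth p"
  shows "\<exists>B. \<forall>s x. 0 \<le> s \<longrightarrow> s \<le> 1 \<longrightarrow> \<bar>(deriv ^^ m) (\<lambda>x. \<kappa> (s * x) * p x) x\<bar> \<le> B"
    and "s \<longlonglongrightarrow> 0 \<Longrightarrow> (\<And>n. 0 \<le> s n \<and> s n \<le> 1) \<Longrightarrow>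
      (\<lambda>n. (deriv ^^ m) (\<lambda>x. \<kappa> (s n * x) * p x) x) \<longlonglongrightarrow> \<kappa> 0 * (deriv ^^ m) p x"
  using assms
proof (induction m arbitrary: \<kappa> p)
  case 0
  {
    case 1
    obtain B1 where "\<And>x. \<bar>\<kappa> x\<bar> \<le> B1"
      using 1(1) unfolding bsmooth_def by (metis funpow_0)
    moreover obtain B2 where "\<And>x. \<bar>p x\<bar> \<le> B2"
      using 1(2) unfolding bsmooth_def by (metis funpow_0)
    ultimately have "\<bar>\<kappa> (s * x)\<bar> * \<bar>p x\<bar> \<le> B1 * B2" for s x
      by (intro mult_mono) (auto intro: order_trans[OF abs_ge_zero])
    then show ?case by (auto simp: abs_mult)
  next
    case 2
    have "isCont \<kappa> 0"
      using 2 by (auto simp: bsmooth_def intro: smooth_isCont)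
    moreover have "(\<lambda>n. s n * x) \<longlonglongrightarrow> 0 * x"
      by (intro tendsto_intros 2)
    ultimately have "(\<lambda>n. \<kappa> (s n * x)) \<longlonglongrightarrow> \<kappa> 0"
      by (metis isCont_tendsto_compose mult_zero_left)
    then show ?case by (simp add: tendsto_mult_right)
  }
next
  case (Suc m)
  have sm: "smooth \<kappa>" "smooth p" "smooth (deriv \<kappa>)" "smooth (deriv p)"
    if "bsmooth \<kappa>" "bsmooth p" for \<kappa> p
    using that by (auto simp: bsmooth_def intro: smooth_deriv)
  have step: "(deriv ^^ Suc m) (\<lambda>x. \<kappa> (s * x) * p x) x
      = s * (deriv ^^ m) (\<lambda>x. deriv \<kappa> (s * x) * p x) x + (deriv ^^ m) (\<lambda>x. \<kappa> (s * x) * deriv p x) x"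
    if "bsmooth \<kappa>" "bsmooth p" for s x \<kappa> p
  proof -
    have "(deriv ^^ Suc m) (\<lambda>x. \<kappa> (s * x) * p x) = (deriv ^^ m) (deriv (\<lambda>x. \<kappa> (s * x) * p x))"
      by (simp only: funpow_Suc_right comp_apply)
    also have "\<dots> = (deriv ^^ m) (\<lambda>x. s * (deriv \<kappa> (s * x) * p x) + \<kappa> (s * x) * deriv p x)"
      using sm[OF that] by (simp add: deriv_dilated_cutoff)
    also have "\<dots> = (\<lambda>x. s * (deriv ^^ m) (\<lambda>x. deriv \<kappa> (s * x) * p x) x + (deriv ^^ m) (\<lambda>x. \<kappa> (s * x) * deriv p x) x)"
      by (intro higher_deriv_linear smooth_mult smooth_dilation sm[OF that])
    finally show ?thesis by simp
  qed
  {
    case 1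
    obtain B1 where B1: "\<And>s x. 0 \<le> s \<Longrightarrow> s \<le> 1 \<Longrightarrow> \<bar>(deriv ^^ m) (\<lambda>x. deriv \<kappa> (s * x) * p x) x\<bar> \<le> B1"
      using Suc.IH(1)[OF bsmooth_deriv[OF 1(1)] 1(2)] by blast
    obtain B2 where B2: "\<And>s x. 0 \<le> s \<Longrightarrow> s \<le> 1 \<Longrightarrow> \<bar>(deriv ^^ m) (\<lambda>x. \<kappa> (s * x) * deriv p x) x\<bar> \<le> B2"
      using Suc.IH(1)[OF 1(1) bsmooth_deriv[OF 1(2)]] by blast
    have "\<bar>(deriv ^^ Suc m) (\<lambda>x. \<kappa> (s * x) * p x) x\<bar> \<le> B1 + B2" if s: "0 \<le> s" "s \<le> 1" for s x
    proof -
      have "\<bar>s * (deriv ^^ m) (\<lambda>x. deriv \<kappa> (s * x) * p x) x\<bar> \<le> 1 * B1"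
        unfolding abs_mult using s B1[OF s, of x] by (intro mult_mono) auto
      then show ?thesis
        unfolding step[OF 1] using B2[OF s, of x] by linarith
    qed
    then show ?case by blast
  next
    case 2
    have "(\<lambda>n. s n * (deriv ^^ m) (\<lambda>x. deriv \<kappa> (s n * x) * p x) x + (deriv ^^ m) (\<lambda>x. \<kappa> (s n * x) * deriv p x) x)
        \<longlonglongrightarrow> 0 * (deriv \<kappa> 0 * (deriv ^^ m) p x) + \<kappa> 0 * (deriv ^^ m) (deriv p) x"
      by (intro tendsto_add tendsto_mult 2 Suc.IH(2) bsmooth_deriv)
    then show ?case
      unfolding step[OF 2(3,4)] by (simp add: funpow_swap1)
  }
qed


section \<open>Fourier inversion for test functions\<close>

lemma integrable_test_function:
  assumes "test_function \<phi>"
  shows "integrable lborel (\<lambda>x. complex_of_real (\<phi> x))"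
proof -
  have "locally_integrable (\<lambda>_. 1 :: complex)"
    unfolding locally_integrable_def set_integrable_def
    by (intro allI integrable_scaleR_left integrable_real_indicator) (auto simp: emeasure_lborel_Icc_eq)
  from integrable_test_function_scaleR[OF this assms] show ?thesis
    by (simp add: scaleR_conv_of_real)
qed

lemma ft_deriv:
  assumes \<phi>: "test_function \<phi>"
  shows "ft (\<lambda>x. of_real (deriv \<phi> x)) \<xi> = \<i> * of_real \<xi> * ft (\<lambda>x. of_real (\<phi> x)) \<xi>"
proof -
  note \<phi>' = test_function_deriv[OF \<phi>]
  have s: "smooth \<phi>" using \<phi> by (simp add: test_function_iff_smooth)
  obtain R where R: "\<And>x. \<bar>x\<bar> > R \<Longrightarrow> \<phi> x = 0"
    using \<phi> by (auto simp: test_function_iff_smooth)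
  obtain R' where R': "\<And>x. \<bar>x\<bar> > R' \<Longrightarrow> deriv \<phi> x = 0"
    using \<phi>' by (auto simp: test_function_iff_smooth)
  \<comment> \<open>The summand 1 makes \<open>\<phi>\<close> and its derivative vanish at the end
    points of [-S, S] too, so no boundary term appears.\<close>
  define S where "S = \<bar>R\<bar> + \<bar>R'\<bar> + 1"
  have S: "\<phi> x = 0" "deriv \<phi> x = 0" if "\<bar>x\<bar> \<ge> S" for x
    using that by (auto intro!: R R' simp: S_def)
  let ?F = "\<lambda>x. cis (- (\<xi> * x)) * of_real (\<phi> x)"
  let ?f = "\<lambda>x. - (\<i> * of_real \<xi>) * ?F x + cis (- (\<xi> * x)) * of_real (deriv \<phi> x)"
  have DF: "(?F has_vector_derivative ?f x) (at x)" for x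
  proof -
    have "((\<lambda>z. exp (- (\<i> * of_real \<xi>) * z)) has_field_derivative - (\<i> * of_real \<xi>) * exp (- (\<i> * of_real \<xi>) * of_real x)) (at (of_real x))"
      by (auto intro!: derivative_eq_intros)
    from has_vector_derivative_real_field[OF this]
    have 1: "((\<lambda>x. cis (- (\<xi> * x))) has_vector_derivative - (\<i> * of_real \<xi>) * cis (- (\<xi> * x))) (at x)"
      by (simp add: cis_conv_exp mult_ac)
    have 2: "((\<lambda>x. complex_of_real (\<phi> x)) has_vector_derivative of_real (deriv \<phi> x)) (at x)"
      using smooth_DERIV[OF s, of x] by (intro has_vector_derivative_of_real) (simp add: has_real_derivative_iff_has_vector_derivative)
    from has_vector_derivative_mult[OF 1 2] show ?thesis
      by (simp add: algebra_simps)
  qed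
  have cont: "continuous_on {-S..S} ?f"
  proof -
    have "continuous_on UNIV \<phi>" "continuous_on UNIV (deriv \<phi>)"
      using smooth_isCont[OF s] smooth_isCont[OF smooth_deriv[OF s]] by (simp_all add: continuous_on_eq_continuous_at)
    then have "continuous_on {-S..S} \<phi>" "continuous_on {-S..S} (deriv \<phi>)"
      by (auto intro: continuous_on_subset)
    then show ?thesis
      by (intro continuous_intros)
  qed
  have "(\<integral>x. indicator {-S..S} x *\<^sub>R ?f x \<partial>lborel) = ?F S - ?F (- S)"
    by (rule integral_FTC_Icc[OF _ has_vector_derivative_at_within[OF DF] cont]) (simp add: S_def)
  also have "\<dots> = 0"
    using S by (simp add: S_def)
  also have "(\<lambda>x. indicator {-S..S} x *\<^sub>R ?f x) = ?f"
  proof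
    fix x show "indicator {-S..S} x *\<^sub>R ?f x = ?f x"
      using S[of x] by (cases "\<bar>x\<bar> \<le> S") (auto simp: indicator_def)
  qed
  finally have 0: "(\<integral>x. ?f x \<partial>lborel) = 0" .
  have "(\<integral>x. ?f x \<partial>lborel) = (\<integral>x. - (\<i> * of_real \<xi>) * ?F x \<partial>lborel) + (\<integral>x. cis (- (\<xi> * x)) * of_real (deriv \<phi> x) \<partial>lborel)"
    by (intro Bochner_Integration.integral_add integrable_mult_right integrable_cis_mult
        integrable_test_function \<phi> \<phi>') measurable
  also have "(\<integral>x. - (\<i> * of_real \<xi>) * ?F x \<partial>lborel) = - (\<i> * of_real \<xi>) * ft (\<lambda>x. of_real (\<phi> x)) \<xi>"
    unfolding ft_def by (rule integral_mult_right_zero)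
  finally show ?thesis
    using 0 by (simp add: ft_def)
qed

lemma ft_higher_deriv:
  assumes "test_function \<phi>"
  shows "ft (\<lambda>x. of_real ((deriv ^^ k) \<phi> x)) \<xi> = (\<i> * of_real \<xi>) ^ k * ft (\<lambda>x. of_real (\<phi> x)) \<xi>"
  by (induction k) (simp_all add: ft_deriv[OF test_function_higher_deriv[OF assms]])

text \<open>Two derivatives on the test function give decay like 1 / (1 +
  \<open>\<xi>\<close>^2).\<close>

lemma integrable_ft_test_function:
  assumes \<phi>: "test_function \<phi>"
  shows "integrable lborel (ft (\<lambda>x. of_real (\<phi> x)))"
proof -
  let ?f = "ft (\<lambda>x. of_real (\<phi> x))"
  have [measurable]: "\<phi> \<in> borel_measurable borel"
    by (rule test_function_bounded[OF \<phi>])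
  define C where "C = (\<integral>x. norm (complex_of_real (\<phi> x)) \<partial>lborel) + (\<integral>x. norm (complex_of_real ((deriv ^^ 2) \<phi> x)) \<partial>lborel)"
  have bound: "norm (?f \<xi>) \<le> C * inverse (1 + \<xi>\<^sup>2)" for \<xi>
  proof -
    have "norm (?f \<xi>) + \<xi>\<^sup>2 * norm (?f \<xi>) = norm (?f \<xi>) + norm (ft (\<lambda>x. of_real ((deriv ^^ 2) \<phi> x)) \<xi>)"
      unfolding ft_higher_deriv[OF \<phi>] by (simp add: norm_mult norm_power)
    also have "\<dots> \<le> C"
      unfolding C_def
      by (intro add_mono norm_ft_le integrable_test_function \<phi> test_function_higher_deriv)
    finally have "(1 + \<xi>\<^sup>2) * norm (?f \<xi>) \<le> C" by (simp add: algebra_simps)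
    moreover have "0 < 1 + \<xi>\<^sup>2" by (simp add: add_pos_nonneg)
    ultimately show ?thesis by (simp add: field_simps)
  qed
  show ?thesis
  proof (rule Bochner_Integration.integrable_bound)
    show "integrable lborel (\<lambda>\<xi>. C * inverse (1 + \<xi>\<^sup>2))"
      using integrable_inverse_1_plus_square by (simp add: set_integrable_def)
    show "AE \<xi> in lborel. norm (?f \<xi>) \<le> norm (C * inverse (1 + \<xi>\<^sup>2))"
    proof (rule AE_I2)
      fix \<xi> show "norm (?f \<xi>) \<le> norm (C * inverse (1 + \<xi>\<^sup>2))"
        using bound[of \<xi>] by (simp add: abs_if)
    qed
  qed measurable
qed

lemma integrable_square_if_bounded:
  fixes f :: "real \<Rightarrow> complex"
  assumes f: "integrable lborel f" and B: "\<And>x. norm (f x) \<le> B"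
  shows "integrable lborel (\<lambda>x. (norm (f x))\<^sup>2)"
proof (rule Bochner_Integration.integrable_bound)
  have [measurable]: "f \<in> borel_measurable borel" using f by auto
  show "integrable lborel (\<lambda>x. B * norm (f x))"
    using f by simp
  show "(\<lambda>x. (norm (f x))\<^sup>2) \<in> borel_measurable lborel" by measurable
  have "(norm (f x))\<^sup>2 \<le> B * norm (f x)" for x
    using B[of x] by (simp add: power2_eq_square mult_right_mono)
  moreover have "0 \<le> B" using order_trans[OF norm_ge_zero B] .
  ultimately show "AE x in lborel. norm ((norm (f x))\<^sup>2) \<le> norm (B * norm (f x))"
    by (simp add: abs_mult)
qed

text \<open>With the parameter e^2, the substitution y = x + 2 e t turns the heat kernel into a
  fixed multiple of exp(-t^2), after which dominated convergence applies. The mass is 2 sqrt(pi)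
  sqrt(pi) = 2 pi.\<close>

lemma heat_kernel_approximate_identity:
  assumes \<phi>: "test_function \<phi>"
  shows "(\<lambda>n. \<integral>y. of_real (\<phi> y) * complex_of_real (heat_kernel ((inverse (real (Suc n)))\<^sup>2) (y - x)) \<partial>lborel)
    \<longlonglongrightarrow> of_real (2 * pi * \<phi> x)"
proof -
  obtain R B where RB: "R > 0" "\<And>x. \<bar>x\<bar> > R \<Longrightarrow> \<phi> x = 0" "\<And>x. \<bar>\<phi> x\<bar> \<le> B" "continuous_on UNIV \<phi>"
    "\<phi> \<in> borel_measurable borel" "B \<ge> 0"
    by (rule test_function_bounded[OF \<phi>]) blast
  note [measurable] = RB(5)
  let ?e = "\<lambda>n. inverse (real (Suc n))"
  have subst: "(\<integral>y. \<phi> y * heat_kernel ((?e n)\<^sup>2) (y - x) \<partial>lborel) = 2 * sqrt pi * (\<integral>t. \<phi> (x + 2 * ?e n * t) * gauss 1 t \<partial>lborel)" for n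
  proof -
    have e: "?e n > 0" by simp
    have "(\<integral>y. \<phi> y * heat_kernel ((?e n)\<^sup>2) (y - x) \<partial>lborel)
        = \<bar>2 * ?e n\<bar> *\<^sub>R (\<integral>t. \<phi> (x + 2 * ?e n * t) * heat_kernel ((?e n)\<^sup>2) (x + 2 * ?e n * t - x) \<partial>lborel)"
      by (rule lborel_integral_real_affine) (use e in simp)
    also have "(\<lambda>t. \<phi> (x + 2 * ?e n * t) * heat_kernel ((?e n)\<^sup>2) (x + 2 * ?e n * t - x))
        = (\<lambda>t. sqrt pi / ?e n * (\<phi> (x + 2 * ?e n * t) * gauss 1 t))"
    proof
      fix t
      have "1 / (4 * (?e n)\<^sup>2) * (2 * ?e n * t)\<^sup>2 = 1 * t\<^sup>2"
        using e by (simp add: power_mult_distrib field_simps del: of_nat_Suc)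
      then have "heat_kernel ((?e n)\<^sup>2) (x + 2 * ?e n * t - x) = sqrt pi / ?e n * gauss 1 t"
        using e by (simp add: heat_kernel_def gauss_def real_sqrt_divide del: of_nat_Suc)
      then show "\<phi> (x + 2 * ?e n * t) * heat_kernel ((?e n)\<^sup>2) (x + 2 * ?e n * t - x)
          = sqrt pi / ?e n * (\<phi> (x + 2 * ?e n * t) * gauss 1 t)"
        by (simp only: mult_ac)
    qed
    also have "\<bar>2 * ?e n\<bar> *\<^sub>R (\<integral>t. sqrt pi / ?e n * (\<phi> (x + 2 * ?e n * t) * gauss 1 t) \<partial>lborel)
        = 2 * sqrt pi * (\<integral>t. \<phi> (x + 2 * ?e n * t) * gauss 1 t \<partial>lborel)"
      using e by (simp del: of_nat_Suc)
    finally show ?thesis .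
  qed
  have "(\<lambda>n. \<integral>t. \<phi> (x + 2 * ?e n * t) * gauss 1 t \<partial>lborel) \<longlonglongrightarrow> (\<integral>t. \<phi> x * gauss 1 t \<partial>lborel)"
  proof (rule integral_dominated_convergence)
    show "integrable lborel (\<lambda>t. B * gauss 1 t)"
      by (simp add: integrable_gauss)
    show "AE t in lborel. (\<lambda>n. \<phi> (x + 2 * ?e n * t) * gauss 1 t) \<longlonglongrightarrow> \<phi> x * gauss 1 t"
    proof (intro AE_I2 tendsto_mult_right)
      fix t
      have "(\<lambda>n. x + 2 * ?e n * t) \<longlonglongrightarrow> x + 2 * 0 * t"
        by (intro tendsto_intros LIMSEQ_inverse_real_of_nat)
      moreover have "isCont \<phi> (x + 2 * 0 * t)"
        using RB(4) by (simp add: continuous_on_eq_continuous_at)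
      ultimately have "(\<lambda>n. \<phi> (x + 2 * ?e n * t)) \<longlonglongrightarrow> \<phi> (x + 2 * 0 * t)"
        by (rule isCont_tendsto_compose[rotated])
      then show "(\<lambda>n. \<phi> (x + 2 * ?e n * t)) \<longlonglongrightarrow> \<phi> x" by simp
    qed
    show "AE t in lborel. norm (\<phi> (x + 2 * ?e n * t) * gauss 1 t) \<le> B * gauss 1 t" for n
      using RB(3) by (intro AE_I2) (simp add: abs_mult mult_right_mono)
  qed measurable
  then have "(\<lambda>n. 2 * sqrt pi * (\<integral>t. \<phi> (x + 2 * ?e n * t) * gauss 1 t \<partial>lborel)) \<longlonglongrightarrow> 2 * sqrt pi * (\<integral>t. \<phi> x * gauss 1 t \<partial>lborel)"
    by (rule tendsto_mult_left)
  also have "2 * sqrt pi * (\<integral>t. \<phi> x * gauss 1 t \<partial>lborel) = 2 * pi * \<phi> x"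
    by (simp add: integral_gauss)
  finally have "(\<lambda>n. \<integral>y. \<phi> y * heat_kernel ((?e n)\<^sup>2) (y - x) \<partial>lborel) \<longlonglongrightarrow> 2 * pi * \<phi> x"
    unfolding subst .
  then have "(\<lambda>n. complex_of_real (\<integral>y. \<phi> y * heat_kernel ((?e n)\<^sup>2) (y - x) \<partial>lborel)) \<longlonglongrightarrow> of_real (2 * pi * \<phi> x)"
    by (rule tendsto_of_real)
  moreover have "complex_of_real (\<integral>y. \<phi> y * heat_kernel ((?e n)\<^sup>2) (y - x) \<partial>lborel)
      = (\<integral>y. of_real (\<phi> y) * complex_of_real (heat_kernel ((?e n)\<^sup>2) (y - x)) \<partial>lborel)" for n
    by (simp only: of_real_mult[symmetric] integral_complex_of_real)
  ultimately show ?thesis by (simp only:)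
qed

text \<open>A Gaussian factor is inserted into the inverse integral. On the frequency side it
  disappears by dominated convergence, the transform being integrable; after the multiplication
  formula it has become an approximate identity acting on \<open>\<phi>\<close>.\<close>

theorem ft_inversion:
  assumes \<phi>: "test_function \<phi>"
  shows "ft (ft (\<lambda>x. of_real (\<phi> x))) (- x) = of_real (2 * pi * \<phi> x)"
proof -
  let ?f = "\<lambda>x. complex_of_real (\<phi> x)" and ?e = "\<lambda>n. (inverse (real (Suc n)))\<^sup>2"
  note i = integrable_test_function[OF \<phi>] and ift = integrable_ft_test_function[OF \<phi>]
  have e: "?e n > 0" for n by simp
  have "(\<lambda>n. \<integral>\<xi>. ft ?f \<xi> * (cis (\<xi> * x) * of_real (gauss (?e n) \<xi>)) \<partial>lborel) \<longlonglongrightarrow> (\<integral>\<xi>. ft ?f \<xi> * (cis (\<xi> * x) * of_real 1) \<partial>lborel)"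
  proof (rule integral_dominated_convergence[OF _ _ integrable_norm[OF ift]])
    have m: "ft ?f \<in> borel_measurable borel"
      using ift by auto
    note [measurable] = m
    show "(\<lambda>\<xi>. ft ?f \<xi> * (cis (\<xi> * x) * of_real 1)) \<in> borel_measurable lborel" by measurable
    show "(\<lambda>\<xi>. ft ?f \<xi> * (cis (\<xi> * x) * of_real (gauss (?e n) \<xi>))) \<in> borel_measurable lborel" for n by measurable
    show "AE \<xi> in lborel. (\<lambda>n. ft ?f \<xi> * (cis (\<xi> * x) * of_real (gauss (?e n) \<xi>))) \<longlonglongrightarrow> ft ?f \<xi> * (cis (\<xi> * x) * of_real 1)"
    proof (intro AE_I2 tendsto_mult_left tendsto_of_real)
      fix \<xi>
      have "(\<lambda>n. gauss (?e n) \<xi>) \<longlonglongrightarrow> exp (- (0\<^sup>2 * \<xi>\<^sup>2))"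
        unfolding gauss_def by (intro tendsto_intros LIMSEQ_inverse_real_of_nat)
      then show "(\<lambda>n. gauss (?e n) \<xi>) \<longlonglongrightarrow> 1" by simp
    qed
    show "AE \<xi> in lborel. norm (ft ?f \<xi> * (cis (\<xi> * x) * of_real (gauss (?e n) \<xi>))) \<le> norm (ft ?f \<xi>)" for n
      using gauss_le_1[of "?e n"] by (intro AE_I2) (simp add: norm_mult mult_left_le)
  qed
  moreover have "(\<integral>\<xi>. ft ?f \<xi> * (cis (\<xi> * x) * of_real (gauss (?e n) \<xi>)) \<partial>lborel) = (\<integral>y. ?f y * of_real (heat_kernel (?e n) (y - x)) \<partial>lborel)" for n
  proof -
    have ig: "integrable lborel (\<lambda>\<xi>. complex_of_real (gauss (?e n) \<xi>))"
      using integrable_gauss[OF e] by (simp add: complex_of_real_integrable_eq)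
    have "(\<integral>\<xi>. ft ?f \<xi> * (cis (\<xi> * x) * of_real (gauss (?e n) \<xi>)) \<partial>lborel)
        = (\<integral>y. ?f y * ft (\<lambda>\<xi>. cis (\<xi> * x) * of_real (gauss (?e n) \<xi>)) y \<partial>lborel)"
      by (rule ft_multiplication_formula[OF i integrable_cis_mult[OF ig]]) measurable
    then show ?thesis
      by (simp only: ft_modulated_gauss[OF e])
  qed
  ultimately have "(\<integral>\<xi>. ft ?f \<xi> * (cis (\<xi> * x) * of_real 1) \<partial>lborel) = of_real (2 * pi * \<phi> x)"
    using heat_kernel_approximate_identity[OF \<phi>, of x] by (simp only: LIMSEQ_unique)
  moreover have "ft (ft ?f) (- x) = (\<integral>\<xi>. ft ?f \<xi> * (cis (\<xi> * x) * of_real 1) \<partial>lborel)"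
    unfolding ft_def[of "ft ?f"] by (simp add: mult_ac)
  ultimately show ?thesis by simp
qed

text \<open>The Cauchy-Schwarz inequality before optimisation: the free parameter s balances the two
  squares and is fixed in each application.\<close>

lemma integrable_mult_square_integrable:
  fixes f g :: "real \<Rightarrow> complex"
  assumes [measurable]: "f \<in> borel_measurable borel" "g \<in> borel_measurable borel"
    and f: "integrable lborel (\<lambda>x. (norm (f x))\<^sup>2)" and g: "integrable lborel (\<lambda>x. (norm (g x))\<^sup>2)"
  shows "integrable lborel (\<lambda>x. f x * g x)"
    and "0 < s \<Longrightarrow> norm (\<integral>x. f x * g x \<partial>lborel) \<le> (\<integral>x. (norm (f x))\<^sup>2 \<partial>lborel) / s + s * (\<integral>x. (norm (g x))\<^sup>2 \<partial>lborel) / 4"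
proof -
  have am_gm: "norm (f x * g x) \<le> (norm (f x))\<^sup>2 / s + s * (norm (g x))\<^sup>2 / 4" if "0 < s" for s x
  proof -
    have "(norm (f x))\<^sup>2 / s + s * (norm (g x))\<^sup>2 / 4 - norm (f x) * norm (g x) = (2 * norm (f x) - s * norm (g x))\<^sup>2 / (4 * s)"
      using that by (simp add: power2_eq_square field_simps)
    moreover have "0 \<le> (2 * norm (f x) - s * norm (g x))\<^sup>2 / (4 * s)"
      using that by simp
    ultimately show ?thesis
      by (simp add: norm_mult)
  qed
  show int: "integrable lborel (\<lambda>x. f x * g x)"
  proof (rule Bochner_Integration.integrable_bound)
    show "integrable lborel (\<lambda>x. (norm (f x))\<^sup>2 / 1 + 1 * (norm (g x))\<^sup>2 / 4)"
      using f g by simp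
    show "AE x in lborel. norm (f x * g x) \<le> norm ((norm (f x))\<^sup>2 / 1 + 1 * (norm (g x))\<^sup>2 / 4)"
      using am_gm[of 1] by (intro AE_I2) (simp add: order_trans[OF _ abs_ge_self])
  qed measurable
  show "norm (\<integral>x. f x * g x \<partial>lborel) \<le> (\<integral>x. (norm (f x))\<^sup>2 \<partial>lborel) / s + s * (\<integral>x. (norm (g x))\<^sup>2 \<partial>lborel) / 4"
    if "0 < s"
  proof -
    have "norm (\<integral>x. f x * g x \<partial>lborel) \<le> (\<integral>x. norm (f x * g x) \<partial>lborel)"
      by (rule integral_norm_bound)
    also have "\<dots> \<le> (\<integral>x. (norm (f x))\<^sup>2 / s + s * (norm (g x))\<^sup>2 / 4 \<partial>lborel)"
      by (intro integral_mono integrable_norm int am_gm that Bochner_Integration.integrable_add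
          integrable_divide integrable_mult_right f g)
    also have "\<dots> = (\<integral>x. (norm (f x))\<^sup>2 \<partial>lborel) / s + s * (\<integral>x. (norm (g x))\<^sup>2 \<partial>lborel) / 4"
      using f g by simp
    finally show ?thesis .
  qed
qed

lemma integrable_power2_norm_diff:
  fixes f g :: "real \<Rightarrow> complex"
  assumes [measurable]: "f \<in> borel_measurable borel" "g \<in> borel_measurable borel"
    and f: "integrable lborel (\<lambda>x. (norm (f x))\<^sup>2)" and g: "integrable lborel (\<lambda>x. (norm (g x))\<^sup>2)"
  shows "integrable lborel (\<lambda>x. (norm (f x - g x))\<^sup>2)"
proof (rule Bochner_Integration.integrable_bound)
  show "integrable lborel (\<lambda>x. 2 * (norm (f x))\<^sup>2 + 2 * (norm (g x))\<^sup>2)"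
    using f g by simp
  show "AE x in lborel. norm ((norm (f x - g x))\<^sup>2) \<le> norm (2 * (norm (f x))\<^sup>2 + 2 * (norm (g x))\<^sup>2)"
  proof (rule AE_I2)
    fix x
    have "(norm (f x - g x))\<^sup>2 \<le> (norm (f x) + norm (g x))\<^sup>2"
      by (intro power_mono norm_triangle_ineq4) simp
    also have "\<dots> \<le> 2 * (norm (f x))\<^sup>2 + 2 * (norm (g x))\<^sup>2"
      using sum_squares_bound[of "norm (f x)" "norm (g x)"] by (simp add: power2_sum)
    finally show "norm ((norm (f x - g x))\<^sup>2) \<le> norm (2 * (norm (f x))\<^sup>2 + 2 * (norm (g x))\<^sup>2)"
      by simp
  qed
qed measurable

lemma integrable_truncation:
  fixes u :: "real \<Rightarrow> complex"
  assumes [measurable]: "u \<in> borel_measurable borel" and u: "integrable lborel (\<lambda>x. (norm (u x))\<^sup>2)"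
  shows "integrable lborel (\<lambda>x. indicator {-R..R} x *\<^sub>R u x)"
    and "integrable lborel (\<lambda>x. (norm (indicator {-R..R} x *\<^sub>R u x))\<^sup>2)"
proof -
  show "integrable lborel (\<lambda>x. indicator {-R..R} x *\<^sub>R u x)"
    using u by (intro square_integrable_imp_integrable_Icc) (simp add: square_integrable_def)
  show "integrable lborel (\<lambda>x. (norm (indicator {-R..R} x *\<^sub>R u x))\<^sup>2)"
    by (rule Bochner_Integration.integrable_bound[OF u]) (auto simp: indicator_def)
qed

text \<open>The multiplication formula holds for the integrable truncations of u and survives the
  limit: on one side the transforms converge to h in L2, on the other domination by |u
  \<open>ft \<psi>\<close>| applies.\<close>

lemma fourier_L2_duality:
  fixes u h \<psi> :: "real \<Rightarrow> complex"
  assumes u_meas [measurable]: "u \<in> borel_measurable borel" and u: "integrable lborel (\<lambda>x. (norm (u x))\<^sup>2)"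
    and h_meas [measurable]: "h \<in> borel_measurable borel" and h: "integrable lborel (\<lambda>\<xi>. (norm (h \<xi>))\<^sup>2)"
    and lim: "((\<lambda>R. \<integral>\<^sup>+\<xi>. ennreal ((norm (h \<xi> - ft (\<lambda>x. indicator {-R..R} x *\<^sub>R u x) \<xi>))\<^sup>2) \<partial>lborel) \<longlongrightarrow> 0) at_top"
    and \<psi>: "integrable lborel \<psi>" and \<psi>2: "integrable lborel (\<lambda>x. (norm (\<psi> x))\<^sup>2)"
  shows "(\<integral>\<xi>. h \<xi> * \<psi> \<xi> \<partial>lborel) = (\<integral>x. u x * ft \<psi> x \<partial>lborel)"
proof -
  have \<psi>_meas [measurable]: "\<psi> \<in> borel_measurable borel" using \<psi> by auto
  let ?u = "\<lambda>n x. indicator {- real n..real n} x *\<^sub>R u x"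
  have ui: "integrable lborel (?u n)" "integrable lborel (\<lambda>x. (norm (?u n x))\<^sup>2)" for n
    using integrable_truncation[OF u_meas u] by auto
  define D where "D = (\<lambda>n. \<integral>\<xi>. (norm (h \<xi> - ft (?u n) \<xi>))\<^sup>2 \<partial>lborel)"
  have diff_int: "integrable lborel (\<lambda>\<xi>. (norm (h \<xi> - ft (?u n) \<xi>))\<^sup>2)" for n
    by (intro integrable_power2_norm_diff square_integrable_ft ui h) measurable
  have "(\<lambda>n. \<integral>\<^sup>+\<xi>. ennreal ((norm (h \<xi> - ft (?u n) \<xi>))\<^sup>2) \<partial>lborel) \<longlonglongrightarrow> 0"
    using filterlim_compose[OF lim filterlim_real_sequentially] .
  then have "(\<lambda>n. ennreal (D n)) \<longlonglongrightarrow> ennreal 0"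
    unfolding D_def by (simp add: nn_integral_eq_integral[OF diff_int])
  then have D0: "D \<longlonglongrightarrow> 0"
    by (rule tendsto_ennrealD) (auto simp: D_def)
  have D_nonneg: "0 \<le> D n" for n by (simp add: D_def)
  let ?P = "\<integral>x. (norm (\<psi> x))\<^sup>2 \<partial>lborel"
  have err: "norm ((\<integral>\<xi>. h \<xi> * \<psi> \<xi> \<partial>lborel) - (\<integral>x. ?u n x * ft \<psi> x \<partial>lborel))
      \<le> sqrt (D n) + (sqrt (D n) + inverse (real (Suc n))) * ?P / 4" for n
  proof -
    \<comment> \<open>The balancing value sqrt(D n) may be 0; the added 1/(n+1) keeps the parameter
      positive and tends to 0.\<close>
    let ?s = "sqrt (D n) + inverse (real (Suc n))"
    have s: "0 < ?s" using D_nonneg[of n] by (simp add: add_nonneg_pos)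
    have "(\<integral>\<xi>. h \<xi> * \<psi> \<xi> \<partial>lborel) - (\<integral>x. ?u n x * ft \<psi> x \<partial>lborel)
        = (\<integral>\<xi>. h \<xi> * \<psi> \<xi> \<partial>lborel) - (\<integral>\<xi>. ft (?u n) \<xi> * \<psi> \<xi> \<partial>lborel)"
      by (simp only: ft_multiplication_formula[OF ui(1) \<psi>])
    also have "\<dots> = (\<integral>\<xi>. h \<xi> * \<psi> \<xi> - ft (?u n) \<xi> * \<psi> \<xi> \<partial>lborel)"
      by (intro Bochner_Integration.integral_diff[symmetric] integrable_mult_square_integrable
          square_integrable_ft ui h \<psi>2) measurable
    also have "\<dots> = (\<integral>\<xi>. (h \<xi> - ft (?u n) \<xi>) * \<psi> \<xi> \<partial>lborel)"
      by (simp add: left_diff_distrib)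
    finally have "norm ((\<integral>\<xi>. h \<xi> * \<psi> \<xi> \<partial>lborel) - (\<integral>x. ?u n x * ft \<psi> x \<partial>lborel)) \<le> D n / ?s + ?s * ?P / 4"
      unfolding D_def
      using integrable_mult_square_integrable(2)[OF _ \<psi>_meas diff_int \<psi>2 s, of n] by (simp add: D_def)
    moreover have "D n / ?s \<le> sqrt (D n)"
    proof -
      have "D n = sqrt (D n) * sqrt (D n)" using D_nonneg by simp
      also have "\<dots> \<le> sqrt (D n) * ?s"
        using D_nonneg by (intro mult_left_mono) auto
      finally show ?thesis using s by (simp add: divide_le_eq)
    qed
    ultimately show ?thesis by linarith
  qed
  have "(\<lambda>n. sqrt (D n) + (sqrt (D n) + inverse (real (Suc n))) * ?P / 4) \<longlonglongrightarrow> sqrt 0 + (sqrt 0 + 0) * ?P / 4"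
    by (intro tendsto_intros D0 LIMSEQ_inverse_real_of_nat) auto
  then have "(\<lambda>n. (\<integral>\<xi>. h \<xi> * \<psi> \<xi> \<partial>lborel) - (\<integral>x. ?u n x * ft \<psi> x \<partial>lborel)) \<longlonglongrightarrow> 0"
    by (intro Lim_null_comparison[OF always_eventually[OF allI[OF err]]]) simp
  from tendsto_diff[OF tendsto_const[of "\<integral>\<xi>. h \<xi> * \<psi> \<xi> \<partial>lborel"] this]
  have "(\<lambda>n. \<integral>x. ?u n x * ft \<psi> x \<partial>lborel) \<longlonglongrightarrow> (\<integral>\<xi>. h \<xi> * \<psi> \<xi> \<partial>lborel)"
    by simp
  moreover have "(\<lambda>n. \<integral>x. ?u n x * ft \<psi> x \<partial>lborel) \<longlonglongrightarrow> (\<integral>x. u x * ft \<psi> x \<partial>lborel)"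
  proof (rule integral_dominated_convergence)
    show "integrable lborel (\<lambda>x. norm (u x * ft \<psi> x))"
      by (intro integrable_norm integrable_mult_square_integrable square_integrable_ft u \<psi> \<psi>2) measurable
    show "AE x in lborel. (\<lambda>n. ?u n x * ft \<psi> x) \<longlonglongrightarrow> u x * ft \<psi> x"
    proof (intro AE_I2 tendsto_mult_right tendsto_eventually)
      fix x
      obtain N where "\<bar>x\<bar> \<le> real N"
        using real_arch_simple by blast
      then show "\<forall>\<^sub>F n in sequentially. ?u n x = u x"
        by (intro eventually_sequentiallyI[of N]) (auto simp: indicator_def)
    qed
    show "AE x in lborel. norm (?u n x * ft \<psi> x) \<le> norm (u x * ft \<psi> x)" for n
      by (intro AE_I2) (auto simp: indicator_def)
  qed measurable
  ultimately show ?thesis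
    by (rule LIMSEQ_unique)
qed

section \<open>Weak derivatives of a function given by its transform\<close>

lemma integral_reflect:
  fixes f :: "real \<Rightarrow> 'a::euclidean_space"
  shows "(\<integral>x. f (- x) \<partial>lborel) = (\<integral>x. f x \<partial>lborel)"
  using lborel_integral_real_affine[of "-1" f 0] by simp

lemma integrable_reflect:
  fixes f :: "real \<Rightarrow> 'a::euclidean_space"
  shows "integrable lborel f \<Longrightarrow> integrable lborel (\<lambda>x. f (- x))"
  using lborel_integrable_real_affine[of f "-1" 0] by simp

lemma ft_reflect: "ft (\<lambda>\<xi>. f (- \<xi>)) x = ft f (- x)"
  unfolding ft_def using integral_reflect[of "\<lambda>\<xi>. cis (x * \<xi>) * f \<xi>"] by simp

text \<open>The inverse transform of (i \<open>\<xi>\<close>)^k h, written through \<open>ft\<close>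
  at -x: the candidate for the k-th weak derivative.\<close>

definition fourier_deriv :: "nat \<Rightarrow> (real \<Rightarrow> complex) \<Rightarrow> real \<Rightarrow> complex" where
  "fourier_deriv k h x = ft (\<lambda>\<xi>. (\<i> * of_real \<xi>) ^ k * h \<xi>) (- x) / of_real (2 * pi)"

text \<open>By inversion the k-th derivative of the test function is itself a transform, so duality
  carries the pairing to the frequency side. There the derivative is a factor (i
  \<open>\<xi>\<close>)^k at the reflected argument, which accounts for the sign (-1)^k, and it is
  handed over to h before transforming back.\<close>

theorem weak_derivative_of_inverse_transform:
  fixes u h :: "real \<Rightarrow> complex"
  assumes u_meas: "u \<in> borel_measurable borel" and u: "integrable lborel (\<lambda>x. (norm (u x))\<^sup>2)"
    and h_meas: "h \<in> borel_measurable borel" and h: "integrable lborel (\<lambda>\<xi>. (norm (h \<xi>))\<^sup>2)"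
    and lim: "((\<lambda>R. \<integral>\<^sup>+\<xi>. ennreal ((norm (h \<xi> - ft (\<lambda>x. indicator {-R..R} x *\<^sub>R u x) \<xi>))\<^sup>2) \<partial>lborel) \<longlongrightarrow> 0) at_top"
    and hk: "integrable lborel (\<lambda>\<xi>. (\<i> * of_real \<xi>) ^ k * h \<xi>)" and \<phi>: "test_function \<phi>"
  shows "(\<integral>x. (deriv ^^ k) \<phi> x *\<^sub>R u x \<partial>lborel) = (-1) ^ k *\<^sub>R (\<integral>x. \<phi> x *\<^sub>R fourier_deriv k h x \<partial>lborel)"
proof -
  let ?\<kappa> = "(deriv ^^ k) \<phi>" and ?g = "\<lambda>\<xi>. (\<i> * of_real \<xi>) ^ k * h \<xi>"
  let ?F = "ft (\<lambda>x. of_real (?\<kappa> x))" and ?f = "ft (\<lambda>x. of_real (\<phi> x))"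
  have tf: "test_function ?\<kappa>" by (rule test_function_higher_deriv[OF \<phi>])
  define \<psi> where "\<psi> = (\<lambda>\<xi>. ?F (- \<xi>) / of_real (2 * pi))"
  have F: "integrable lborel ?F" by (rule integrable_ft_test_function[OF tf])
  have \<psi>: "integrable lborel \<psi>"
    unfolding \<psi>_def by (intro integrable_divide integrable_reflect F)
  have "norm (\<psi> \<xi>) \<le> (\<integral>x. norm (complex_of_real (?\<kappa> x)) \<partial>lborel) / (2 * pi)" for \<xi>
    unfolding \<psi>_def using norm_ft_le[OF integrable_test_function[OF tf], of "- \<xi>"]
    by (simp add: norm_divide norm_mult divide_right_mono)
  then have \<psi>2: "integrable lborel (\<lambda>\<xi>. (norm (\<psi> \<xi>))\<^sup>2)"
    by (rule integrable_square_if_bounded[OF \<psi>])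
  have "ft \<psi> x = of_real (?\<kappa> x)" for x
  proof -
    have "ft \<psi> x = ft (\<lambda>\<xi>. ?F (- \<xi>)) x / of_real (2 * pi)"
      unfolding ft_def[of \<psi>] ft_def[of "\<lambda>\<xi>. ?F (- \<xi>)"] by (simp add: \<psi>_def)
    also have "\<dots> = of_real (?\<kappa> x)"
      unfolding ft_reflect ft_inversion[OF tf] by simp
    finally show ?thesis .
  qed
  then have "(\<integral>x. ?\<kappa> x *\<^sub>R u x \<partial>lborel) = (\<integral>x. u x * ft \<psi> x \<partial>lborel)"
    by (simp add: scaleR_conv_of_real mult.commute)
  also have "\<dots> = (\<integral>\<xi>. h \<xi> * \<psi> \<xi> \<partial>lborel)"
    by (rule fourier_L2_duality[OF u_meas u h_meas h lim \<psi> \<psi>2, symmetric])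
  also have "\<dots> = (\<integral>\<xi>. (-1) ^ k / of_real (2 * pi) * (?g \<xi> * ?f (- \<xi>)) \<partial>lborel)"
    by (intro Bochner_Integration.integral_cong refl)
      (simp add: \<psi>_def ft_higher_deriv[OF \<phi>] power_minus[of "\<i> * _"])
  also have "\<dots> = (-1) ^ k / of_real (2 * pi) * (\<integral>\<xi>. ?g \<xi> * ?f (- \<xi>) \<partial>lborel)"
    by (rule integral_mult_right_zero)
  also have "(\<integral>\<xi>. ?g \<xi> * ?f (- \<xi>) \<partial>lborel) = (\<integral>\<xi>. ?f \<xi> * ?g (- \<xi>) \<partial>lborel)"
    using integral_reflect[of "\<lambda>\<xi>. ?g \<xi> * ?f (- \<xi>)"] by (simp add: mult.commute)
  also have "\<dots> = (\<integral>x. of_real (\<phi> x) * ft (\<lambda>\<xi>. ?g (- \<xi>)) x \<partial>lborel)"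
    by (rule ft_multiplication_formula[OF integrable_test_function[OF \<phi>] integrable_reflect[OF hk]])
  also have "(\<lambda>x. of_real (\<phi> x) * ft (\<lambda>\<xi>. ?g (- \<xi>)) x) = (\<lambda>x. of_real (2 * pi) * (\<phi> x *\<^sub>R fourier_deriv k h x))"
  proof
    fix x
    have "ft (\<lambda>\<xi>. ?g (- \<xi>)) x = ft ?g (- x)"
      by (rule ft_reflect[of ?g])
    then show "of_real (\<phi> x) * ft (\<lambda>\<xi>. ?g (- \<xi>)) x = of_real (2 * pi) * (\<phi> x *\<^sub>R fourier_deriv k h x)"
      by (simp add: fourier_deriv_def scaleR_conv_of_real)
  qed
  also have "(-1) ^ k / of_real (2 * pi) * (\<integral>x. of_real (2 * pi) * (\<phi> x *\<^sub>R fourier_deriv k h x) \<partial>lborel)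
      = (-1) ^ k *\<^sub>R (\<integral>x. \<phi> x *\<^sub>R fourier_deriv k h x \<partial>lborel)"
    by (simp add: scaleR_conv_of_real)
  finally show ?thesis .
qed

lemma fourier_deriv_bounds:
  assumes h1: "integrable lborel (\<lambda>\<xi>. (\<i> * of_real \<xi>) ^ k * h \<xi>)"
    and h2: "integrable lborel (\<lambda>\<xi>. (\<bar>\<xi>\<bar> ^ k * norm (h \<xi>))\<^sup>2)"
  shows "fourier_deriv k h \<in> borel_measurable borel"
    and "integrable lborel (\<lambda>x. (norm (fourier_deriv k h x))\<^sup>2)"
    and "(\<integral>x. (norm (fourier_deriv k h x))\<^sup>2 \<partial>lborel) \<le> (\<integral>\<xi>. (\<bar>\<xi>\<bar> ^ k * norm (h \<xi>))\<^sup>2 \<partial>lborel) / (2 * pi)"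
    and "norm (fourier_deriv k h x) \<le> (\<integral>\<xi>. norm ((\<i> * of_real \<xi>) ^ k * h \<xi>) \<partial>lborel) / (2 * pi)"
proof -
  let ?g = "\<lambda>\<xi>. (\<i> * of_real \<xi>) ^ k * h \<xi>"
  have [measurable]: "?g \<in> borel_measurable borel" using h1 by auto
  have g2: "integrable lborel (\<lambda>\<xi>. (norm (?g \<xi>))\<^sup>2)"
    using h2 by (simp add: norm_mult norm_power)
  note F = square_integrable_ft[OF h1 g2]
  have eq: "(norm (fourier_deriv k h x))\<^sup>2 = (norm (ft ?g (- x)))\<^sup>2 / (2 * pi)\<^sup>2" for x
    by (simp add: fourier_deriv_def norm_divide norm_mult power_divide power_mult_distrib)
  show "fourier_deriv k h \<in> borel_measurable borel"
    unfolding fourier_deriv_def[abs_def] by measurable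
  show "integrable lborel (\<lambda>x. (norm (fourier_deriv k h x))\<^sup>2)"
    unfolding eq by (intro integrable_divide integrable_reflect[OF F(1)])
  have "(\<integral>x. (norm (fourier_deriv k h x))\<^sup>2 \<partial>lborel) = (\<integral>x. (norm (ft ?g x))\<^sup>2 \<partial>lborel) / (2 * pi)\<^sup>2"
    unfolding eq using integral_reflect[of "\<lambda>x. (norm (ft ?g x))\<^sup>2"] by simp
  also have "\<dots> \<le> (2 * pi * (\<integral>\<xi>. (norm (?g \<xi>))\<^sup>2 \<partial>lborel)) / (2 * pi)\<^sup>2"
    using F(2) by (intro divide_right_mono) auto
  also have "\<dots> = (\<integral>\<xi>. (\<bar>\<xi>\<bar> ^ k * norm (h \<xi>))\<^sup>2 \<partial>lborel) / (2 * pi)"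
    by (simp add: norm_mult norm_power power2_eq_square)
  finally show "(\<integral>x. (norm (fourier_deriv k h x))\<^sup>2 \<partial>lborel) \<le> (\<integral>\<xi>. (\<bar>\<xi>\<bar> ^ k * norm (h \<xi>))\<^sup>2 \<partial>lborel) / (2 * pi)" .
  show "norm (fourier_deriv k h x) \<le> (\<integral>\<xi>. norm (?g \<xi>) \<partial>lborel) / (2 * pi)"
    using norm_ft_le[OF h1, of "- x"] by (simp add: fourier_deriv_def norm_divide norm_mult divide_right_mono)
qed

section \<open>Weighted Plancherel inequality for weak derivatives\<close>

lemma smooth_measurable: "smooth f \<Longrightarrow> f \<in> borel_measurable borel"
  by (intro borel_measurable_continuous_onI) (simp add: continuous_on_eq_continuous_at smooth_isCont)

text \<open>The function p is cut off by \<open>\<kappa>\<close>(s x) and s tends to 0.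
  Integrability of f dominates the left side, because the derivatives of the products are bounded
  uniformly in s; integrability of p g dominates the right side.\<close>

lemma weak_derivative_bsmooth:
  fixes f g :: "real \<Rightarrow> complex"
  assumes weak: "\<And>\<phi>. test_function \<phi> \<Longrightarrow>
      (\<integral>x. (deriv ^^ m) \<phi> x *\<^sub>R f x \<partial>lborel) = (-1) ^ m *\<^sub>R (\<integral>x. \<phi> x *\<^sub>R g x \<partial>lborel)"
    and f: "integrable lborel f" and g_meas: "g \<in> borel_measurable borel"
    and p: "bsmooth p" and pg: "integrable lborel (\<lambda>x. p x *\<^sub>R g x)"
  shows "(\<integral>x. (deriv ^^ m) p x *\<^sub>R f x \<partial>lborel) = (-1) ^ m *\<^sub>R (\<integral>x. p x *\<^sub>R g x \<partial>lborel)"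
proof -
  define \<kappa> where "\<kappa> = bump 1 (-1) 1"
  have tk: "test_function \<kappa>" unfolding \<kappa>_def by (rule test_function_bump) simp
  have bk: "bsmooth \<kappa>" by (rule bsmooth_test_function[OF tk])
  \<comment> \<open>The cutoff is not normalised; its value exp(-2) at 0 appears on both sides of
    the limit and is cancelled at the end.\<close>
  have k0: "\<kappa> 0 \<noteq> 0" by (simp add: \<kappa>_def bump_def cut_eq)
  have sm: "smooth \<kappa>" "smooth p" using bk p by (auto simp: bsmooth_def)
  have [measurable]: "f \<in> borel_measurable borel" using f by auto
  note [measurable] = g_meas smooth_measurable[OF sm(1)] smooth_measurable[OF sm(2)]
  define s where "s = (\<lambda>n. inverse (real (Suc n)))"
  have s: "0 < s n" "s n \<le> 1" for n by (auto simp: s_def inverse_le_1_iff)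
  have s': "0 \<le> s n \<and> s n \<le> 1" for n using s[of n] by simp
  have s_lim: "s \<longlonglongrightarrow> 0" unfolding s_def by (rule LIMSEQ_inverse_real_of_nat)
  define \<phi> where "\<phi> = (\<lambda>n x. \<kappa> (s n * x) * p x)"
  have sm\<phi>: "smooth (\<phi> n)" for n
    unfolding \<phi>_def by (intro smooth_mult smooth_dilation sm)
  have t\<phi>: "test_function (\<phi> n)" for n
    unfolding test_function_iff_smooth
  proof (intro conjI exI allI impI sm\<phi>)
    fix x assume "\<bar>x\<bar> > 1 / s n"
    then have "\<bar>s n * x\<bar> > 1"
      using s[of n] by (simp add: abs_mult field_simps)
    then have "s n * x \<notin> {-1<..<1}" by auto
    then show "\<phi> n x = 0"
      by (simp add: \<phi>_def \<kappa>_def bump_support)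
  qed
  obtain B where B: "\<And>s x. 0 \<le> s \<Longrightarrow> s \<le> 1 \<Longrightarrow> \<bar>(deriv ^^ m) (\<lambda>x. \<kappa> (s * x) * p x) x\<bar> \<le> B"
    using higher_deriv_dilated_cutoff(1)[OF bk p] by blast
  note [measurable] = smooth_measurable[OF smooth_higher_deriv[OF sm\<phi>]] smooth_measurable[OF smooth_higher_deriv[OF sm(2)]]
  have "(\<lambda>n. \<integral>x. (deriv ^^ m) (\<phi> n) x *\<^sub>R f x \<partial>lborel) \<longlonglongrightarrow> (\<integral>x. (\<kappa> 0 * (deriv ^^ m) p x) *\<^sub>R f x \<partial>lborel)"
  proof (rule integral_dominated_convergence)
    show "integrable lborel (\<lambda>x. B * norm (f x))" using f by simp
    show "AE x in lborel. (\<lambda>n. (deriv ^^ m) (\<phi> n) x *\<^sub>R f x) \<longlonglongrightarrow> (\<kappa> 0 * (deriv ^^ m) p x) *\<^sub>R f x"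
      unfolding \<phi>_def by (intro AE_I2 tendsto_scaleR tendsto_const higher_deriv_dilated_cutoff(2) bk p s_lim s')
    show "AE x in lborel. norm ((deriv ^^ m) (\<phi> n) x *\<^sub>R f x) \<le> B * norm (f x)" for n
      using B[of "s n"] s' by (intro AE_I2) (simp add: \<phi>_def mult_right_mono)
  qed measurable
  moreover have "(\<lambda>n. (-1) ^ m *\<^sub>R (\<integral>x. \<phi> n x *\<^sub>R g x \<partial>lborel)) \<longlonglongrightarrow> (-1) ^ m *\<^sub>R (\<integral>x. (\<kappa> 0 * p x) *\<^sub>R g x \<partial>lborel)"
  proof (intro tendsto_scaleR tendsto_const, rule integral_dominated_convergence)
    show "integrable lborel (\<lambda>x. norm (p x *\<^sub>R g x))" using pg by (rule integrable_norm)
    show "(\<lambda>x. \<phi> n x *\<^sub>R g x) \<in> borel_measurable lborel" for n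
      unfolding \<phi>_def by measurable
    show "AE x in lborel. (\<lambda>n. \<phi> n x *\<^sub>R g x) \<longlonglongrightarrow> (\<kappa> 0 * p x) *\<^sub>R g x"
      using higher_deriv_dilated_cutoff(2)[OF bk p, of s 0] s_lim s'
      by (intro AE_I2 tendsto_scaleR tendsto_const) (simp add: \<phi>_def)
    show "AE x in lborel. norm (\<phi> n x *\<^sub>R g x) \<le> norm (p x *\<^sub>R g x)" for n
    proof (rule AE_I2)
      fix x
      have "\<bar>\<kappa> (s n * x)\<bar> \<le> 1"
        using bump_bounds[of 1 "-1" 1 "s n * x"] by (simp add: \<kappa>_def)
      then show "norm (\<phi> n x *\<^sub>R g x) \<le> norm (p x *\<^sub>R g x)"
        by (simp add: \<phi>_def abs_mult mult.assoc mult_left_le_one_le)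
    qed
  qed measurable
  ultimately have "(\<integral>x. (\<kappa> 0 * (deriv ^^ m) p x) *\<^sub>R f x \<partial>lborel) = (-1) ^ m *\<^sub>R (\<integral>x. (\<kappa> 0 * p x) *\<^sub>R g x \<partial>lborel)"
    unfolding weak[OF t\<phi>] by (rule LIMSEQ_unique)
  then have "\<kappa> 0 *\<^sub>R (\<integral>x. (deriv ^^ m) p x *\<^sub>R f x \<partial>lborel) = \<kappa> 0 *\<^sub>R ((-1) ^ m *\<^sub>R (\<integral>x. p x *\<^sub>R g x \<partial>lborel))"
    by (simp only: scaleR_scaleR[symmetric] integral_scaleR_right scaleR_left_commute)
  then show ?thesis
    using k0 unfolding scaleR_cancel_left by blast
qed

context
  fixes f :: "real \<Rightarrow> complex" and m :: nat and R :: real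
  assumes f: "integrable lborel f" and R: "0 < R"
begin

text \<open>The conjugate of \<open>\<xi>\<close>^m \<open>ft f\<close>, truncated to [-R, R] so
  that all moments are finite. The factor (-i \<open>\<xi>\<close>)^k makes
  \<open>ft (window k)\<close> the k-th derivative of \<open>ft (window 0)\<close>.\<close>

definition window :: "nat \<Rightarrow> real \<Rightarrow> complex" where
  "window k \<xi> = (- (\<i> * of_real \<xi>)) ^ k * (indicator {-R..R} \<xi> * (of_real (\<xi> ^ m) * cnj (ft f \<xi>)))"

lemma integrable_window: "integrable lborel (window k)"
proof (rule Bochner_Integration.integrable_bound)
  let ?N = "\<integral>x. norm (f x) \<partial>lborel"
  have [measurable]: "f \<in> borel_measurable borel" using f by auto
  show "integrable lborel (\<lambda>\<xi>. (R ^ k * (R ^ m * ?N)) * indicator {-R..R} \<xi> :: real)"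
    by (intro integrable_mult_right integrable_real_indicator) (auto simp: emeasure_lborel_Icc_eq)
  show "window k \<in> borel_measurable lborel"
    unfolding window_def[abs_def] by measurable
  show "AE \<xi> in lborel. norm (window k \<xi>) \<le> norm ((R ^ k * (R ^ m * ?N)) * indicator {-R..R} \<xi> :: real)"
  proof (rule AE_I2)
    fix \<xi>
    have "\<bar>\<xi>\<bar> ^ k * (\<bar>\<xi>\<bar> ^ m * norm (ft f \<xi>)) \<le> R ^ k * (R ^ m * ?N)" if "\<bar>\<xi>\<bar> \<le> R"
      using that norm_ft_le[OF f, of \<xi>] R by (intro mult_mono power_mono) auto
    then show "norm (window k \<xi>) \<le> norm ((R ^ k * (R ^ m * ?N)) * indicator {-R..R} \<xi> :: real)"
      using R by (auto simp: window_def norm_mult norm_power indicator_def power_abs abs_mult)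
  qed
qed

lemma window_Suc: "window (Suc k) \<xi> = - (\<i> * of_real \<xi>) * window k \<xi>"
  by (simp add: window_def)

lemma Re_ft_window_DERIV:
  "((\<lambda>x. Re (c * ft (window k) x)) has_field_derivative Re (c * ft (window (Suc k)) x)) (at x)"
proof -
  have "(\<lambda>\<xi>. of_real \<xi> * window k \<xi>) = (\<lambda>\<xi>. \<i> * window (Suc k) \<xi>)"
    by (simp add: window_Suc fun_eq_iff mult.assoc[symmetric])
  then have "integrable lborel (\<lambda>\<xi>. of_real \<xi> * window k \<xi>)"
    using integrable_window by (simp add: integrable_mult_right)
  from Re_ft_DERIV[OF integrable_window this] show ?thesis
    by (simp only: window_Suc[abs_def])
qed

lemma higher_deriv_Re_ft_window: "(deriv ^^ n) (\<lambda>x. Re (c * ft (window 0) x)) = (\<lambda>x. Re (c * ft (window n) x))"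
proof (induction n)
  case (Suc n)
  then show ?case
    by (simp only: funpow.simps comp_apply) (intro ext DERIV_imp_deriv Re_ft_window_DERIV)
qed simp

lemma bsmooth_Re_ft_window: "bsmooth (\<lambda>x. Re (c * ft (window 0) x))"
  unfolding bsmooth_def
proof (intro conjI allI)
  show "smooth (\<lambda>x. Re (c * ft (window 0) x))"
  proof (rule smooth_coinduct)
    let ?S = "range (\<lambda>n x. Re (c * ft (window n) x))"
    show "(\<lambda>x. Re (c * ft (window 0) x)) \<in> ?S" by blast
    fix q assume "q \<in> ?S"
    then obtain n where "q = (\<lambda>x. Re (c * ft (window n) x))" by blast
    then show "\<exists>q'\<in>?S. \<forall>x. (q has_field_derivative q' x) (at x)"
      using Re_ft_window_DERIV[of c n] by (intro bexI[of _ "\<lambda>x. Re (c * ft (window (Suc n)) x)"]) auto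
  qed
  show "\<exists>B. \<forall>x. \<bar>(deriv ^^ n) (\<lambda>x. Re (c * ft (window 0) x)) x\<bar> \<le> B" for n
  proof (intro exI allI)
    fix x
    have "\<bar>Re (c * ft (window n) x)\<bar> \<le> norm (c * ft (window n) x)"
      by (rule abs_Re_le_cmod)
    also have "\<dots> \<le> norm c * (\<integral>\<xi>. norm (window n \<xi>) \<partial>lborel)"
      unfolding norm_mult by (intro mult_left_mono norm_ft_le integrable_window) simp
    finally show "\<bar>(deriv ^^ n) (\<lambda>x. Re (c * ft (window 0) x)) x\<bar> \<le> norm c * (\<integral>\<xi>. norm (window n \<xi>) \<partial>lborel)"
      unfolding higher_deriv_Re_ft_window .
  qed
qed


text \<open>Let I be the truncated weighted integral. Pairing f with the m-th derivative of
  \<open>ft (window 0)\<close> gives (-i)^m I by the multiplication formula, and (-1)^m times the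
  pairing of \<open>ft (window 0)\<close> with g by the weak derivative. Plancherel's inequality
  bounds \<open>ft (window 0)\<close> by I again, and the truncation makes I finite, so it can be
  absorbed.\<close>

lemma window_weighted_bound:
  assumes weak: "\<And>\<phi>. test_function \<phi> \<Longrightarrow>
      (\<integral>x. (deriv ^^ m) \<phi> x *\<^sub>R f x \<partial>lborel) = (-1) ^ m *\<^sub>R (\<integral>x. \<phi> x *\<^sub>R g x \<partial>lborel)"
    and g_meas: "g \<in> borel_measurable borel" and g: "integrable lborel (\<lambda>x. (norm (g x))\<^sup>2)"
  shows "(\<integral>\<^sup>+\<xi>. ennreal (indicator {-R..R} \<xi> * (\<bar>\<xi>\<bar> ^ m * norm (ft f \<xi>))\<^sup>2) \<partial>lborel) \<le> ennreal (2 * pi * (\<integral>x. (norm (g x))\<^sup>2 \<partial>lborel))"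
proof -
  have [measurable]: "f \<in> borel_measurable borel" using f by auto
  note [measurable] = g_meas
  let ?W = "\<lambda>n. ft (window n)" and ?i = "\<lambda>\<xi>. indicator {-R..R} \<xi> * (\<bar>\<xi>\<bar> ^ m * norm (ft f \<xi>))\<^sup>2"
  define I where "I = (\<integral>\<xi>. ?i \<xi> \<partial>lborel)"
  let ?G = "\<integral>x. (norm (g x))\<^sup>2 \<partial>lborel"
  have w_meas: "window n \<in> borel_measurable borel" for n
    using integrable_window[of n] by auto
  note [measurable] = w_meas
  have w0: "(norm (window 0 \<xi>))\<^sup>2 = ?i \<xi>" for \<xi>
    by (simp add: window_def norm_mult norm_power power_abs indicator_def)
  have "norm (window 0 \<xi>) \<le> R ^ m * (\<integral>x. norm (f x) \<partial>lborel)" for \<xi>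
  proof -
    have "\<bar>\<xi>\<bar> ^ m * norm (ft f \<xi>) \<le> R ^ m * (\<integral>x. norm (f x) \<partial>lborel)" if "\<bar>\<xi>\<bar> \<le> R"
      using that norm_ft_le[OF f, of \<xi>] R by (intro mult_mono power_mono) auto
    then show ?thesis
      using R by (auto simp: window_def norm_mult norm_power indicator_def power_abs)
  qed
  then have w2: "integrable lborel (\<lambda>\<xi>. (norm (window 0 \<xi>))\<^sup>2)"
    by (rule integrable_square_if_bounded[OF integrable_window])
  then have i_int: "integrable lborel ?i"
    unfolding w0 .
  note W2 = square_integrable_ft[OF integrable_window[of 0] w2]
  have W_meas: "?W n \<in> borel_measurable borel" for n by measurable
  \<comment> \<open>The weak derivative is tested with the real functions Re(c W); c = 1 and c = -i
    are recombined below into the complex identity.\<close>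
  have part: "(\<integral>x. of_real (Re (c * ?W m x)) * f x \<partial>lborel) = (-1) ^ m * (\<integral>x. of_real (Re (c * ?W 0 x)) * g x \<partial>lborel)
      \<and> integrable lborel (\<lambda>x. of_real (Re (c * ?W m x)) * f x) \<and> integrable lborel (\<lambda>x. of_real (Re (c * ?W 0 x)) * g x)" for c
  proof -
    let ?p = "\<lambda>x. Re (c * ?W 0 x)"
    have p_meas: "(\<lambda>x. complex_of_real (?p x)) \<in> borel_measurable borel" by measurable
    have p2: "integrable lborel (\<lambda>x. (norm (complex_of_real (?p x)))\<^sup>2)"
    proof (rule Bochner_Integration.integrable_bound)
      show "integrable lborel (\<lambda>x. (norm c)\<^sup>2 * (norm (?W 0 x))\<^sup>2)" using W2(1) by simp
      show "AE x in lborel. norm ((norm (complex_of_real (?p x)))\<^sup>2) \<le> norm ((norm c)\<^sup>2 * (norm (?W 0 x))\<^sup>2)"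
      proof (rule AE_I2)
        fix x
        have "\<bar>?p x\<bar>\<^sup>2 \<le> (norm (c * ?W 0 x))\<^sup>2"
          by (intro power_mono abs_Re_le_cmod) simp
        then have "(norm (complex_of_real (?p x)))\<^sup>2 \<le> (norm c)\<^sup>2 * (norm (?W 0 x))\<^sup>2"
          by (simp only: norm_of_real norm_mult power_mult_distrib)
        then show "norm ((norm (complex_of_real (?p x)))\<^sup>2) \<le> norm ((norm c)\<^sup>2 * (norm (?W 0 x))\<^sup>2)"
          by (simp only: real_norm_def abs_of_nonneg[OF zero_le_power2] abs_mult abs_power2)
      qed
    qed measurable
    have pg: "integrable lborel (\<lambda>x. complex_of_real (?p x) * g x)"
      by (rule integrable_mult_square_integrable(1)[OF p_meas g_meas p2 g])
    have pg': "integrable lborel (\<lambda>x. ?p x *\<^sub>R g x)"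
      using pg by (simp only: scaleR_conv_of_real)
    have bs: "bsmooth ?p" by (rule bsmooth_Re_ft_window)
    obtain B where B: "\<And>x. \<bar>(deriv ^^ m) ?p x\<bar> \<le> B"
      using bs unfolding bsmooth_def by blast
    have "integrable lborel (\<lambda>x. of_real (Re (c * ?W m x)) * f x)"
    proof (rule integrable_bounded_mult[OF f])
      show "norm (complex_of_real (Re (c * ?W m x))) \<le> B" for x
        using B[of x] unfolding higher_deriv_Re_ft_window norm_of_real .
    qed measurable
    moreover have "(\<integral>x. Re (c * ?W m x) *\<^sub>R f x \<partial>lborel) = (-1) ^ m *\<^sub>R (\<integral>x. ?p x *\<^sub>R g x \<partial>lborel)"
      using weak_derivative_bsmooth[OF weak f g_meas bs pg'] unfolding higher_deriv_Re_ft_window .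
    then have "(\<integral>x. of_real (Re (c * ?W m x)) * f x \<partial>lborel) = (-1) ^ m * (\<integral>x. of_real (?p x) * g x \<partial>lborel)"
      by (simp only: scaleR_conv_of_real of_real_power of_real_minus of_real_1)
    ultimately show ?thesis
      using pg by blast
  qed
  have split: "z = of_real (Re (1 * z)) + \<i> * of_real (Re (- \<i> * z))" for z
    by (simp add: complex_eq_iff)
  have comb: "(\<integral>x. ?W n x * k x \<partial>lborel) = (\<integral>x. of_real (Re (1 * ?W n x)) * k x \<partial>lborel) + \<i> * (\<integral>x. of_real (Re (- \<i> * ?W n x)) * k x \<partial>lborel)"
    if "integrable lborel (\<lambda>x. of_real (Re (1 * ?W n x)) * k x)" "integrable lborel (\<lambda>x. of_real (Re (- \<i> * ?W n x)) * k x)" for n k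
  proof -
    have "(\<integral>x. ?W n x * k x \<partial>lborel) = (\<integral>x. of_real (Re (1 * ?W n x)) * k x + \<i> * (of_real (Re (- \<i> * ?W n x)) * k x) \<partial>lborel)"
    proof (rule Bochner_Integration.integral_cong[OF refl])
      fix x
      show "?W n x * k x = of_real (Re (1 * ?W n x)) * k x + \<i> * (of_real (Re (- \<i> * ?W n x)) * k x)"
        by (subst split[of "?W n x"]) (simp only: distrib_right mult.assoc)
    qed
    also have "\<dots> = (\<integral>x. of_real (Re (1 * ?W n x)) * k x \<partial>lborel) + (\<integral>x. \<i> * (of_real (Re (- \<i> * ?W n x)) * k x) \<partial>lborel)"
      by (intro Bochner_Integration.integral_add integrable_mult_right that)
    finally show ?thesis
      by (simp only: integral_mult_right_zero)
  qed
  have "(\<integral>x. ?W m x * f x \<partial>lborel) = (-1) ^ m * (\<integral>x. ?W 0 x * g x \<partial>lborel)"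
    using part[of 1] part[of "- \<i>"] comb[of m f] comb[of 0 g]
    by (simp only: distrib_left mult.left_commute)
  moreover have "(\<integral>x. ?W m x * f x \<partial>lborel) = (- \<i>) ^ m * of_real I"
  proof -
    have "(\<integral>x. ?W m x * f x \<partial>lborel) = (\<integral>\<xi>. window m \<xi> * ft f \<xi> \<partial>lborel)"
      by (rule ft_multiplication_formula[OF integrable_window f])
    also have "\<dots> = (\<integral>\<xi>. (- \<i>) ^ m * of_real (?i \<xi>) \<partial>lborel)"
    proof (rule Bochner_Integration.integral_cong[OF refl])
      fix \<xi>
      have "window m \<xi> * ft f \<xi> = (- \<i>) ^ m * (of_real (indicator {-R..R} \<xi>) * ((of_real \<xi> ^ m * of_real \<xi> ^ m) * (ft f \<xi> * cnj (ft f \<xi>))))"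
        by (simp add: window_def power_mult_distrib[of "- \<i>", simplified] indicator_def mult_ac)
      also have "ft f \<xi> * cnj (ft f \<xi>) = of_real ((norm (ft f \<xi>))\<^sup>2)"
        by (rule complex_norm_square[symmetric])
      also have "complex_of_real \<xi> ^ m * of_real \<xi> ^ m = of_real ((\<bar>\<xi>\<bar> ^ m)\<^sup>2)"
        by (simp add: power2_eq_square power_mult_distrib[symmetric] flip: of_real_mult of_real_power)
      finally show "window m \<xi> * ft f \<xi> = (- \<i>) ^ m * of_real (?i \<xi>)"
        by (simp only: of_real_mult[symmetric] power_mult_distrib)
    qed
    also have "\<dots> = (- \<i>) ^ m * of_real I"
      by (simp only: integral_mult_right_zero integral_complex_of_real I_def)
    finally show ?thesis .
  qed
  ultimately have eq: "(- \<i>) ^ m * of_real I = (-1) ^ m * (\<integral>x. ?W 0 x * g x \<partial>lborel)" by simp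
  have "I \<le> norm (\<integral>x. ?W 0 x * g x \<partial>lborel)"
    using arg_cong[OF eq, of norm] by (simp add: norm_mult norm_power)
  \<comment> \<open>The parameter s = 4 pi turns the Plancherel factor 2 pi into 1/2, so half of I
    moves to the left.\<close>
  also have "\<dots> \<le> (\<integral>x. (norm (?W 0 x))\<^sup>2 \<partial>lborel) / (4 * pi) + 4 * pi * ?G / 4"
    by (rule integrable_mult_square_integrable(2)[OF W_meas g_meas W2(1) g]) simp
  also have "\<dots> \<le> 2 * pi * I / (4 * pi) + 4 * pi * ?G / 4"
    using W2(2) unfolding w0 I_def by (intro add_right_mono divide_right_mono) auto
  finally have "I \<le> 2 * pi * ?G"
    by simp
  moreover have "(\<integral>\<^sup>+\<xi>. ennreal (?i \<xi>) \<partial>lborel) = ennreal I"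
    unfolding I_def by (rule nn_integral_eq_integral[OF i_int]) simp
  ultimately show ?thesis
    by (simp add: ennreal_leI)
qed

end

text \<open>The truncated bound is independent of R, so Fatou's lemma removes the truncation and
  yields integrability as well.\<close>

theorem weighted_plancherel_weak_deriv:
  fixes f g :: "real \<Rightarrow> complex"
  assumes f: "integrable lborel f"
    and weak: "\<And>\<phi>. test_function \<phi> \<Longrightarrow>
      (\<integral>x. (deriv ^^ m) \<phi> x *\<^sub>R f x \<partial>lborel) = (-1) ^ m *\<^sub>R (\<integral>x. \<phi> x *\<^sub>R g x \<partial>lborel)"
    and g_meas: "g \<in> borel_measurable borel" and g: "integrable lborel (\<lambda>x. (norm (g x))\<^sup>2)"
  shows "integrable lborel (\<lambda>\<xi>. (\<bar>\<xi>\<bar> ^ m * norm (ft f \<xi>))\<^sup>2)"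
    and "(\<integral>\<xi>. (\<bar>\<xi>\<bar> ^ m * norm (ft f \<xi>))\<^sup>2 \<partial>lborel) \<le> 2 * pi * (\<integral>x. (norm (g x))\<^sup>2 \<partial>lborel)"
proof -
  have [measurable]: "f \<in> borel_measurable borel" using f by auto
  let ?h = "\<lambda>\<xi>. (\<bar>\<xi>\<bar> ^ m * norm (ft f \<xi>))\<^sup>2" and ?G = "2 * pi * (\<integral>x. (norm (g x))\<^sup>2 \<partial>lborel)"
  let ?i = "\<lambda>n \<xi>. ennreal (indicator {- real (Suc n)..real (Suc n)} \<xi> * ?h \<xi>)"
  have G: "0 \<le> ?G" by simp
  have "liminf (\<lambda>n. ?i n \<xi>) = ennreal (?h \<xi>)" for \<xi>
  proof (intro lim_imp_Liminf tendsto_eventually)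
    obtain N where "\<bar>\<xi>\<bar> \<le> real N"
      using real_arch_simple by blast
    then show "\<forall>\<^sub>F n in sequentially. ?i n \<xi> = ennreal (?h \<xi>)"
      by (intro eventually_sequentiallyI[of N]) (auto simp: indicator_def)
  qed simp
  then have "(\<integral>\<^sup>+\<xi>. ennreal (?h \<xi>) \<partial>lborel) = (\<integral>\<^sup>+\<xi>. liminf (\<lambda>n. ?i n \<xi>) \<partial>lborel)"
    by simp
  also have "\<dots> \<le> liminf (\<lambda>n. \<integral>\<^sup>+\<xi>. ?i n \<xi> \<partial>lborel)"
    by (rule nn_integral_liminf) measurable
  also have "\<dots> \<le> liminf (\<lambda>n. ennreal ?G)"
    by (intro Liminf_mono always_eventually allI window_weighted_bound[OF f _ weak g_meas g]) simp_all
  also have "\<dots> = ennreal ?G"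
    by (rule Liminf_const) simp
  finally have le: "(\<integral>\<^sup>+\<xi>. ennreal (?h \<xi>) \<partial>lborel) \<le> ennreal ?G" .
  then have "(\<integral>\<^sup>+\<xi>. ennreal (norm (?h \<xi>)) \<partial>lborel) < \<infinity>"
    by (simp add: le_less_trans[OF _ ennreal_less_top])
  then show int: "integrable lborel ?h"
    by (intro integrableI_bounded) measurable
  have "ennreal (\<integral>\<xi>. ?h \<xi> \<partial>lborel) \<le> ennreal ?G"
    using le nn_integral_eq_integral[OF int] by simp
  then show "(\<integral>\<xi>. ?h \<xi> \<partial>lborel) \<le> ?G"
    using G by (simp add: ennreal_le_iff)
qed

section \<open>Decay of the solution\<close>

lemma power_div_fact_le_exp:
  fixes x :: real
  assumes "0 \<le> x"
  shows "x ^ n / fact n \<le> exp x"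
proof -
  have "(\<Sum>k\<in>{n}. x ^ k /\<^sub>R fact k) \<le> (\<Sum>k. x ^ k /\<^sub>R fact k)"
    using assms by (intro sum_le_suminf sums_summable[OF exp_converges]) auto
  then show ?thesis
    using sums_unique[OF exp_converges[of x]] by (simp add: divide_inverse mult.commute)
qed

lemma exp_decay_dominates_powr:
  fixes c q :: real
  assumes "0 < c"
  shows "\<exists>S>0. \<forall>s\<ge>0. (1 + s) powr q * exp (- c * s) \<le> S"
proof -
  define M where "M = nat \<lceil>q\<rceil>"
  have M: "q \<le> real M" unfolding M_def by linarith
  have "(1 + s) powr q * exp (- c * s) \<le> fact M * exp c / c ^ M" if s: "0 \<le> s" for s
  proof -
    have "c ^ M * (1 + s) ^ M / fact M \<le> exp (c * (1 + s))"
      unfolding power_mult_distrib[symmetric] using assms s by (intro power_div_fact_le_exp) simp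
    then have "c ^ M * (1 + s) ^ M \<le> fact M * exp (c * (1 + s))"
      by (simp only: pos_divide_le_eq[OF fact_gt_zero] mult.commute[of _ "fact M"])
    then have "(1 + s) ^ M \<le> fact M * exp (c * (1 + s)) / c ^ M"
      by (simp only: pos_le_divide_eq[OF zero_less_power[OF assms]] mult.commute[of _ "c ^ M"])
    moreover have "(1 + s) powr q \<le> (1 + s) ^ M"
    proof -
      have "(1 + s) powr q \<le> (1 + s) powr real M"
        using M s by (intro powr_mono) auto
      then show ?thesis using s by (simp add: powr_realpow)
    qed
    ultimately have "(1 + s) powr q * exp (- c * s) \<le> fact M * exp (c * (1 + s)) / c ^ M * exp (- c * s)"
      by (intro mult_right_mono) auto
    also have "exp (c * (1 + s)) = exp c * exp (c * s)"
      by (simp add: distrib_left exp_add)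
    also have "fact M * (exp c * exp (c * s)) / c ^ M * exp (- c * s) = fact M * exp c / c ^ M"
      by (simp add: exp_minus field_simps)
    finally show ?thesis .
  qed
  moreover have "0 < fact M * exp c / c ^ M" using assms by simp
  ultimately show ?thesis by blast
qed

text \<open>With b = 1 / r^q <= 1 one has b (1 + t) <= 1 + b t, and any power of 1 + b t is beaten
  by exp(-c b t). The exponent 2l/q is the one for which b^(-2l/q) = r^(2l), that is, l derivatives
  in the squared norm.\<close>

lemma high_frequency_decay:
  fixes c :: real
  assumes "0 < c" "0 < q"
  shows "\<exists>S>0. \<forall>r\<ge>1. \<forall>t\<ge>0. exp (- c * (1 / r ^ q) * t) \<le> S * r ^ (2 * l) * ((1 + t) powr (- real l / real q))\<^sup>2"
proof -
  let ?m = "2 * real l / real q"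
  obtain S where S: "S > 0" "\<And>s. s \<ge> 0 \<Longrightarrow> (1 + s) powr ?m * exp (- c * s) \<le> S"
    using exp_decay_dominates_powr[OF assms(1), of ?m] by blast
  have "exp (- c * (1 / r ^ q) * t) \<le> S * r ^ (2 * l) * ((1 + t) powr (- real l / real q))\<^sup>2"
    if r: "1 \<le> r" and t: "0 \<le> t" for r t
  proof -
    define b where "b = 1 / r ^ q"
    have b: "0 < b" "b \<le> 1" using r by (auto simp: b_def)
    have b_powr: "b powr ?m = 1 / r ^ (2 * l)"
    proof -
      have "b = r powr (- real q)"
        using r by (simp add: b_def powr_minus powr_realpow divide_inverse)
      then have "b powr ?m = r powr (- real (2 * l))"
        using assms(2) by (simp add: powr_powr)
      also have "\<dots> = 1 / r ^ (2 * l)"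
        using r by (simp add: powr_minus powr_realpow divide_inverse del: of_nat_mult)
      finally show ?thesis .
    qed
    have sq: "((1 + t) powr (- real l / real q))\<^sup>2 = 1 / (1 + t) powr ?m"
      using t by (simp add: power2_eq_square powr_add[symmetric] powr_minus_divide[symmetric])
    have "(b * (1 + t)) powr ?m * exp (- c * (b * t)) \<le> (1 + b * t) powr ?m * exp (- c * (b * t))"
      using b t by (intro mult_right_mono powr_mono2) (auto simp: algebra_simps)
    also have "\<dots> \<le> S"
      using b t by (intro S(2)) auto
    finally have "b powr ?m * (1 + t) powr ?m * exp (- c * (b * t)) \<le> S"
      using b t by (simp add: powr_mult)
    then have "exp (- c * (b * t)) \<le> S * r ^ (2 * l) * (1 / (1 + t) powr ?m)"
      using r t unfolding b_powr by (simp add: field_simps)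
    then show ?thesis
      unfolding sq b_def by (simp add: mult.assoc)
  qed
  with S(1) show ?thesis by blast
qed

text \<open>Substituting a^(1/p) \<open>\<xi>\<close> for the variable extracts the power of a; I is
  the value at a = 1.\<close>

lemma low_frequency_integral:
  fixes c :: real
  assumes c: "0 < c" and p: "2 \<le> p"
  shows "\<exists>I\<ge>0. \<forall>a>0. integrable lborel (\<lambda>\<xi>. \<bar>\<xi>\<bar> ^ (2 * j) * exp (- c * \<bar>\<xi>\<bar> ^ p * a))
    \<and> (\<integral>\<xi>. \<bar>\<xi>\<bar> ^ (2 * j) * exp (- c * \<bar>\<xi>\<bar> ^ p * a) \<partial>lborel) = I * a powr (- (2 * real j + 1) / real p)"
proof -
  let ?f = "\<lambda>x::real. \<bar>x\<bar> ^ (2 * j) * exp (- c * \<bar>x\<bar> ^ p)"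
  obtain S where S: "\<And>s. s \<ge> 0 \<Longrightarrow> (1 + s) powr (real j + 1) * exp (- c * s) \<le> S"
    using exp_decay_dominates_powr[OF c, of "real j + 1"] by blast
  have int: "integrable lborel ?f"
  proof (rule Bochner_Integration.integrable_bound)
    show "integrable lborel (\<lambda>x. exp c * S * inverse (1 + x\<^sup>2))"
      using integrable_inverse_1_plus_square by (simp add: set_integrable_def)
    show "AE x in lborel. norm (?f x) \<le> norm (exp c * S * inverse (1 + x\<^sup>2))"
    proof (rule AE_I2)
      fix x :: real
      have x0: "0 < 1 + x\<^sup>2" by (simp add: add_pos_nonneg)
      \<comment> \<open>Comparison with a Gaussian, at the cost of a factor exp c; it makes one
        majorant serve all p >= 2.\<close>
      have "x\<^sup>2 - 1 \<le> \<bar>x\<bar> ^ p"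
      proof (cases "\<bar>x\<bar> \<le> 1")
        case True
        then have "x\<^sup>2 \<le> 1" by (simp add: abs_square_le_1)
        moreover have "0 \<le> \<bar>x\<bar> ^ p" by simp
        ultimately show ?thesis by linarith
      next
        case False
        then have "\<bar>x\<bar> ^ 2 \<le> \<bar>x\<bar> ^ p" using p by (intro power_increasing) auto
        then show ?thesis by simp
      qed
      then have "c * (x\<^sup>2 - 1) \<le> c * \<bar>x\<bar> ^ p" using c by simp
      then have "exp (- c * \<bar>x\<bar> ^ p) \<le> exp (c + - c * x\<^sup>2)"
        by (simp add: algebra_simps)
      also have "\<dots> = exp c * exp (- c * x\<^sup>2)" by (rule exp_add)
      finally have 1: "exp (- c * \<bar>x\<bar> ^ p) \<le> exp c * exp (- c * x\<^sup>2)" .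
      have "\<bar>x\<bar> ^ (2 * j) = (x\<^sup>2) ^ j" by (simp add: power_mult)
      also have "\<dots> \<le> (1 + x\<^sup>2) ^ j" by (intro power_mono) auto
      finally have 2: "\<bar>x\<bar> ^ (2 * j) \<le> (1 + x\<^sup>2) ^ j" .
      have "(1 + x\<^sup>2) * (\<bar>x\<bar> ^ (2 * j) * exp (- c * \<bar>x\<bar> ^ p)) \<le> (1 + x\<^sup>2) * ((1 + x\<^sup>2) ^ j * (exp c * exp (- c * x\<^sup>2)))"
        using 1 2 x0 by (intro mult_left_mono mult_mono) auto
      also have "\<dots> = exp c * ((1 + x\<^sup>2) powr (real j + 1) * exp (- c * x\<^sup>2))"
        using x0 by (simp add: powr_add powr_realpow mult_ac)
      also have "\<dots> \<le> exp c * S"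
        using S[of "x\<^sup>2"] by (intro mult_left_mono) auto
      finally have "?f x \<le> exp c * S * inverse (1 + x\<^sup>2)"
        using x0 by (simp add: field_simps)
      moreover have "0 \<le> ?f x" by simp
      ultimately show "norm (?f x) \<le> norm (exp c * S * inverse (1 + x\<^sup>2))"
        by (simp only: real_norm_def abs_of_nonneg)
    qed
  qed measurable
  define I where "I = (\<integral>x. ?f x \<partial>lborel)"
  have "integrable lborel (\<lambda>\<xi>. \<bar>\<xi>\<bar> ^ (2 * j) * exp (- c * \<bar>\<xi>\<bar> ^ p * a))
    \<and> (\<integral>\<xi>. \<bar>\<xi>\<bar> ^ (2 * j) * exp (- c * \<bar>\<xi>\<bar> ^ p * a) \<partial>lborel) = I * a powr (- (2 * real j + 1) / real p)" if a: "0 < a" for a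
  proof -
    define b where "b = a powr (1 / real p)"
    have b: "0 < b" using a by (simp add: b_def)
    have bp: "b ^ p = a"
      using a p by (simp add: b_def powr_realpow[symmetric] powr_powr)
    have fb: "?f (0 + b * \<xi>) = b ^ (2 * j) * (\<bar>\<xi>\<bar> ^ (2 * j) * exp (- c * \<bar>\<xi>\<bar> ^ p * a))" for \<xi>
      using b by (simp add: abs_mult power_mult_distrib bp mult_ac)
    have "integrable lborel (\<lambda>\<xi>. ?f (0 + b * \<xi>))"
      using b by (intro lborel_integrable_real_affine int) auto
    then have int': "integrable lborel (\<lambda>\<xi>. \<bar>\<xi>\<bar> ^ (2 * j) * exp (- c * \<bar>\<xi>\<bar> ^ p * a))"
      unfolding fb using b by simp
    have "I = \<bar>b\<bar> *\<^sub>R (\<integral>\<xi>. ?f (0 + b * \<xi>) \<partial>lborel)"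
      unfolding I_def using b by (intro lborel_integral_real_affine) auto
    then have "I = b ^ Suc (2 * j) * (\<integral>\<xi>. \<bar>\<xi>\<bar> ^ (2 * j) * exp (- c * \<bar>\<xi>\<bar> ^ p * a) \<partial>lborel)"
      unfolding fb using b by simp
    moreover have "a powr (- (2 * real j + 1) / real p) = 1 / b ^ Suc (2 * j)"
    proof -
      have "b ^ Suc (2 * j) = b powr (2 * real j + 1)"
        using b by (simp add: powr_realpow[symmetric] powr_add mult.commute)
      also have "\<dots> = a powr ((2 * real j + 1) / real p)"
        by (simp add: b_def powr_powr)
      finally have B: "b ^ Suc (2 * j) = a powr ((2 * real j + 1) / real p)" .
      show ?thesis
        unfolding B by (simp only: minus_divide_left[symmetric] powr_minus_divide)
    qed
    ultimately show ?thesis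
      using int' b by (simp add: field_simps)
  qed
  moreover have "0 \<le> I" by (simp add: I_def)
  ultimately show ?thesis by blast
qed

section \<open>Reduction of vector-valued functions to components\<close>

lemma norm_vec_power2: "(norm (w :: complex ^ 'n))\<^sup>2 = (\<Sum>i\<in>UNIV. (norm (w $ i))\<^sup>2)"
  by (simp add: norm_vec_def L2_set_def sum_nonneg)

lemma norm_vector_scale: "norm (c *s w) = norm c * norm (w :: complex ^ 'n)"
proof -
  have "norm (c *s w) = L2_set (\<lambda>i. norm c * norm (w $ i)) UNIV"
    by (simp add: norm_vec_def norm_mult)
  then show ?thesis
    by (simp add: norm_vec_def L2_set_right_distrib)
qed

lemma borel_measurable_vec_iff:
  fixes f :: "'a \<Rightarrow> complex ^ 'n"
  shows "f \<in> borel_measurable M \<longleftrightarrow> (\<forall>i. (\<lambda>x. f x $ i) \<in> borel_measurable M)"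
proof (intro iffI allI)
  fix i assume f: "f \<in> borel_measurable M"
  show "(\<lambda>x. f x $ i) \<in> borel_measurable M"
    by (rule measurable_compose[OF f borel_measurable_continuous_onI]) (intro continuous_intros)
next
  assume f: "\<forall>i. (\<lambda>x. f x $ i) \<in> borel_measurable M"
  show "f \<in> borel_measurable M"
  proof (rule borel_measurable_euclidean_space[THEN iffD2], intro ballI)
    fix b :: "complex ^ 'n" assume "b \<in> Basis"
    then obtain i e where b: "b = axis i e"
      by (auto simp: Basis_vec_def)
    have "(\<lambda>x. f x $ i) \<in> borel_measurable M" using f by blast
    then show "(\<lambda>x. f x \<bullet> b) \<in> borel_measurable M"
      unfolding b inner_axis by measurable
  qed
qed

lemma square_integrable_nth:
  fixes f :: "real \<Rightarrow> complex ^ 'n"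
  assumes "square_integrable f"
  shows "(\<lambda>x. f x $ i) \<in> borel_measurable borel" "integrable lborel (\<lambda>x. (norm (f x $ i))\<^sup>2)"
proof -
  show m: "(\<lambda>x. f x $ i) \<in> borel_measurable borel"
    using assms borel_measurable_vec_iff[of f lborel] by (simp add: square_integrable_def)
  show "integrable lborel (\<lambda>x. (norm (f x $ i))\<^sup>2)"
  proof (rule Bochner_Integration.integrable_bound)
    show "integrable lborel (\<lambda>x. (norm (f x))\<^sup>2)"
      using assms by (simp add: square_integrable_def)
    show "AE x in lborel. norm ((norm (f x $ i))\<^sup>2) \<le> norm ((norm (f x))\<^sup>2)"
      by (intro AE_I2) (simp add: power_mono Finite_Cartesian_Product.norm_nth_le)
  qed (use m in measurable)
qed

lemma square_integrableI_nth:
  fixes f :: "real \<Rightarrow> complex ^ 'n"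
  assumes "\<And>i. (\<lambda>x. f x $ i) \<in> borel_measurable borel" "\<And>i. integrable lborel (\<lambda>x. (norm (f x $ i))\<^sup>2)"
  shows "square_integrable f" "(L2_norm f)\<^sup>2 = (\<Sum>i\<in>UNIV. \<integral>x. (norm (f x $ i))\<^sup>2 \<partial>lborel)"
proof -
  have "f \<in> borel_measurable lborel"
    using assms(1) borel_measurable_vec_iff[of f lborel] by simp
  then show "square_integrable f"
    using assms(2) by (simp add: square_integrable_def norm_vec_power2)
  show "(L2_norm f)\<^sup>2 = (\<Sum>i\<in>UNIV. \<integral>x. (norm (f x $ i))\<^sup>2 \<partial>lborel)"
    using assms(2) by (simp add: L2_norm_def norm_vec_power2 sum_nonneg)
qed

lemma fourier_L1_nth:
  fixes f :: "real \<Rightarrow> complex ^ 'n"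
  assumes f: "integrable lborel f"
  shows "fourier_L1 f \<xi> $ i = ft (\<lambda>x. f x $ i) \<xi>"
    and "norm (fourier_L1 f \<xi>) \<le> L1_norm f"
proof -
  have "f \<in> borel_measurable borel" using f by auto
  then have [measurable]: "(\<lambda>x. f x $ k) \<in> borel_measurable borel" for k
    using borel_measurable_vec_iff by blast
  have int: "integrable lborel (\<lambda>x. cis (- (\<xi> * x)) *s f x)"
  proof (rule Bochner_Integration.integrable_bound[OF f])
    show "(\<lambda>x. cis (- (\<xi> * x)) *s f x) \<in> borel_measurable lborel"
      unfolding borel_measurable_vec_iff by simp
  qed (simp add: norm_vector_scale)
  have "(\<integral>x. cis (- (\<xi> * x)) *s f x \<partial>lborel) $ i = (\<integral>x. (cis (- (\<xi> * x)) *s f x) $ i \<partial>lborel)"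
    by (rule integral_bounded_linear[OF bounded_linear_vec_nth int, symmetric])
  then show "fourier_L1 f \<xi> $ i = ft (\<lambda>x. f x $ i) \<xi>"
    by (simp add: fourier_L1_def ft_def)
  have "norm (fourier_L1 f \<xi>) \<le> (\<integral>x. norm (cis (- (\<xi> * x)) *s f x) \<partial>lborel)"
    unfolding fourier_L1_def by (rule integral_norm_bound)
  then show "norm (fourier_L1 f \<xi>) \<le> L1_norm f"
    by (simp add: L1_norm_def norm_vector_scale)
qed

lemma has_fourier_L2_nth:
  fixes f h :: "real \<Rightarrow> complex ^ 'n"
  assumes "has_fourier_L2 f h"
  shows "((\<lambda>R. \<integral>\<^sup>+\<xi>. ennreal ((norm (h \<xi> $ i - ft (\<lambda>x. indicator {-R..R} x *\<^sub>R (f x $ i)) \<xi>))\<^sup>2) \<partial>lborel) \<longlongrightarrow> 0) at_top"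
proof (rule tendsto_sandwich[OF always_eventually always_eventually tendsto_const])
  show "((\<lambda>R. \<integral>\<^sup>+\<xi>. ennreal ((norm (h \<xi> - fourier_L1 (\<lambda>x. indicator {-R..R} x *\<^sub>R f x) \<xi>))\<^sup>2) \<partial>lborel) \<longlongrightarrow> 0) at_top"
    using assms by (simp add: has_fourier_L2_def)
  show "\<forall>R. (\<integral>\<^sup>+\<xi>. ennreal ((norm (h \<xi> $ i - ft (\<lambda>x. indicator {-R..R} x *\<^sub>R (f x $ i)) \<xi>))\<^sup>2) \<partial>lborel)
      \<le> (\<integral>\<^sup>+\<xi>. ennreal ((norm (h \<xi> - fourier_L1 (\<lambda>x. indicator {-R..R} x *\<^sub>R f x) \<xi>))\<^sup>2) \<partial>lborel)"
  proof (intro allI nn_integral_mono ennreal_leI power_mono)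
    fix R \<xi>
    have "integrable lborel (\<lambda>x. indicator {-R..R} x *\<^sub>R f x)"
      using assms by (intro square_integrable_imp_integrable_Icc) (simp add: has_fourier_L2_def)
    then have "h \<xi> $ i - ft (\<lambda>x. indicator {-R..R} x *\<^sub>R (f x $ i)) \<xi>
        = (h \<xi> - fourier_L1 (\<lambda>x. indicator {-R..R} x *\<^sub>R f x) \<xi>) $ i"
      by (simp add: fourier_L1_nth(1))
    then show "norm (h \<xi> $ i - ft (\<lambda>x. indicator {-R..R} x *\<^sub>R (f x $ i)) \<xi>)
        \<le> norm (h \<xi> - fourier_L1 (\<lambda>x. indicator {-R..R} x *\<^sub>R f x) \<xi>)"
      by (simp only: Finite_Cartesian_Product.norm_nth_le)
  qed simp
qed simp

lemma weighted_plancherel_vec: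
  fixes f g :: "real \<Rightarrow> complex ^ 'n"
  assumes f: "integrable lborel f" and weak: "has_weak_deriv m f g" and g: "square_integrable g"
  shows "integrable lborel (\<lambda>\<xi>. (\<bar>\<xi>\<bar> ^ m * norm (fourier_L1 f \<xi>))\<^sup>2)"
    and "(\<integral>\<xi>. (\<bar>\<xi>\<bar> ^ m * norm (fourier_L1 f \<xi>))\<^sup>2 \<partial>lborel) \<le> 2 * pi * (L2_norm g)\<^sup>2"
proof -
  have fi: "integrable lborel (\<lambda>x. f x $ i)" for i
    by (rule integrable_bounded_linear[OF bounded_linear_vec_nth f])
  have lf: "locally_integrable f" and lg: "locally_integrable g"
    using weak by (auto simp: has_weak_deriv_def)
  have "(\<integral>x. (deriv ^^ m) \<phi> x *\<^sub>R (f x $ i) \<partial>lborel) = (-1) ^ m *\<^sub>R (\<integral>x. \<phi> x *\<^sub>R (g x $ i) \<partial>lborel)"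
    if \<phi>: "test_function \<phi>" for \<phi> i
  proof -
    have "(\<integral>x. (deriv ^^ m) \<phi> x *\<^sub>R f x \<partial>lborel) $ i = ((-1) ^ m *\<^sub>R (\<integral>x. \<phi> x *\<^sub>R g x \<partial>lborel)) $ i"
      using weak \<phi> by (simp add: has_weak_deriv_def)
    moreover have "(\<integral>x. (deriv ^^ m) \<phi> x *\<^sub>R f x \<partial>lborel) $ i = (\<integral>x. ((deriv ^^ m) \<phi> x *\<^sub>R f x) $ i \<partial>lborel)"
      by (rule integral_bounded_linear[OF bounded_linear_vec_nth
            integrable_test_function_scaleR[OF lf test_function_higher_deriv[OF \<phi>]], symmetric])
    moreover have "(\<integral>x. \<phi> x *\<^sub>R g x \<partial>lborel) $ i = (\<integral>x. (\<phi> x *\<^sub>R g x) $ i \<partial>lborel)"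
      by (rule integral_bounded_linear[OF bounded_linear_vec_nth
            integrable_test_function_scaleR[OF lg \<phi>], symmetric])
    ultimately show ?thesis by simp
  qed
  note wp = weighted_plancherel_weak_deriv[OF fi this square_integrable_nth[OF g]]
  have eq: "(\<bar>\<xi>\<bar> ^ m * norm (fourier_L1 f \<xi>))\<^sup>2 = (\<Sum>i\<in>UNIV. (\<bar>\<xi>\<bar> ^ m * norm (ft (\<lambda>x. f x $ i) \<xi>))\<^sup>2)" for \<xi>
    by (simp add: power_mult_distrib norm_vec_power2 fourier_L1_nth(1)[OF f] sum_distrib_left)
  show "integrable lborel (\<lambda>\<xi>. (\<bar>\<xi>\<bar> ^ m * norm (fourier_L1 f \<xi>))\<^sup>2)"
    unfolding eq by (intro Bochner_Integration.integrable_sum wp(1))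
  have "(\<integral>\<xi>. (\<bar>\<xi>\<bar> ^ m * norm (fourier_L1 f \<xi>))\<^sup>2 \<partial>lborel) = (\<Sum>i\<in>UNIV. \<integral>\<xi>. (\<bar>\<xi>\<bar> ^ m * norm (ft (\<lambda>x. f x $ i) \<xi>))\<^sup>2 \<partial>lborel)"
    unfolding eq by (intro Bochner_Integration.integral_sum wp(1))
  also have "\<dots> \<le> (\<Sum>i\<in>UNIV. 2 * pi * (\<integral>x. (norm (g x $ i))\<^sup>2 \<partial>lborel))"
    by (intro sum_mono wp(2))
  also have "\<dots> = 2 * pi * (L2_norm g)\<^sup>2"
    by (simp add: square_integrableI_nth(2)[OF square_integrable_nth[OF g]] sum_distrib_left)
  finally show "(\<integral>\<xi>. (\<bar>\<xi>\<bar> ^ m * norm (fourier_L1 f \<xi>))\<^sup>2 \<partial>lborel) \<le> 2 * pi * (L2_norm g)\<^sup>2" .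
qed

text \<open>Componentwise, \<open>fourier_deriv\<close> is the weak derivative; the first
  integrability assumption makes it a pointwise integral and the second bounds its L2 norm.\<close>

lemma sobolev_of_fourier:
  fixes f h :: "real \<Rightarrow> complex ^ 'n"
  assumes four: "has_fourier_L2 f h"
    and h1: "integrable lborel (\<lambda>\<xi>. \<bar>\<xi>\<bar> ^ k * norm (h \<xi>))"
    and h2: "integrable lborel (\<lambda>\<xi>. (\<bar>\<xi>\<bar> ^ k * norm (h \<xi>))\<^sup>2)"
  shows "\<exists>g. has_weak_deriv k f g \<and> square_integrable g \<and>
    (L2_norm g)\<^sup>2 \<le> (\<integral>\<xi>. (\<bar>\<xi>\<bar> ^ k * norm (h \<xi>))\<^sup>2 \<partial>lborel) / (2 * pi)"
proof -
  have sf: "square_integrable f" and sh: "square_integrable h"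
    using four by (auto simp: has_fourier_L2_def)
  note fi = square_integrable_nth[OF sf] and hi = square_integrable_nth[OF sh]
  note [measurable] = hi(1)
  define g where "g = (\<lambda>x. \<chi> i. fourier_deriv k (\<lambda>\<xi>. h \<xi> $ i) x)"
  have h1i: "integrable lborel (\<lambda>\<xi>. (\<i> * of_real \<xi>) ^ k * h \<xi> $ i)" for i
  proof (rule Bochner_Integration.integrable_bound[OF h1])
    show "AE \<xi> in lborel. norm ((\<i> * of_real \<xi>) ^ k * h \<xi> $ i) \<le> norm (\<bar>\<xi>\<bar> ^ k * norm (h \<xi>))"
      by (intro AE_I2) (simp add: norm_mult norm_power abs_mult mult_left_mono Finite_Cartesian_Product.norm_nth_le)
  qed measurable
  have h2i: "integrable lborel (\<lambda>\<xi>. (\<bar>\<xi>\<bar> ^ k * norm (h \<xi> $ i))\<^sup>2)" for i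
  proof (rule Bochner_Integration.integrable_bound[OF h2])
    show "AE \<xi> in lborel. norm ((\<bar>\<xi>\<bar> ^ k * norm (h \<xi> $ i))\<^sup>2) \<le> norm ((\<bar>\<xi>\<bar> ^ k * norm (h \<xi>))\<^sup>2)"
      by (intro AE_I2) (simp add: mult_left_mono power_mono Finite_Cartesian_Product.norm_nth_le)
  qed measurable
  note fd = fourier_deriv_bounds[OF h1i h2i]
  have sg: "square_integrable g" and L2g: "(L2_norm g)\<^sup>2 = (\<Sum>i\<in>UNIV. \<integral>x. (norm (g x $ i))\<^sup>2 \<partial>lborel)"
    by (rule square_integrableI_nth; simp add: g_def fd(1,2))+
  have "(L2_norm g)\<^sup>2 \<le> (\<Sum>i\<in>UNIV. (\<integral>\<xi>. (\<bar>\<xi>\<bar> ^ k * norm (h \<xi> $ i))\<^sup>2 \<partial>lborel) / (2 * pi))"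
    unfolding L2g using fd(3) by (intro sum_mono) (simp add: g_def)
  also have "\<dots> = (\<integral>\<xi>. (\<Sum>i\<in>UNIV. (\<bar>\<xi>\<bar> ^ k * norm (h \<xi> $ i))\<^sup>2) \<partial>lborel) / (2 * pi)"
    by (simp only: sum_divide_distrib[symmetric] Bochner_Integration.integral_sum[OF h2i])
  also have "(\<lambda>\<xi>. \<Sum>i\<in>UNIV. (\<bar>\<xi>\<bar> ^ k * norm (h \<xi> $ i))\<^sup>2) = (\<lambda>\<xi>. (\<bar>\<xi>\<bar> ^ k * norm (h \<xi>))\<^sup>2)"
    by (simp add: power_mult_distrib norm_vec_power2 sum_distrib_left)
  finally have L2: "(L2_norm g)\<^sup>2 \<le> (\<integral>\<xi>. (\<bar>\<xi>\<bar> ^ k * norm (h \<xi>))\<^sup>2 \<partial>lborel) / (2 * pi)" .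
  have lf: "locally_integrable f" and lg: "locally_integrable g"
    using sf sg by (auto intro: square_integrable_imp_locally_integrable)
  have "(\<integral>x. (deriv ^^ k) \<phi> x *\<^sub>R f x \<partial>lborel) = (-1) ^ k *\<^sub>R (\<integral>x. \<phi> x *\<^sub>R g x \<partial>lborel)"
    if \<phi>: "test_function \<phi>" for \<phi>
    unfolding vec_eq_iff
  proof
    fix i
    have "(\<integral>x. (deriv ^^ k) \<phi> x *\<^sub>R f x \<partial>lborel) $ i = (\<integral>x. ((deriv ^^ k) \<phi> x *\<^sub>R f x) $ i \<partial>lborel)"
      by (rule integral_bounded_linear[OF bounded_linear_vec_nth
            integrable_test_function_scaleR[OF lf test_function_higher_deriv[OF \<phi>]], symmetric])
    also have "\<dots> = (\<integral>x. (deriv ^^ k) \<phi> x *\<^sub>R (f x $ i) \<partial>lborel)"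
      by simp
    also have "\<dots> = (-1) ^ k *\<^sub>R (\<integral>x. \<phi> x *\<^sub>R fourier_deriv k (\<lambda>\<xi>. h \<xi> $ i) x \<partial>lborel)"
      by (rule weak_derivative_of_inverse_transform[OF fi hi has_fourier_L2_nth[OF four] h1i \<phi>])
    also have "(\<integral>x. \<phi> x *\<^sub>R fourier_deriv k (\<lambda>\<xi>. h \<xi> $ i) x \<partial>lborel) = (\<integral>x. (\<phi> x *\<^sub>R g x) $ i \<partial>lborel)"
      by (simp add: g_def)
    also have "\<dots> = (\<integral>x. \<phi> x *\<^sub>R g x \<partial>lborel) $ i"
      by (rule integral_bounded_linear[OF bounded_linear_vec_nth integrable_test_function_scaleR[OF lg \<phi>]])
    finally show "(\<integral>x. (deriv ^^ k) \<phi> x *\<^sub>R f x \<partial>lborel) $ i = ((-1) ^ k *\<^sub>R (\<integral>x. \<phi> x *\<^sub>R g x \<partial>lborel)) $ i"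
      by simp
  qed
  then have "has_weak_deriv k f g"
    using lf lg by (simp add: has_weak_deriv_def)
  with sg L2 show ?thesis by blast
qed

section \<open>Assembly of the decay estimate\<close>

lemma le_add_of_power2_le:
  fixes x a b :: real
  assumes "x\<^sup>2 \<le> a\<^sup>2 + b\<^sup>2" "0 \<le> a" "0 \<le> b"
  shows "x \<le> a + b"
proof (rule power2_le_imp_le)
  have "0 \<le> 2 * a * b" using assms by simp
  with assms(1) show "x\<^sup>2 \<le> (a + b)\<^sup>2" by (simp add: power2_sum)
qed (use assms in simp)

lemma mult_le_sum_power2:
  fixes a b :: real
  assumes "0 \<le> a" "0 \<le> b"
  shows "a * b \<le> a\<^sup>2 + b\<^sup>2"
proof -
  have "0 \<le> a * b" using assms by simp
  then show ?thesis
    using sum_squares_bound[of a b] by (simp add: mult.assoc)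
qed

lemma split_energy_bound:
  fixes A B C I S L1 L2 w b d :: real
  assumes "A\<^sup>2 = C * d * I / (2 * pi)" "B\<^sup>2 = C * S"
  shows "(C * d * L1\<^sup>2 * (I * w\<^sup>2) + C * S * b\<^sup>2 * (2 * pi * L2\<^sup>2)) / (2 * pi) = (A * w * L1)\<^sup>2 + (B * b * L2)\<^sup>2"
  unfolding power_mult_distrib assms by (simp add: field_simps)

lemma norm_real_mono: "0 \<le> x \<Longrightarrow> x \<le> y \<Longrightarrow> norm x \<le> norm (y :: real)"
  by simp

text \<open>\<open>\<beta> c t\<close> is the decay factor of the high frequencies at the price of \<open>l\<close> derivatives.\<close>

theorem beam_decay:
  fixes U\<^sub>0 :: "real \<Rightarrow> complex ^ 8" and \<beta> :: "real \<Rightarrow> real \<Rightarrow> real"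
  assumes k: "k1 > 0" "k2 > 0" "k3 > 0" "k4 > 0" "k5 > 0" "\<gamma> \<noteq> 0" and e: "e \<in> {0, 1}"
    and l: "1 \<le> l" "j + l \<le> N" and U0: "U\<^sub>0 \<in> sobolev N" "integrable lborel U\<^sub>0"
    and sol: "beam_solution k1 k2 k3 k4 k5 \<gamma> (0, 0, 1) e U\<^sub>0 U"
    and \<beta>_nonneg: "\<And>c t. 0 \<le> \<beta> c t"
    and \<beta>: "\<And>c. 0 < c \<Longrightarrow> \<exists>S>0. \<forall>r>1. \<forall>t\<ge>0.
      exp (- c * gap_rate e (k1 = k2 \<and> k2 = k3) r * t) \<le> S * r ^ (2 * l) * (\<beta> c t)\<^sup>2"
  shows "\<exists>c0>0. \<exists>c>0. \<forall>t\<ge>0. (\<lambda>x. U x t) \<in> sobolev j \<and>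
    L2_norm (weak_deriv j (\<lambda>x. U x t))
      \<le> c0 * (1 + t) powr (- (2 * real j + 1) / (2 * (4 + 2 * real e))) * L1_norm U\<^sub>0
        + c0 * \<beta> c t * L2_norm (weak_deriv (j + l) U\<^sub>0)"
proof -
  let ?A = "beam_matrix k1 k2 k3 k4 k5 \<gamma> (0, 0, 1) e"
  let ?F = "fourier_L1 U\<^sub>0" and ?m = "j + l" and ?p = "4 + 2 * e"
  let ?G = "gap_rate e (k1 = k2 \<and> k2 = k3)"
  obtain C c where C: "C > 0" and c: "c > 0" and semi:
    "\<And>\<xi> t w. t \<ge> 0 \<Longrightarrow> (norm (matrix_exp (t *\<^sub>R ?A \<xi>) *v w))\<^sup>2 \<le> C * exp (- c * ?G \<bar>\<xi>\<bar> * t) * (norm w)\<^sup>2"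
    using beam_semigroup_bound[OF k e] by blast
  obtain S where S: "S > 0" "\<And>r t. r > 1 \<Longrightarrow> t \<ge> 0 \<Longrightarrow> exp (- c * ?G r * t) \<le> S * r ^ (2 * l) * (\<beta> c t)\<^sup>2"
    using \<beta>[OF c] by blast
  obtain I where I: "I \<ge> 0"
    "\<And>a. a > 0 \<Longrightarrow> integrable lborel (\<lambda>\<xi>. \<bar>\<xi>\<bar> ^ (2 * j) * exp (- c * \<bar>\<xi>\<bar> ^ ?p * a))"
    "\<And>a. a > 0 \<Longrightarrow> (\<integral>\<xi>. \<bar>\<xi>\<bar> ^ (2 * j) * exp (- c * \<bar>\<xi>\<bar> ^ ?p * a) \<partial>lborel) = I * a powr (- (2 * real j + 1) / real ?p)"
  proof -
    have "2 \<le> ?p" by simp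
    from low_frequency_integral[OF c this, of j] that show thesis by blast
  qed
  obtain g where g: "has_weak_deriv ?m U\<^sub>0 g" "square_integrable g"
    using U0(1) l(2) by (auto simp: sobolev_def)
  let ?L1 = "L1_norm U\<^sub>0" and ?L2 = "L2_norm (weak_deriv ?m U\<^sub>0)"
  have L2_g: "L2_norm g = ?L2"
    using L2_norm_weak_deriv[OF g(1)] by simp
  have L1: "0 \<le> ?L1" and L2: "0 \<le> ?L2"
    by (simp_all add: L1_norm_def L2_norm_def)
  have F_le: "norm (?F \<xi>) \<le> ?L1" for \<xi>
    by (rule fourier_L1_nth(2)[OF U0(2)])
  let ?X = "\<lambda>\<xi>. \<bar>\<xi>\<bar> ^ ?m * norm (?F \<xi>)"
  note X = weighted_plancherel_vec[OF U0(2) g, unfolded L2_g]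
  have inv: "integrable lborel (\<lambda>\<xi>. b * inverse (1 + \<xi>\<^sup>2))" for b :: real
    using integrable_inverse_1_plus_square by (simp add: set_integrable_def)
  have inv1: "1 \<le> 2 * inverse (1 + \<xi>\<^sup>2)" if "\<bar>\<xi>\<bar> \<le> 1" for \<xi> :: real
  proof -
    have "\<xi>\<^sup>2 \<le> 1" using that by (simp add: abs_square_le_1)
    moreover have "0 < 1 + \<xi>\<^sup>2" by (simp add: add_pos_nonneg)
    ultimately show ?thesis by (simp add: field_simps)
  qed
  \<comment> \<open>Here l >= 1 enters: |\<open>\<xi>\<close>|^(-2l) is integrable at infinity.
    Paired with the square-integrable weighted datum, this makes |\<open>\<xi>\<close>|^j h
    integrable.\<close>
  have inv2: "1 / (\<bar>\<xi>\<bar> ^ l)\<^sup>2 \<le> 2 * inverse (1 + \<xi>\<^sup>2)" if "\<bar>\<xi>\<bar> > 1" for \<xi> :: real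
  proof -
    have "\<bar>\<xi>\<bar> ^ 2 \<le> \<bar>\<xi>\<bar> ^ (l * 2)"
      using that l by (intro power_increasing) auto
    moreover have "1 \<le> \<bar>\<xi>\<bar> ^ 2"
      using that by (intro one_le_power) simp
    ultimately have "1 + \<xi>\<^sup>2 \<le> 2 * (\<bar>\<xi>\<bar> ^ l)\<^sup>2"
      by (simp add: power_mult)
    moreover have "0 < (\<bar>\<xi>\<bar> ^ l)\<^sup>2" "0 < 1 + \<xi>\<^sup>2" using that by (auto simp: add_pos_nonneg)
    ultimately show ?thesis by (simp add: field_simps)
  qed
  \<comment> \<open>Square roots of the low- and high-frequency constants. The 2 pi of the inverse
    transform remains in A, while in B it cancels against the 2 pi from the Plancherel bound of the
    datum.\<close>
  define A B where "A = sqrt (C * exp c * I / (2 * pi))" and "B = sqrt (C * S)"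
  have AB: "0 \<le> A" "0 \<le> B" "A\<^sup>2 = C * exp c * I / (2 * pi)" "B\<^sup>2 = C * S"
    using C S I by (simp_all add: A_def B_def)
  have main: "(\<lambda>x. U x t) \<in> sobolev j \<and> L2_norm (weak_deriv j (\<lambda>x. U x t))
      \<le> A * (1 + t) powr (- (2 * real j + 1) / (2 * (4 + 2 * real e))) * ?L1 + B * \<beta> c t * ?L2" if t: "t \<ge> 0" for t
  proof -
    define h where "h = (\<lambda>\<xi>. matrix_exp (t *\<^sub>R ?A \<xi>) *v ?F \<xi>)"
    have four: "has_fourier_L2 (\<lambda>x. U x t) h"
      unfolding h_def using sol t unfolding beam_solution_def by blast
    have U2: "square_integrable (\<lambda>x. U x t)" and h_sq: "square_integrable h"
      using four unfolding has_fourier_L2_def by blast+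
    have h_meas [measurable]: "h \<in> borel_measurable borel"
      using h_sq by (simp add: square_integrable_def)
    have h_semi: "(norm (h \<xi>))\<^sup>2 \<le> C * exp (- c * ?G \<bar>\<xi>\<bar> * t) * (norm (?F \<xi>))\<^sup>2" for \<xi>
      unfolding h_def by (rule semi[OF t])
    have h_le2: "(norm (h \<xi>))\<^sup>2 \<le> C * (norm (?F \<xi>))\<^sup>2" for \<xi>
    proof -
      have "0 \<le> c * ?G \<bar>\<xi>\<bar> * t"
        using c t gap_rate_nonneg[of "\<bar>\<xi>\<bar>"] by simp
      then have "C * exp (- c * ?G \<bar>\<xi>\<bar> * t) * (norm (?F \<xi>))\<^sup>2 \<le> C * 1 * (norm (?F \<xi>))\<^sup>2"
        using C by (intro mult_right_mono mult_left_mono) auto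
      with h_semi[of \<xi>] show ?thesis by simp
    qed
    have h_le: "norm (h \<xi>) \<le> sqrt C * norm (?F \<xi>)" for \<xi>
      using C real_le_rsqrt[OF h_le2[of \<xi>]] by (simp add: real_sqrt_mult)
    have h1: "integrable lborel (\<lambda>\<xi>. \<bar>\<xi>\<bar> ^ i * norm (h \<xi>))" if i: "i \<le> j" for i
    proof (rule Bochner_Integration.integrable_bound)
      let ?K = "sqrt C * ?L1 * 2 + C * 2"
      show "integrable lborel (\<lambda>\<xi>. ?K * inverse (1 + \<xi>\<^sup>2) + (?X \<xi>)\<^sup>2)"
        by (intro Bochner_Integration.integrable_add inv X(1))
      show "AE \<xi> in lborel. norm (\<bar>\<xi>\<bar> ^ i * norm (h \<xi>)) \<le> norm (?K * inverse (1 + \<xi>\<^sup>2) + (?X \<xi>)\<^sup>2)"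
      proof (rule AE_I2)
        fix \<xi> :: real
        have q: "0 < inverse (1 + \<xi>\<^sup>2)" by (simp add: add_pos_nonneg)
        have "\<bar>\<xi>\<bar> ^ i * norm (h \<xi>) \<le> ?K * inverse (1 + \<xi>\<^sup>2) + (?X \<xi>)\<^sup>2"
        proof (cases "\<bar>\<xi>\<bar> \<le> 1")
          case True
          have "\<bar>\<xi>\<bar> ^ i * norm (h \<xi>) \<le> 1 * (sqrt C * ?L1)"
            using True h_le[of \<xi>] F_le[of \<xi>] C
            by (intro mult_mono power_le_one) (auto intro: order_trans mult_left_mono)
          also have "\<dots> \<le> sqrt C * ?L1 * (2 * inverse (1 + \<xi>\<^sup>2))"
            using mult_left_mono[OF inv1[OF True], of "sqrt C * ?L1"] L1 C by simp
          also have "\<dots> \<le> ?K * inverse (1 + \<xi>\<^sup>2)"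
            using C q by (simp add: algebra_simps)
          finally show ?thesis by (simp add: add_increasing2)
        next
          case False
          then have r: "1 \<le> \<bar>\<xi>\<bar>" by simp
          have "\<bar>\<xi>\<bar> ^ i * norm (h \<xi>) \<le> \<bar>\<xi>\<bar> ^ j * (sqrt C * norm (?F \<xi>))"
            using r i h_le[of \<xi>] by (intro mult_mono power_increasing) auto
          also have "\<dots> = (sqrt C / \<bar>\<xi>\<bar> ^ l) * ?X \<xi>"
          proof -
            have "\<xi> \<noteq> 0" using r by auto
            then show ?thesis by (simp add: power_add)
          qed
          also have "\<dots> \<le> (sqrt C / \<bar>\<xi>\<bar> ^ l)\<^sup>2 + (?X \<xi>)\<^sup>2"
            using C by (intro mult_le_sum_power2) auto
          also have "(sqrt C / \<bar>\<xi>\<bar> ^ l)\<^sup>2 = C * (1 / (\<bar>\<xi>\<bar> ^ l)\<^sup>2)"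
            using C by (simp add: power_divide)
          also have "\<dots> \<le> C * (2 * inverse (1 + \<xi>\<^sup>2))"
            using inv2[of \<xi>] False C by (intro mult_left_mono) auto
          also have "\<dots> \<le> ?K * inverse (1 + \<xi>\<^sup>2)"
          proof -
            have "C * 2 * inverse (1 + \<xi>\<^sup>2) \<le> ?K * inverse (1 + \<xi>\<^sup>2)"
              using C q L1 by (intro mult_right_mono) auto
            then show ?thesis by (simp only: mult.assoc)
          qed
          finally show ?thesis by simp
        qed
        then show "norm (\<bar>\<xi>\<bar> ^ i * norm (h \<xi>)) \<le> norm (?K * inverse (1 + \<xi>\<^sup>2) + (?X \<xi>)\<^sup>2)"
          by (intro norm_real_mono) auto
      qed
    qed measurable
    have h2: "integrable lborel (\<lambda>\<xi>. (\<bar>\<xi>\<bar> ^ i * norm (h \<xi>))\<^sup>2)" if i: "i \<le> j" for i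
    proof (rule Bochner_Integration.integrable_bound)
      let ?K = "C * ?L1\<^sup>2 * 2"
      show "integrable lborel (\<lambda>\<xi>. ?K * inverse (1 + \<xi>\<^sup>2) + C * (?X \<xi>)\<^sup>2)"
        by (intro Bochner_Integration.integrable_add inv integrable_mult_right X(1))
      show "AE \<xi> in lborel. norm ((\<bar>\<xi>\<bar> ^ i * norm (h \<xi>))\<^sup>2) \<le> norm (?K * inverse (1 + \<xi>\<^sup>2) + C * (?X \<xi>)\<^sup>2)"
      proof (rule AE_I2)
        fix \<xi> :: real
        have q: "0 < inverse (1 + \<xi>\<^sup>2)" by (simp add: add_pos_nonneg)
        have nn: "0 \<le> ?K * inverse (1 + \<xi>\<^sup>2)" "0 \<le> C * (?X \<xi>)\<^sup>2"
          using C q by auto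
        have "(\<bar>\<xi>\<bar> ^ i * norm (h \<xi>))\<^sup>2 \<le> ?K * inverse (1 + \<xi>\<^sup>2) + C * (?X \<xi>)\<^sup>2"
        proof (cases "\<bar>\<xi>\<bar> \<le> 1")
          case True
          have "(\<bar>\<xi>\<bar> ^ i)\<^sup>2 * (norm (h \<xi>))\<^sup>2 \<le> 1 * (C * ?L1\<^sup>2)"
          proof (rule mult_mono)
            show "(\<bar>\<xi>\<bar> ^ i)\<^sup>2 \<le> 1"
              using True by (intro power_le_one) auto
            show "(norm (h \<xi>))\<^sup>2 \<le> C * ?L1\<^sup>2"
            proof (rule order_trans[OF h_le2])
              show "C * (norm (?F \<xi>))\<^sup>2 \<le> C * ?L1\<^sup>2"
                using C F_le by (intro mult_left_mono power_mono) auto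
            qed
          qed auto
          also have "\<dots> \<le> C * ?L1\<^sup>2 * (2 * inverse (1 + \<xi>\<^sup>2))"
            using mult_left_mono[OF inv1[OF True], of "C * ?L1\<^sup>2"] C by simp
          finally show ?thesis
            using nn(2) by (simp add: power_mult_distrib)
        next
          case False
          then have r: "1 \<le> \<bar>\<xi>\<bar>" by simp
          have "\<bar>\<xi>\<bar> ^ i * norm (h \<xi>) \<le> \<bar>\<xi>\<bar> ^ ?m * (sqrt C * norm (?F \<xi>))"
            using r i h_le[of \<xi>] by (intro mult_mono power_increasing) auto
          then have "(\<bar>\<xi>\<bar> ^ i * norm (h \<xi>))\<^sup>2 \<le> (\<bar>\<xi>\<bar> ^ ?m * (sqrt C * norm (?F \<xi>)))\<^sup>2"
            by (intro power_mono) auto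
          also have "\<dots> = C * (?X \<xi>)\<^sup>2"
            using C by (simp add: power_mult_distrib)
          finally show ?thesis using nn(1) by linarith
        qed
        then show "norm ((\<bar>\<xi>\<bar> ^ i * norm (h \<xi>))\<^sup>2) \<le> norm (?K * inverse (1 + \<xi>\<^sup>2) + C * (?X \<xi>)\<^sup>2)"
          by (intro norm_real_mono) auto
      qed
    qed measurable
    have "\<exists>v. has_weak_deriv i (\<lambda>x. U x t) v \<and> square_integrable v" if "i \<le> j" for i
      using sobolev_of_fourier[OF four h1[OF that] h2[OF that]] by (elim exE conjE) (intro exI conjI)
    then have "(\<lambda>x. U x t) \<in> sobolev j"
      unfolding sobolev_def using U2 by simp
    moreover have "L2_norm (weak_deriv j (\<lambda>x. U x t))
      \<le> A * (1 + t) powr (- (2 * real j + 1) / (2 * (4 + 2 * real e))) * ?L1 + B * \<beta> c t * ?L2"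
    proof -
      \<comment> \<open>With 1 + t in place of t the integral is finite at t = 0 too; as
        |\<open>\<xi>\<close>| <= 1 at low frequencies, the shift costs only the factor exp c found
        in A.\<close>
      let ?low = "\<lambda>\<xi>. \<bar>\<xi>\<bar> ^ (2 * j) * exp (- c * \<bar>\<xi>\<bar> ^ ?p * (1 + t))"
      have t1: "0 < 1 + t" using t by simp
      obtain v where v: "has_weak_deriv j (\<lambda>x. U x t) v"
        "(L2_norm v)\<^sup>2 \<le> (\<integral>\<xi>. (\<bar>\<xi>\<bar> ^ j * norm (h \<xi>))\<^sup>2 \<partial>lborel) / (2 * pi)"
        using sobolev_of_fourier[OF four h1[OF order_refl] h2[OF order_refl]] that by (elim exE conjE)
      have "(\<bar>\<xi>\<bar> ^ j * norm (h \<xi>))\<^sup>2 \<le> C * exp c * ?L1\<^sup>2 * ?low \<xi> + C * S * (\<beta> c t)\<^sup>2 * (?X \<xi>)\<^sup>2" for \<xi>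
      proof (cases "\<bar>\<xi>\<bar> \<le> 1")
        case True
        have "c * \<bar>\<xi>\<bar> ^ ?p \<le> c * 1"
          using c True by (intro mult_left_mono power_le_one) auto
        then have "exp (- c * ?G \<bar>\<xi>\<bar> * t) \<le> exp (c + - c * \<bar>\<xi>\<bar> ^ ?p * (1 + t))"
          using True by (simp add: gap_rate_def algebra_simps)
        also have "\<dots> = exp c * exp (- c * \<bar>\<xi>\<bar> ^ ?p * (1 + t))"
          by (rule exp_add)
        finally have E: "exp (- c * ?G \<bar>\<xi>\<bar> * t) \<le> exp c * exp (- c * \<bar>\<xi>\<bar> ^ ?p * (1 + t))" .
        have "(\<bar>\<xi>\<bar> ^ j * norm (h \<xi>))\<^sup>2 = \<bar>\<xi>\<bar> ^ (2 * j) * (norm (h \<xi>))\<^sup>2"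
          by (simp add: power_mult_distrib power_mult[symmetric] mult.commute)
        also have "\<dots> \<le> \<bar>\<xi>\<bar> ^ (2 * j) * (C * exp (- c * ?G \<bar>\<xi>\<bar> * t) * (norm (?F \<xi>))\<^sup>2)"
          by (intro mult_left_mono h_semi) simp
        also have "\<dots> \<le> \<bar>\<xi>\<bar> ^ (2 * j) * (C * (exp c * exp (- c * \<bar>\<xi>\<bar> ^ ?p * (1 + t))) * ?L1\<^sup>2)"
          using C E F_le by (intro mult_left_mono mult_mono power_mono) auto
        also have "\<dots> = C * exp c * ?L1\<^sup>2 * ?low \<xi>"
          by (simp only: mult_ac)
        finally show ?thesis
          using C S by (simp add: add_increasing2)
      next
        case False
        have "(\<bar>\<xi>\<bar> ^ j * norm (h \<xi>))\<^sup>2 = \<bar>\<xi>\<bar> ^ (2 * j) * (norm (h \<xi>))\<^sup>2"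
          by (simp add: power_mult_distrib power_mult[symmetric] mult.commute)
        also have "\<dots> \<le> \<bar>\<xi>\<bar> ^ (2 * j) * (C * exp (- c * ?G \<bar>\<xi>\<bar> * t) * (norm (?F \<xi>))\<^sup>2)"
          by (intro mult_left_mono h_semi) simp
        also have "\<dots> \<le> \<bar>\<xi>\<bar> ^ (2 * j) * (C * (S * \<bar>\<xi>\<bar> ^ (2 * l) * (\<beta> c t)\<^sup>2) * (norm (?F \<xi>))\<^sup>2)"
          using C S(2)[of "\<bar>\<xi>\<bar>" t] False t by (intro mult_left_mono mult_right_mono) auto
        also have "\<dots> = C * S * (\<beta> c t)\<^sup>2 * (?X \<xi>)\<^sup>2"
          by (simp add: power_mult_distrib power_mult[symmetric] power_add mult_ac)
        finally show ?thesis
          using C by (simp add: add_increasing)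
      qed
      then have "(\<integral>\<xi>. (\<bar>\<xi>\<bar> ^ j * norm (h \<xi>))\<^sup>2 \<partial>lborel)
          \<le> (\<integral>\<xi>. C * exp c * ?L1\<^sup>2 * ?low \<xi> + C * S * (\<beta> c t)\<^sup>2 * (?X \<xi>)\<^sup>2 \<partial>lborel)"
        by (intro integral_mono h2 order_refl Bochner_Integration.integrable_add integrable_mult_right X(1) I(2) t1)
      also have "\<dots> = C * exp c * ?L1\<^sup>2 * (\<integral>\<xi>. ?low \<xi> \<partial>lborel) + C * S * (\<beta> c t)\<^sup>2 * (\<integral>\<xi>. (?X \<xi>)\<^sup>2 \<partial>lborel)"
      proof (subst Bochner_Integration.integral_add)
        show "integrable lborel (\<lambda>\<xi>. C * exp c * ?L1\<^sup>2 * ?low \<xi>)"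
          by (rule integrable_mult_right) (rule I(2)[OF t1])
        show "integrable lborel (\<lambda>\<xi>. C * S * (\<beta> c t)\<^sup>2 * (?X \<xi>)\<^sup>2)"
          by (rule integrable_mult_right) (rule X(1))
      qed (simp only: integral_mult_right_zero)
      also have "\<dots> \<le> C * exp c * ?L1\<^sup>2 * (I * (1 + t) powr (- (2 * real j + 1) / real ?p)) + C * S * (\<beta> c t)\<^sup>2 * (2 * pi * ?L2\<^sup>2)"
        unfolding I(3)[OF t1] using C S X(2) by (intro add_left_mono mult_left_mono) auto
      finally have bound: "(\<integral>\<xi>. (\<bar>\<xi>\<bar> ^ j * norm (h \<xi>))\<^sup>2 \<partial>lborel)
          \<le> C * exp c * ?L1\<^sup>2 * (I * (1 + t) powr (- (2 * real j + 1) / real ?p)) + C * S * (\<beta> c t)\<^sup>2 * (2 * pi * ?L2\<^sup>2)" .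
      let ?w = "(1 + t) powr (- (2 * real j + 1) / (2 * (4 + 2 * real e)))"
      have w: "?w\<^sup>2 = (1 + t) powr (- (2 * real j + 1) / real ?p)"
      proof -
        have "?w\<^sup>2 = (1 + t) powr (- (2 * real j + 1) / (2 * (4 + 2 * real e)) + - (2 * real j + 1) / (2 * (4 + 2 * real e)))"
          by (simp only: power2_eq_square powr_add)
        also have "- (2 * real j + 1) / (2 * (4 + 2 * real e)) + - (2 * real j + 1) / (2 * (4 + 2 * real e)) = - (2 * real j + 1) / real ?p"
        proof -
          have "x / (2 * y) + x / (2 * y) = x / y" for x y :: real
            by (cases "y = 0") (simp_all add: field_simps)
          from this[of "- (2 * real j + 1)" "4 + 2 * real e"] show ?thesis
            by (simp only: of_nat_add of_nat_mult of_nat_numeral)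
        qed
        finally show ?thesis .
      qed
      have "(L2_norm v)\<^sup>2 \<le> (C * exp c * ?L1\<^sup>2 * (I * ?w\<^sup>2) + C * S * (\<beta> c t)\<^sup>2 * (2 * pi * ?L2\<^sup>2)) / (2 * pi)"
        unfolding w by (rule order_trans[OF v(2) divide_right_mono[OF bound]]) simp
      also have "\<dots> = (A * ?w * ?L1)\<^sup>2 + (B * \<beta> c t * ?L2)\<^sup>2"
        by (rule split_energy_bound[OF AB(3,4)])
      finally have "L2_norm v \<le> A * ?w * ?L1 + B * \<beta> c t * ?L2"
        by (rule le_add_of_power2_le) (intro mult_nonneg_nonneg AB L1 L2 \<beta>_nonneg powr_ge_zero)+
      then show ?thesis
        unfolding L2_norm_weak_deriv[OF v(1)] .
    qed
    ultimately show ?thesis ..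
  qed
  define c0 where "c0 = A + B + 1"
  have "L2_norm (weak_deriv j (\<lambda>x. U x t))
      \<le> c0 * (1 + t) powr (- (2 * real j + 1) / (2 * (4 + 2 * real e))) * ?L1 + c0 * \<beta> c t * ?L2" if "t \<ge> 0" for t
  proof -
    have "A * (1 + t) powr (- (2 * real j + 1) / (2 * (4 + 2 * real e))) * ?L1
        \<le> c0 * (1 + t) powr (- (2 * real j + 1) / (2 * (4 + 2 * real e))) * ?L1"
      using AB L1 by (intro mult_right_mono) (auto simp: c0_def)
    moreover have "B * \<beta> c t * ?L2 \<le> c0 * \<beta> c t * ?L2"
      using AB L2 \<beta>_nonneg by (intro mult_right_mono) (auto simp: c0_def)
    ultimately show ?thesis
      using main[OF that] by linarith
  qed
  moreover have "0 < c0" using AB by (simp add: c0_def)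
  ultimately show ?thesis
    using main[THEN conjunct1] c by (intro exI[of _ c0] conjI exI[of _ c] allI impI) assumption+
qed

theorem theorem4p7:
  fixes k\<^sub>1 k\<^sub>2 k\<^sub>3 k\<^sub>4 k\<^sub>5 \<gamma> \<tau>\<^sub>1 \<tau>\<^sub>2 \<tau>\<^sub>3 :: real and \<epsilon>\<^sub>0 N l j :: nat
    and U\<^sub>0 :: "real \<Rightarrow> complex ^ 8" and U :: "real \<Rightarrow> real \<Rightarrow> complex ^ 8"
  assumes "k\<^sub>1 > 0" "k\<^sub>2 > 0" "k\<^sub>3 > 0" "k\<^sub>4 > 0" "k\<^sub>5 > 0" "\<gamma> \<noteq> 0"
    and "(\<tau>\<^sub>1, \<tau>\<^sub>2, \<tau>\<^sub>3) = (0, 0, 1)"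
    and "\<epsilon>\<^sub>0 \<in> {0, 1}"
    and "N \<ge> 1" "l \<ge> 1" "l \<le> N"
    and "U\<^sub>0 \<in> sobolev N" "integrable lborel U\<^sub>0"
    and "beam_solution k\<^sub>1 k\<^sub>2 k\<^sub>3 k\<^sub>4 k\<^sub>5 \<gamma> (\<tau>\<^sub>1, \<tau>\<^sub>2, \<tau>\<^sub>3) \<epsilon>\<^sub>0 U\<^sub>0 U"
    and "j \<in> {0..N - l}"
  shows "\<exists>c\<^sub>0 > 0. \<exists>c\<^sub>1 > 0. \<forall>t\<ge>0.
    (\<lambda>x. U x t) \<in> sobolev j \<and>
    (\<epsilon>\<^sub>0 = 1 \<longrightarrow>
      (k\<^sub>1 = k\<^sub>2 \<and> k\<^sub>2 = k\<^sub>3 \<longrightarrow>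
        L2_norm (weak_deriv j (\<lambda>x. U x t))
          \<le> c\<^sub>0 * (1 + t) powr (- 1/12 - real j / 6) * L1_norm U\<^sub>0
            + c\<^sub>0 * exp (- c\<^sub>1 * t) * L2_norm (weak_deriv (j + l) U\<^sub>0)) \<and>
      (\<not> (k\<^sub>1 = k\<^sub>2 \<and> k\<^sub>2 = k\<^sub>3) \<longrightarrow>
        L2_norm (weak_deriv j (\<lambda>x. U x t))
          \<le> c\<^sub>0 * (1 + t) powr (- 1/12 - real j / 6) * L1_norm U\<^sub>0
            + c\<^sub>0 * (1 + t) powr (- real l / 4) * L2_norm (weak_deriv (j + l) U\<^sub>0))) \<and>
    (\<epsilon>\<^sub>0 = 0 \<longrightarrow>
      (k\<^sub>1 = k\<^sub>2 \<and> k\<^sub>2 = k\<^sub>3 \<longrightarrow>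
        L2_norm (weak_deriv j (\<lambda>x. U x t))
          \<le> c\<^sub>0 * (1 + t) powr (- 1/8 - real j / 4) * L1_norm U\<^sub>0
            + c\<^sub>0 * (1 + t) powr (- real l / 2) * L2_norm (weak_deriv (j + l) U\<^sub>0)) \<and>
      (\<not> (k\<^sub>1 = k\<^sub>2 \<and> k\<^sub>2 = k\<^sub>3) \<longrightarrow>
        L2_norm (weak_deriv j (\<lambda>x. U x t))
          \<le> c\<^sub>0 * (1 + t) powr (- 1/8 - real j / 4) * L1_norm U\<^sub>0
            + c\<^sub>0 * (1 + t) powr (- real l / 4) * L2_norm (weak_deriv (j + l) U\<^sub>0)))"
proof -
  note k = assms(1-6) and e = assms(8)
  have \<tau>: "\<tau>\<^sub>1 = 0" "\<tau>\<^sub>2 = 0" "\<tau>\<^sub>3 = 1"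
    using assms(7) by simp_all
  have jl: "j + l \<le> N"
    using \<open>j \<in> {0..N - l}\<close> \<open>l \<le> N\<close> by auto
  have sol: "beam_solution k\<^sub>1 k\<^sub>2 k\<^sub>3 k\<^sub>4 k\<^sub>5 \<gamma> (0, 0, 1) \<epsilon>\<^sub>0 U\<^sub>0 U"
    using assms(14) unfolding \<tau> .
  note decay = beam_decay[OF k e \<open>1 \<le> l\<close> jl assms(12,13) sol]
  let ?eq = "k\<^sub>1 = k\<^sub>2 \<and> k\<^sub>2 = k\<^sub>3"
  let ?D = "\<lambda>t. L2_norm (weak_deriv j (\<lambda>x. U x t))" and ?L1 = "L1_norm U\<^sub>0" and ?L2 = "L2_norm (weak_deriv (j + l) U\<^sub>0)"
  have w0: "- (2 * real j + 1) / (2 * (4 + 2 * real 0)) = - 1/8 - real j / 4"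
    and w1: "- (2 * real j + 1) / (2 * (4 + 2 * real 1)) = - 1/12 - real j / 6"
    by (simp_all add: field_simps)
  \<comment> \<open>Three of the four cases have an algebraic gap r^(-q) at high frequencies: q = 2
    for equal speeds with \<open>\<epsilon>\<^sub>0\<close> = 0, and q = 4 for different
    speeds.\<close>
  have algebraic: "\<exists>c0>0. \<forall>t\<ge>0. (\<lambda>x. U x t) \<in> sobolev j \<and>
      ?D t \<le> c0 * (1 + t) powr (- (2 * real j + 1) / (2 * (4 + 2 * real \<epsilon>\<^sub>0))) * ?L1
        + c0 * (1 + t) powr (- real l / real q) * ?L2"
    if gap: "\<And>r. r > 1 \<Longrightarrow> gap_rate \<epsilon>\<^sub>0 ?eq r = 1 / r ^ q" and q: "0 < q" for q
  proof -
    have high: "\<exists>S>0. \<forall>r>1. \<forall>t\<ge>0. exp (- c * gap_rate \<epsilon>\<^sub>0 ?eq r * t)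
        \<le> S * r ^ (2 * l) * ((1 + t) powr (- real l / real q))\<^sup>2" if "0 < c" for c
    proof -
      from that obtain S where "S > 0" "\<And>r t. r \<ge> 1 \<Longrightarrow> t \<ge> 0 \<Longrightarrow>
        exp (- c * (1 / r ^ q) * t) \<le> S * r ^ (2 * l) * ((1 + t) powr (- real l / real q))\<^sup>2"
      using high_frequency_decay[OF _ q, of c l] by blast
    then show ?thesis
      using gap by (intro exI[of _ S]) auto
    qed
    show ?thesis
      using decay[of "\<lambda>c t. (1 + t) powr (- real l / real q)", OF powr_ge_zero] high by blast
  qed
  consider (exponential) "\<epsilon>\<^sub>0 = 1" "?eq" | (neq1) "\<epsilon>\<^sub>0 = 1" "\<not> ?eq" | (eq0) "\<epsilon>\<^sub>0 = 0" "?eq" | (neq0) "\<epsilon>\<^sub>0 = 0" "\<not> ?eq"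
    using e by blast
  then show ?thesis
  proof cases
    case exponential
    have "\<exists>c0>0. \<exists>c>0. \<forall>t\<ge>0. (\<lambda>x. U x t) \<in> sobolev j \<and>
      ?D t \<le> c0 * (1 + t) powr (- (2 * real j + 1) / (2 * (4 + 2 * real \<epsilon>\<^sub>0))) * ?L1
        + c0 * exp (- (c / 2) * t) * ?L2"
    \<comment> \<open>The gap is constant for r > 1. The decay factor enters the estimate squared,
      hence half of the rate c; since r^(2l) >= 1, S = 1 suffices.\<close>
    proof (rule decay[of "\<lambda>c t. exp (- (c / 2) * t)"])
      fix c :: real
      have "exp (- c * gap_rate \<epsilon>\<^sub>0 ?eq r * t) \<le> 1 * r ^ (2 * l) * (exp (- (c / 2) * t))\<^sup>2" if r: "1 < r" for r t
      proof -
        have "gap_rate \<epsilon>\<^sub>0 ?eq r = 1"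
          using exponential r by (simp add: gap_rate_def)
        moreover have "(exp (- (c / 2) * t))\<^sup>2 = exp (- c * t)"
          by (simp add: power2_eq_square exp_add[symmetric])
        moreover have "1 * exp (- c * t) \<le> r ^ (2 * l) * exp (- c * t)"
          using r by (intro mult_right_mono one_le_power) auto
        ultimately show ?thesis by simp
      qed
      then show "\<exists>S>0. \<forall>r>1. \<forall>t\<ge>0. exp (- c * gap_rate \<epsilon>\<^sub>0 ?eq r * t) \<le> S * r ^ (2 * l) * (exp (- (c / 2) * t))\<^sup>2"
        by (intro exI[of _ 1]) auto
    qed simp
    then obtain c0 c where c: "c0 > 0" "c > 0" and *: "\<And>t. t \<ge> 0 \<Longrightarrow> (\<lambda>x. U x t) \<in> sobolev j \<and>
      ?D t \<le> c0 * (1 + t) powr (- 1/12 - real j / 6) * ?L1 + c0 * exp (- (c / 2) * t) * ?L2"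
      unfolding exponential(1) w1 by blast
    show ?thesis
      by (rule exI[of _ c0], intro conjI c(1), rule exI[of _ "c / 2"]) (use exponential c * in simp)
  next
    case neq1
    have "gap_rate \<epsilon>\<^sub>0 ?eq r = 1 / r ^ 4" if "1 < r" for r
      using neq1 that by (auto simp: gap_rate_def)
    from algebraic[OF this zero_less_numeral] obtain c0 where c: "c0 > 0" and *: "\<forall>t\<ge>0. (\<lambda>x. U x t) \<in> sobolev j \<and>
      ?D t \<le> c0 * (1 + t) powr (- 1/12 - real j / 6) * ?L1 + c0 * (1 + t) powr (- real l / 4) * ?L2"
      unfolding neq1(1) w1 of_nat_numeral by blast
    \<comment> \<open>Only the exponential case involves \<open>c\<^sub>1\<close>, so any positive
      witness, here 1, will do.\<close>
    show ?thesis
      by (rule exI[of _ c0], intro conjI c(1), rule exI[of _ 1]) (use neq1 * in auto)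
  next
    case eq0
    have "gap_rate \<epsilon>\<^sub>0 ?eq r = 1 / r ^ 2" if "1 < r" for r
      using eq0 that by (auto simp: gap_rate_def)
    from algebraic[OF this zero_less_numeral] obtain c0 where c: "c0 > 0" and *: "\<forall>t\<ge>0. (\<lambda>x. U x t) \<in> sobolev j \<and>
      ?D t \<le> c0 * (1 + t) powr (- 1/8 - real j / 4) * ?L1 + c0 * (1 + t) powr (- real l / 2) * ?L2"
      unfolding eq0(1) w0 of_nat_numeral by blast
    show ?thesis
      by (rule exI[of _ c0], intro conjI c(1), rule exI[of _ 1]) (use eq0 * in simp)
  next
    case neq0
    have "gap_rate \<epsilon>\<^sub>0 ?eq r = 1 / r ^ 4" if "1 < r" for r
      using neq0 that by (auto simp: gap_rate_def)
    from algebraic[OF this zero_less_numeral] obtain c0 where c: "c0 > 0" and *: "\<forall>t\<ge>0. (\<lambda>x. U x t) \<in> sobolev j \<and>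
      ?D t \<le> c0 * (1 + t) powr (- 1/8 - real j / 4) * ?L1 + c0 * (1 + t) powr (- real l / 4) * ?L2"
      unfolding neq0(1) w0 of_nat_numeral by blast
    show ?thesis
      by (rule exI[of _ c0], intro conjI c(1), rule exI[of _ 1]) (use neq0 * in auto)
  qed
qed

end
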